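(* Let $P$ be a random homogeneous polynomial of degree $d$ in three complex variables distributed according to $\mu_d$, and let $Z(P)\subset \mathbb{C}P^2$ be its zero locus equipped with the restriction $g_{FS|Z(P)}$ of the Fubini-Study metric, with Gaussian curvature $K$. Then $$\mu_d\left[\sup_{x\in Z(P)}|K(x)|\ \leq\ d^{5}\right]\ \longrightarrow\ 1\qquad\text{as } d\to\infty .$$
   Context: $\mathbb{C}_d^{hom}[X_0,X_1,X_2]$ is the space of complex homogeneous polynomials of degree $d$ in three variables and $N_d$ is its complex dimension. The random polynomial is $$P=\sum_{i+j+k=d} a_{i,j,k}\sqrt{\frac{(d+2)!}{2\, i!j!k!}}\,X_0^iX_1^jX_2^k,$$ where the coefficient vector $(a_{i,j,k})_{i+j+k=d}$ is chosen uniformly on $\mathbb{C}P^{N_d-1}$ for the Fubini-Study measure (equivalently, uniformly on the unit sphere $\mathbb{S}^{2N_d-1}\subset\mathbb{C}^{N_d}$); $\mu_d$ denotes the resulting probability measure. Almost surely $Z(P)=\{P=0\}\subset\mathbb{C}P^2$ is a smooth connected compact Riemann surface of genus $\frac12(d-1)(d-2)$. $g_{FS}$ is the Fubini-Study metric on $\mathbb{C}P^2$, i.e. the Kähler metric associated with the curvature form of the standard metric on $\mathcal{O}(1)$ (so that a complex line has area $1$). *)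

theory Defs
  imports "HOL-Analysis.Analysis"
begin

text \<open>A point of the projective plane is a complex line through the origin of complex 3-space.
  \<open>vec.span\<close> is the span over the complex scalars (\<open>span\<close> would be the real one).\<close>

definition proj :: "complex^3 \<Rightarrow> (complex^3) set" where
  "proj v = vec.span {v}"

definition CP2 :: "(complex^3) set set" where
  "CP2 = proj ` (- {0})"

definition CP2_topology :: "(complex^3) set topology" where
  "CP2_topology = topology (\<lambda>W. W \<subseteq> CP2 \<and> open {v. v \<noteq> 0 \<and> proj v \<in> W})"

lemma openin_CP2_topology:
  "openin CP2_topology W \<longleftrightarrow> W \<subseteq> CP2 \<and> open {v. v \<noteq> 0 \<and> proj v \<in> W}"
proof -
  have "istopology (\<lambda>W. W \<subseteq> CP2 \<and> open {v. v \<noteq> 0 \<and> proj v \<in> W})"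
    unfolding istopology_def
  proof (intro conjI allI impI)
    fix S T
    assume "S \<subseteq> CP2 \<and> open {v. v \<noteq> 0 \<and> proj v \<in> S}"
      and "T \<subseteq> CP2 \<and> open {v. v \<noteq> 0 \<and> proj v \<in> T}"
    moreover have "{v. v \<noteq> 0 \<and> proj v \<in> S \<inter> T}
        = {v. v \<noteq> 0 \<and> proj v \<in> S} \<inter> {v. v \<noteq> 0 \<and> proj v \<in> T}"
      by auto
    ultimately show "S \<inter> T \<subseteq> CP2" "open {v. v \<noteq> 0 \<and> proj v \<in> S \<inter> T}"
      by auto
  next
    fix \<K>
    assume \<K>: "\<forall>S\<in>\<K>. S \<subseteq> CP2 \<and> open {v. v \<noteq> 0 \<and> proj v \<in> S}"
    then show "\<Union> \<K> \<subseteq> CP2"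
      by auto
    have "{v. v \<noteq> 0 \<and> proj v \<in> \<Union> \<K>} = (\<Union>S\<in>\<K>. {v. v \<noteq> 0 \<and> proj v \<in> S})"
      by auto
    with \<K> show "open {v. v \<noteq> 0 \<and> proj v \<in> \<Union> \<K>}"
      by auto
  qed
  then show ?thesis
    by (simp add: CP2_topology_def topology_inverse')
qed

definition herm :: "complex^3 \<Rightarrow> complex^3 \<Rightarrow> complex" where
  "herm v w = (\<Sum>i\<in>UNIV. v $ i * cnj (w $ i))"

text \<open>The metric at the point \<open>proj v\<close>, evaluated on the images of \<open>w\<^sub>1\<close> and \<open>w\<^sub>2\<close> under the
  differential of \<open>proj\<close> at \<open>v\<close>. It is the Riemannian metric of the Kaehler form
  \<open>(i / 2\<pi>) \<partial> \<partial>bar log |v|\<^sup>2\<close>. On an affine line with coordinate \<open>z\<close> it restricts to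
  \<open>|dz|\<^sup>2 / (\<pi> (1 + |z|\<^sup>2)\<^sup>2)\<close>, so that projective lines have area 1.\<close>

definition fubini_study :: "complex^3 \<Rightarrow> complex^3 \<Rightarrow> complex^3 \<Rightarrow> real" where
  "fubini_study v w\<^sub>1 w\<^sub>2 =
     1 / pi * Re (herm w\<^sub>1 w\<^sub>2 / herm v v - herm w\<^sub>1 v * herm v w\<^sub>2 / (herm v v)\<^sup>2)"

text \<open>Points of the coordinate domain are complex numbers \<open>x + \<i> y\<close>; the coordinate directions
  are \<open>1\<close> and \<open>\<i>\<close>.\<close>

definition dir :: "2 \<Rightarrow> complex" where
  "dir i = (if i = 1 then 1 else \<i>)"

definition pd :: "2 \<Rightarrow> (complex \<Rightarrow> real) \<Rightarrow> complex \<Rightarrow> real" where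
  "pd i f z = frechet_derivative f (at z) (dir i)"

definition christoffel :: "(complex \<Rightarrow> real^2^2) \<Rightarrow> 2 \<Rightarrow> 2 \<Rightarrow> 2 \<Rightarrow> complex \<Rightarrow> real" where
  "christoffel g k i j z = 1 / 2 * (\<Sum>l\<in>UNIV. matrix_inv (g z) $ k $ l *
     (pd i (\<lambda>w. g w $ j $ l) z + pd j (\<lambda>w. g w $ i $ l) z - pd l (\<lambda>w. g w $ i $ j) z))"

text \<open>\<open>riemann g i j k l\<close> is the component along \<open>\<partial>\<^sub>l\<close> of \<open>R(\<partial>\<^sub>i, \<partial>\<^sub>j) \<partial>\<^sub>k\<close>, where
  \<open>R(X, Y) = [\<nabla>\<^sub>X, \<nabla>\<^sub>Y] - \<nabla>\<^bsub>[X, Y]\<^esub>\<close>.\<close>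

definition riemann :: "(complex \<Rightarrow> real^2^2) \<Rightarrow> 2 \<Rightarrow> 2 \<Rightarrow> 2 \<Rightarrow> 2 \<Rightarrow> complex \<Rightarrow> real" where
  "riemann g i j k l z =
     pd i (christoffel g l j k) z - pd j (christoffel g l i k) z
     + (\<Sum>m\<in>UNIV. christoffel g m j k z * christoffel g l i m z
                - christoffel g m i k z * christoffel g l j m z)"

text \<open>\<open>g(R(\<partial>\<^sub>1, \<partial>\<^sub>2) \<partial>\<^sub>2, \<partial>\<^sub>1) / det g\<close>\<close>

definition metric_curvature :: "(complex \<Rightarrow> real^2^2) \<Rightarrow> complex \<Rightarrow> real" where
  "metric_curvature g z = (\<Sum>l\<in>UNIV. g z $ l $ 1 * riemann g 1 2 2 l z) / det (g z)"

text \<open>\<open>F\<close> is a lift to complex 3-space of the inverse \<open>proj \<circ> F\<close> of a holomorphic chart of \<open>S\<close>, as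
  an embedded complex curve: an immersion and a homeomorphism onto a relatively open part of \<open>S\<close>.
  As the kernel of the differential of \<open>proj\<close> at \<open>v\<close> is the line \<open>proj v\<close>, the last
  conjunct says that the differential of \<open>proj \<circ> F\<close> does not vanish.\<close>

definition local_parametrization ::
  "(complex^3) set set \<Rightarrow> complex set \<Rightarrow> (complex \<Rightarrow> complex^3) \<Rightarrow> bool" where
  "local_parametrization S U F \<longleftrightarrow>
     open U \<and> (\<forall>i. (\<lambda>z. F z $ i) holomorphic_on U) \<and> (\<forall>z\<in>U. F z \<noteq> 0) \<and>
     openin (subtopology CP2_topology S) ((proj \<circ> F) ` U) \<and>
     embedding_map (top_of_set U) CP2_topology (proj \<circ> F) \<and>
     (\<forall>z\<in>U. frechet_derivative F (at z) 1 \<notin> proj (F z))"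

definition induced_metric :: "(complex \<Rightarrow> complex^3) \<Rightarrow> complex \<Rightarrow> real^2^2" where
  "induced_metric F z = (\<chi> i j. fubini_study (F z)
     (frechet_derivative F (at z) (dir i)) (frechet_derivative F (at z) (dir j)))"

definition gauss_curvature :: "(complex^3) set set \<Rightarrow> (complex^3) set \<Rightarrow> real" where
  "gauss_curvature S x = (THE k. \<exists>U F z. local_parametrization S U F \<and> z \<in> U \<and> proj (F z) = x \<and>
     k = metric_curvature (induced_metric F) z)"

definition exponents :: "nat \<Rightarrow> (nat \<times> nat \<times> nat) set" where
  "exponents d = {(i, j, k). i + j + k = d}"

text \<open>\<open>X\<^sub>0, X\<^sub>1, X\<^sub>2\<close> are the coordinates \<open>1, 2, 3\<close> of a vector.\<close>

definition hpoly :: "nat \<Rightarrow> (nat \<times> nat \<times> nat \<Rightarrow> complex) \<Rightarrow> complex^3 \<Rightarrow> complex" where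
  "hpoly d a v = (\<Sum>(i, j, k)\<in>exponents d.
     a (i, j, k) * of_real (sqrt (fact (d + 2) / (2 * fact i * fact j * fact k)))
       * (v $ 1) ^ i * (v $ 2) ^ j * (v $ 3) ^ k)"

definition zero_locus :: "(complex^3 \<Rightarrow> complex) \<Rightarrow> (complex^3) set set" where
  "zero_locus P = proj ` {v. v \<noteq> 0 \<and> P v = 0}"

text \<open>Smoothness as a scheme: a zero locus with multiplicities is not smooth.\<close>

definition smooth_curve :: "(complex^3 \<Rightarrow> complex) \<Rightarrow> bool" where
  "smooth_curve P \<longleftrightarrow> (\<forall>v. v \<noteq> 0 \<and> P v = 0 \<longrightarrow> \<not> (P has_derivative (\<lambda>_. 0)) (at v))"

text \<open>The normalised surface measure of the unit sphere of \<open>\<complex>\<^sup>I\<close>, as the image of the uniform measure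
  on the unit ball under radial projection. The origin, where the radial projection is not
  defined (the term below gives it the value 0), is a null set if \<open>I\<close> is finite and nonempty.\<close>

definition unit_ball :: "'i set \<Rightarrow> ('i \<Rightarrow> complex) set" where
  "unit_ball I = {a \<in> extensional I. L2_set (\<lambda>i. norm (a i)) I \<le> 1}"

definition uniform_sphere :: "'i set \<Rightarrow> ('i \<Rightarrow> complex) measure" where
  "uniform_sphere I =
     distr (uniform_measure (\<Pi>\<^sub>M i\<in>I. lborel) (unit_ball I)) (\<Pi>\<^sub>M i\<in>I. borel)
       (\<lambda>a. \<lambda>i\<in>I. a i / of_real (L2_set (\<lambda>j. norm (a j)) I))"

definition mu :: "nat \<Rightarrow> (nat \<times> nat \<times> nat \<Rightarrow> complex) measure" where
  "mu d = uniform_sphere (exponents d)"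

lemma sets_unit_ball:
  assumes "finite I"
  shows "unit_ball I \<in> sets (\<Pi>\<^sub>M i\<in>I. lborel)"
proof -
  have "unit_ball I = {a \<in> space (\<Pi>\<^sub>M i\<in>I. lborel). sqrt (\<Sum>i\<in>I. (norm (a i))\<^sup>2) \<le> 1}"
    by (auto simp: unit_ball_def space_PiM PiE_def L2_set_def)
  also have "\<dots> \<in> sets (\<Pi>\<^sub>M i\<in>I. lborel)"
    by measurable
  finally show ?thesis .
qed

lemma emeasure_unit_ball:
  assumes "finite I"
  shows "emeasure (\<Pi>\<^sub>M i\<in>I. lborel) (unit_ball I) \<noteq> 0"
    and "emeasure (\<Pi>\<^sub>M i\<in>I. lborel) (unit_ball I) \<noteq> \<infinity>"
proof -
  interpret product_sigma_finite "\<lambda>_. lborel :: complex measure"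
    by (simp add: product_sigma_finite_def sigma_finite_lborel)
  define r where "r = 1 / (1 + real (card I))"
  have r: "0 < r"
    by (simp add: r_def)
  have le: "real (card I) * r \<le> 1"
    by (simp add: r_def)
  have "(\<Pi>\<^sub>E i\<in>I. ball 0 r) \<subseteq> unit_ball I"
  proof
    fix a :: "'a \<Rightarrow> complex"
    assume a: "a \<in> (\<Pi>\<^sub>E i\<in>I. ball 0 r)"
    have "L2_set (\<lambda>i. norm (a i)) I \<le> (\<Sum>i\<in>I. norm (a i))"
      by (rule L2_set_le_sum) simp
    also have "\<dots> \<le> real (card I) * r"
      using a by (intro sum_bounded_above) (auto simp: PiE_def Pi_def less_imp_le)
    finally show "a \<in> unit_ball I"
      using a le by (auto simp: unit_ball_def PiE_def)
  qed
  then have "emeasure (\<Pi>\<^sub>M i\<in>I. lborel) (\<Pi>\<^sub>E i\<in>I. ball (0 :: complex) r)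
      \<le> emeasure (\<Pi>\<^sub>M i\<in>I. lborel) (unit_ball I :: ('a \<Rightarrow> complex) set)"
    using sets_unit_ball[OF assms] by (intro emeasure_mono) auto
  moreover have "emeasure (\<Pi>\<^sub>M i\<in>I. lborel) (\<Pi>\<^sub>E i\<in>I. ball (0 :: complex) r)
      = (\<Prod>i\<in>I. emeasure lborel (ball (0 :: complex) r))"
    using assms by (intro emeasure_PiM) auto
  moreover have "emeasure lborel (ball (0 :: complex) r) \<noteq> 0"
  proof
    assume "emeasure lborel (ball (0 :: complex) r) = 0"
    then have "ball (0 :: complex) r \<in> null_sets lborel"
      by auto
    then show False
      using r open_not_negligible[of "ball (0 :: complex) r"]
      by (auto simp: negligible_iff_null_sets null_sets_completionI)
  qed
  ultimately show "emeasure (\<Pi>\<^sub>M i\<in>I. lborel) (unit_ball I :: ('a \<Rightarrow> complex) set) \<noteq> 0"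
    using assms by auto
  have "unit_ball I \<subseteq> (\<Pi>\<^sub>E i\<in>I. cball (0 :: complex) 1)"
    using assms by (auto simp: unit_ball_def PiE_def intro: order_trans[OF member_le_L2_set])
  then have "emeasure (\<Pi>\<^sub>M i\<in>I. lborel) (unit_ball I)
      \<le> emeasure (\<Pi>\<^sub>M i\<in>I. lborel) (\<Pi>\<^sub>E i\<in>I. cball (0 :: complex) 1)"
    using assms by (intro emeasure_mono) auto
  also have "\<dots> = (\<Prod>i\<in>I. emeasure lborel (cball (0 :: complex) 1))"
    using assms by (intro emeasure_PiM) auto
  also have "\<dots> < \<infinity>"
    using emeasure_bounded_finite[of "cball (0 :: complex) 1"]
    by (simp add: power_less_top_ennreal)
  finally show "emeasure (\<Pi>\<^sub>M i\<in>I. lborel) (unit_ball I :: ('a \<Rightarrow> complex) set) \<noteq> \<infinity>"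
    by simp
qed

lemma emeasure_uniform_sphere_space:
  assumes "finite I"
  shows "emeasure (uniform_sphere I) (space (uniform_sphere I)) = 1"
proof -
  let ?L = "\<Pi>\<^sub>M i\<in>I. lborel :: complex measure"
  have "(\<lambda>a. \<lambda>i\<in>I. a i / of_real (sqrt (\<Sum>i\<in>I. (norm (a i))\<^sup>2)))
      \<in> ?L \<rightarrow>\<^sub>M (\<Pi>\<^sub>M i\<in>I. borel)"
    by measurable
  then have meas: "(\<lambda>a. \<lambda>i\<in>I. a i / of_real (L2_set (\<lambda>j. norm (a j)) I))
      \<in> uniform_measure ?L (unit_ball I) \<rightarrow>\<^sub>M (\<Pi>\<^sub>M i\<in>I. borel)"
    by (simp add: L2_set_def measurable_def)
  have "emeasure (uniform_sphere I) (space (uniform_sphere I))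
      = emeasure (uniform_measure ?L (unit_ball I)) (space ?L)"
    unfolding uniform_sphere_def
    by (subst emeasure_distr[OF meas])
      (use measurable_space[OF meas] in \<open>auto intro!: arg_cong2[where f = emeasure]\<close>)
  also have "\<dots> = emeasure ?L (unit_ball I) / emeasure ?L (unit_ball I)"
    using sets.sets_into_space[OF sets_unit_ball[OF assms]]
    by (simp add: emeasure_uniform_measure sets_unit_ball[OF assms] Int_absorb2)
  also have "\<dots> = 1"
    using emeasure_unit_ball[OF assms] by (simp add: ennreal_divide_self top.not_eq_extremum)
  finally show ?thesis .
qed

lemma finite_exponents: "finite (exponents d)"
  by (rule finite_subset[of _ "{..d} \<times> {..d} \<times> {..d}"]) (auto simp: exponents_def)

lemma emeasure_mu_space: "emeasure (mu d) (space (mu d)) = 1"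
  by (simp add: mu_def emeasure_uniform_sphere_space finite_exponents)

end

theory Submission
  imports Defs "HOL-Probability.Probability" "HOL-Complex_Analysis.Complex_Analysis"
begin

text \<open>
  For a local lift \<open>F\<close> of the curve the metric is conformal with factor
  \<open>|F \<and> F'|\<^sup>2 / (\<pi> |F|\<^sup>4)\<close>, and differentiating \<open>P(F) = 0\<close> twice turns its curvature into
  \<open>K = 4 \<pi> - 2 \<pi> |Hess P (W, W)|\<^sup>2 / (|v|\<^sup>2 |grad P|\<^sup>6)\<close> with \<open>W = conj v \<times> grad P\<close>.
  Large curvature thus means a small gradient at a zero, compared with the second derivatives, which
  Cauchy's estimates bound by \<open>d\<close> times the maximum of \<open>|P|\<close> on the sphere. The condition is invariant
  under scaling of \<open>P\<close>, so the uniform measure on the sphere may be replaced by a Gaussian one.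
  With \<open>N\<close> the number of coefficients, the maximum of \<open>|P|\<close> exceeds \<open>sqrt N\<close> at most by a small
  power of \<open>d\<close> with high probability, by Gaussian tails on a net of polynomial size. A zero with small gradient makes the value and the tangential derivatives of \<open>P\<close>
  small at a point of a net with about \<open>d ^ 15\<close> elements; as these are three orthogonal linear
  forms in the coefficients, this has probability about \<open>d ^ (-16)\<close> at each point of the net.
\<close>

section \<open>Derivatives of homogeneous polynomials\<close>

text \<open>The exponents close with one power of d to spare. The 15 is six times 5/2: the net is
  cut out of a grid of mesh d^(-5/2) in all six real dimensions of the ambient space, although the
  projective plane has only four. The 16 counts squares: up to powers of m and constants, the value
  at a net point is d^(-4) standard deviations and each of the two tangential derivatives d^(-2).
  The value gains a factor \<open>mesh d\<close> over the derivatives because the expansion is made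
  at a nearby zero; a tangential derivative costs sqrt d and not d, since a displacement orthogonal
  to a unit vector changes the norm only to second order. Two features of the statement add work.
  \<open>gauss_curvature\<close> is a definite description, so at every point a chart has to exist
  and all charts have to agree; and the event quantifies over uncountably many points, so its
  measurability is proved separately. Singular polynomials need no argument of their own: a
  vanishing gradient is an extreme case of a small one, and the same estimate covers it.\<close>

definition mon :: "nat \<times> nat \<times> nat \<Rightarrow> complex^3 \<Rightarrow> complex" where
  "mon = (\<lambda>(i, j, k) v. (v $ 1) ^ i * (v $ 2) ^ j * (v $ 3) ^ k)"

text \<open>Where an exponent is 0, the truncated \<open>i - 1\<close> leaves a wrong monomial, but
  the factor \<open>of_nat i\<close> removes it; likewise in \<open>d2mon\<close>. This is why the
  homogeneity and Euler lemmas split on zero exponents.\<close>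

definition dmon :: "nat \<times> nat \<times> nat \<Rightarrow> complex^3 \<Rightarrow> complex^3 \<Rightarrow> complex" where
  "dmon = (\<lambda>(i, j, k) v w. of_nat i * mon (i - 1, j, k) v * w $ 1
     + of_nat j * mon (i, j - 1, k) v * w $ 2 + of_nat k * mon (i, j, k - 1) v * w $ 3)"

definition d2mon :: "nat \<times> nat \<times> nat \<Rightarrow> complex^3 \<Rightarrow> complex^3 \<Rightarrow> complex^3 \<Rightarrow> complex" where
  "d2mon = (\<lambda>(i, j, k) v w u. of_nat i * dmon (i - 1, j, k) v u * w $ 1
     + of_nat j * dmon (i, j - 1, k) v u * w $ 2 + of_nat k * dmon (i, j, k - 1) v u * w $ 3)"

definition weight :: "nat \<Rightarrow> nat \<times> nat \<times> nat \<Rightarrow> real" where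
  "weight d = (\<lambda>(i, j, k). sqrt (fact (d + 2) / (2 * fact i * fact j * fact k)))"

definition dhpoly :: "nat \<Rightarrow> (nat \<times> nat \<times> nat \<Rightarrow> complex) \<Rightarrow> complex^3 \<Rightarrow> complex^3 \<Rightarrow> complex" where
  "dhpoly d a v w = (\<Sum>\<alpha>\<in>exponents d. a \<alpha> * of_real (weight d \<alpha>) * dmon \<alpha> v w)"

definition d2hpoly ::
  "nat \<Rightarrow> (nat \<times> nat \<times> nat \<Rightarrow> complex) \<Rightarrow> complex^3 \<Rightarrow> complex^3 \<Rightarrow> complex^3 \<Rightarrow> complex" where
  "d2hpoly d a v w u = (\<Sum>\<alpha>\<in>exponents d. a \<alpha> * of_real (weight d \<alpha>) * d2mon \<alpha> v w u)"

text \<open>Complex partial derivatives without conjugation: the pairing with a direction is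
  bilinear, not Hermitian.\<close>

definition grad :: "nat \<Rightarrow> (nat \<times> nat \<times> nat \<Rightarrow> complex) \<Rightarrow> complex^3 \<Rightarrow> complex^3" where
  "grad d a v = (\<chi> m. dhpoly d a v (axis m 1))"

lemma hpoly_eq: "hpoly d a v = (\<Sum>\<alpha>\<in>exponents d. a \<alpha> * of_real (weight d \<alpha>) * mon \<alpha> v)"
  unfolding hpoly_def weight_def mon_def by (intro sum.cong) (auto simp: algebra_simps)

lemma has_derivative_vec_nth: "((\<lambda>x::complex^3. x $ i) has_derivative (\<lambda>h. h $ i)) F"
  by (rule bounded_linear_imp_has_derivative[OF bounded_linear_vec_nth])

lemma bounded_linear_scalar_vec: "bounded_linear (\<lambda>s::complex. s *s (w::complex^3))"
  unfolding linear_conv_bounded_linear[symmetric]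
  by (intro linearI) (simp_all add: vec_eq_iff algebra_simps)

lemma has_derivative_line: "((\<lambda>s. v + s *s (w::complex^3)) has_derivative (\<lambda>h. h *s w)) F"
  using has_derivative_add[OF has_derivative_const[of v] bounded_linear_imp_has_derivative[OF bounded_linear_scalar_vec]]
  by simp

lemma has_derivative_mon: "(mon \<alpha> has_derivative dmon \<alpha> v) (at v)"
proof -
  obtain i j k where \<alpha>: "\<alpha> = (i, j, k)" by (cases \<alpha>)
  have "((\<lambda>v::complex^3. (v $ 1) ^ i * (v $ 2) ^ j * (v $ 3) ^ k) has_derivative dmon (i, j, k) v) (at v)"
    by (auto intro!: derivative_eq_intros has_derivative_vec_nth simp: dmon_def mon_def algebra_simps)
  then show ?thesis by (simp add: \<alpha> mon_def)
qed

lemma has_derivative_dmon: "((\<lambda>v. dmon \<alpha> v w) has_derivative d2mon \<alpha> v w) (at v)"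
proof -
  obtain i j k where \<alpha>: "\<alpha> = (i, j, k)" by (cases \<alpha>)
  show ?thesis unfolding \<alpha> dmon_def d2mon_def prod.case
    by (auto intro!: derivative_eq_intros has_derivative_mon simp: dmon_def)
qed

lemma dmon_linear:
  "dmon \<alpha> v (w + w') = dmon \<alpha> v w + dmon \<alpha> v w'" "dmon \<alpha> v (c *s w) = c * dmon \<alpha> v w"
  by (cases \<alpha>; simp add: dmon_def algebra_simps)+

lemma d2mon_linear:
  "d2mon \<alpha> v (w + w') u = d2mon \<alpha> v w u + d2mon \<alpha> v w' u" "d2mon \<alpha> v (c *s w) u = c * d2mon \<alpha> v w u"
  "d2mon \<alpha> v w (u + u') = d2mon \<alpha> v w u + d2mon \<alpha> v w u'" "d2mon \<alpha> v w (c *s u) = c * d2mon \<alpha> v w u"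
  by (cases \<alpha>; simp add: d2mon_def dmon_linear algebra_simps)+

lemma d2mon_commute: "d2mon \<alpha> v w u = d2mon \<alpha> v u w"
proof -
  obtain i j k where \<alpha>: "\<alpha> = (i, j, k)" by (cases \<alpha>)
  show ?thesis by (simp add: \<alpha> d2mon_def dmon_def algebra_simps)
qed

lemma dhpoly_linear:
  "dhpoly d a v (w + w') = dhpoly d a v w + dhpoly d a v w'" "dhpoly d a v (c *s w) = c * dhpoly d a v w"
  by (simp_all add: dhpoly_def dmon_linear algebra_simps sum.distrib sum_distrib_left)

lemma d2hpoly_linear:
  "d2hpoly d a v (w + w') u = d2hpoly d a v w u + d2hpoly d a v w' u"
  "d2hpoly d a v (c *s w) u = c * d2hpoly d a v w u"
  "d2hpoly d a v w (u + u') = d2hpoly d a v w u + d2hpoly d a v w u'"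
  "d2hpoly d a v w (c *s u) = c * d2hpoly d a v w u"
  by (simp_all add: d2hpoly_def d2mon_linear algebra_simps sum.distrib sum_distrib_left)

lemma d2hpoly_commute: "d2hpoly d a v w u = d2hpoly d a v u w"
  unfolding d2hpoly_def by (subst d2mon_commute) simp

lemma has_derivative_hpoly: "(hpoly d a has_derivative dhpoly d a v) (at v)"
proof -
  have "((\<lambda>v. \<Sum>\<alpha>\<in>exponents d. a \<alpha> * of_real (weight d \<alpha>) * mon \<alpha> v) has_derivative dhpoly d a v) (at v)"
    unfolding dhpoly_def
    by (auto intro!: derivative_eq_intros has_derivative_mon)
  moreover have "(\<lambda>v. \<Sum>\<alpha>\<in>exponents d. a \<alpha> * of_real (weight d \<alpha>) * mon \<alpha> v) = hpoly d a"
    by (rule ext) (simp add: hpoly_eq)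
  ultimately show ?thesis by simp
qed

lemma has_derivative_dhpoly: "((\<lambda>v. dhpoly d a v w) has_derivative d2hpoly d a v w) (at v)"
  unfolding dhpoly_def d2hpoly_def by (auto intro!: derivative_eq_intros has_derivative_dmon)

lemma hpoly_line:
  "((\<lambda>s. hpoly d a (v + s *s w)) has_field_derivative dhpoly d a (v + s *s w) w) (at s)"
proof -
  have "((\<lambda>s. v + s *s w) has_derivative (\<lambda>h. h *s w)) (at s)"
    by (rule has_derivative_line)
  from has_derivative_compose[OF this has_derivative_hpoly]
  show ?thesis unfolding has_field_derivative_def
    by (rule has_derivative_eq_rhs) (simp add: dhpoly_linear fun_eq_iff)
qed

lemma dhpoly_line:
  "((\<lambda>s. dhpoly d a (v + s *s w) u) has_field_derivative d2hpoly d a (v + s *s w) u w) (at s)"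
proof -
  have "((\<lambda>s. v + s *s w) has_derivative (\<lambda>h. h *s w)) (at s)"
    by (rule has_derivative_line)
  from has_derivative_compose[OF this has_derivative_dhpoly]
  show ?thesis unfolding has_field_derivative_def
    by (rule has_derivative_eq_rhs) (simp add: d2hpoly_linear fun_eq_iff)
qed

section \<open>Homogeneity and Euler's identities\<close>

lemma mon_scale: "mon (i, j, k) (c *s v) = c ^ (i + j + k) * mon (i, j, k) v"
  by (simp add: mon_def power_mult_distrib power_add)

lemma dmon_scale: "dmon (i, j, k) (c *s v) w = c ^ (i + j + k - 1) * dmon (i, j, k) v w"
proof -
  have "of_nat i * mon (i - 1, j, k) (c *s v) = c ^ (i + j + k - 1) * (of_nat i * mon (i - 1, j, k) v)"
    by (cases i) (auto simp: mon_scale)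
  moreover have "of_nat j * mon (i, j - 1, k) (c *s v) = c ^ (i + j + k - 1) * (of_nat j * mon (i, j - 1, k) v)"
    by (cases j) (auto simp: mon_scale)
  moreover have "of_nat k * mon (i, j, k - 1) (c *s v) = c ^ (i + j + k - 1) * (of_nat k * mon (i, j, k - 1) v)"
    by (cases k) (auto simp: mon_scale)
  ultimately show ?thesis
    by (simp only: dmon_def prod.case distrib_left mult.assoc[symmetric])
qed

lemma d2mon_scale: "d2mon (i, j, k) (c *s v) w u = c ^ (i + j + k - 2) * d2mon (i, j, k) v w u"
proof -
  have "of_nat i * dmon (i - 1, j, k) (c *s v) u = c ^ (i + j + k - 2) * (of_nat i * dmon (i - 1, j, k) v u)"
    by (cases i) (auto simp: dmon_scale)
  moreover have "of_nat j * dmon (i, j - 1, k) (c *s v) u = c ^ (i + j + k - 2) * (of_nat j * dmon (i, j - 1, k) v u)"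
    by (cases j) (auto simp: dmon_scale)
  moreover have "of_nat k * dmon (i, j, k - 1) (c *s v) u = c ^ (i + j + k - 2) * (of_nat k * dmon (i, j, k - 1) v u)"
    by (cases k) (auto simp: dmon_scale)
  ultimately show ?thesis
    by (simp only: d2mon_def prod.case distrib_left mult.assoc[symmetric])
qed

lemma hpoly_scale: "hpoly d a (c *s v) = c ^ d * hpoly d a v"
  unfolding hpoly_eq sum_distrib_left
  by (intro sum.cong) (auto simp: exponents_def mon_scale)

lemma dhpoly_scale: "dhpoly d a (c *s v) w = c ^ (d - 1) * dhpoly d a v w"
  unfolding dhpoly_def sum_distrib_left
  by (intro sum.cong) (auto simp: exponents_def dmon_scale)

lemma d2hpoly_scale: "d2hpoly d a (c *s v) w u = c ^ (d - 2) * d2hpoly d a v w u"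
  unfolding d2hpoly_def sum_distrib_left
  by (intro sum.cong) (auto simp: exponents_def d2mon_scale)

lemma dmon_euler: "dmon (i, j, k) v v = of_nat (i + j + k) * mon (i, j, k) v"
proof -
  have "of_nat i * mon (i - 1, j, k) v * v $ 1 = of_nat i * mon (i, j, k) v"
    by (cases i) (auto simp: mon_def)
  moreover have "of_nat j * mon (i, j - 1, k) v * v $ 2 = of_nat j * mon (i, j, k) v"
    by (cases j) (auto simp: mon_def)
  moreover have "of_nat k * mon (i, j, k - 1) v * v $ 3 = of_nat k * mon (i, j, k) v"
    by (cases k) (auto simp: mon_def)
  ultimately show ?thesis
    by (simp only: dmon_def prod.case of_nat_add distrib_right)
qed

lemma dhpoly_euler: "dhpoly d a v v = of_nat d * hpoly d a v"
  unfolding hpoly_eq dhpoly_def sum_distrib_left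
  by (intro sum.cong) (auto simp: exponents_def dmon_euler)

lemma d2mon_euler: "d2mon (i, j, k) v w v = of_nat (i + j + k - 1) * dmon (i, j, k) v w"
proof -
  have "of_nat i * dmon (i - 1, j, k) v v = of_nat (i + j + k - 1) * (of_nat i * mon (i - 1, j, k) v)"
    by (cases i) (auto simp: dmon_euler)
  moreover have "of_nat j * dmon (i, j - 1, k) v v = of_nat (i + j + k - 1) * (of_nat j * mon (i, j - 1, k) v)"
    by (cases j) (auto simp: dmon_euler)
  moreover have "of_nat k * dmon (i, j, k - 1) v v = of_nat (i + j + k - 1) * (of_nat k * mon (i, j, k - 1) v)"
    by (cases k) (auto simp: dmon_euler)
  ultimately have "d2mon (i, j, k) v w v = of_nat (i + j + k - 1) * (of_nat i * mon (i - 1, j, k) v * w $ 1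
      + of_nat j * mon (i, j - 1, k) v * w $ 2 + of_nat k * mon (i, j, k - 1) v * w $ 3)"
    by (simp only: d2mon_def prod.case distrib_left mult.assoc[symmetric])
  then show ?thesis
    by (simp only: dmon_def prod.case)
qed

text \<open>A Hessian with a radial slot reduces to a first derivative. Where that derivative
  vanishes, as on directions tangent to the curve, radial components may be added to the arguments
  of the Hessian freely.\<close>

lemma d2hpoly_euler: "d2hpoly d a v w v = of_nat (d - 1) * dhpoly d a v w"
  unfolding dhpoly_def d2hpoly_def sum_distrib_left
  by (intro sum.cong) (auto simp: exponents_def d2mon_euler)

lemma dhpoly_grad: "dhpoly d a v w = (\<Sum>m\<in>UNIV. grad d a v $ m * w $ m)"
proof -
  have "w = w $ 1 *s axis 1 1 + w $ 2 *s axis 2 1 + w $ 3 *s axis 3 1"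
    by (simp add: vec_eq_iff forall_3 axis_def)
  then have "dhpoly d a v w = dhpoly d a v (w $ 1 *s axis 1 1 + w $ 2 *s axis 2 1 + w $ 3 *s axis 3 1)"
    by simp
  also have "\<dots> = (\<Sum>m\<in>UNIV. grad d a v $ m * w $ m)"
    unfolding dhpoly_linear by (simp add: grad_def sum_3)
  finally show ?thesis .
qed

lemma grad_scale: "grad d a (c *s v) = c ^ (d - 1) *s grad d a v"
  by (simp add: grad_def vec_eq_iff dhpoly_scale)

lemma has_derivative_hpoly_0_iff:
  "(hpoly d a has_derivative (\<lambda>_. 0)) (at v) \<longleftrightarrow> grad d a v = 0"
proof
  assume "(hpoly d a has_derivative (\<lambda>_. 0)) (at v)"
  from has_derivative_unique[OF this has_derivative_hpoly] show "grad d a v = 0"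
    by (simp add: grad_def vec_eq_iff fun_eq_iff)
next
  assume "grad d a v = 0"
  then have "dhpoly d a v = (\<lambda>_. 0)"
    by (auto simp: dhpoly_grad)
  then show "(hpoly d a has_derivative (\<lambda>_. 0)) (at v)"
    using has_derivative_hpoly[of d a v] by simp
qed

lemma smooth_curve_hpoly_iff:
  "smooth_curve (hpoly d a) \<longleftrightarrow> (\<forall>v. v \<noteq> 0 \<and> hpoly d a v = 0 \<longrightarrow> grad d a v \<noteq> 0)"
  by (simp add: smooth_curve_def has_derivative_hpoly_0_iff)

section \<open>The curvature of a plane curve\<close>

lemma pd_eq: "(f has_derivative f') (at z) \<Longrightarrow> pd i f z = f' (dir i)"
  unfolding pd_def by (metis frechet_derivative_at)

lemma has_derivative_if_0:
  "(f has_derivative f') F \<Longrightarrow> ((\<lambda>x. if b then f x else 0) has_derivative (\<lambda>h. if b then f' h else 0)) F"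
  by (cases b) auto

lemma matrix_inv_unique:
  fixes A :: "real^'n^'n"
  assumes "A ** B = mat 1" "B ** A = mat 1"
  shows "matrix_inv A = B"
proof -
  have "A ** matrix_inv A = mat 1"
    unfolding matrix_inv_def using assms by (rule someI2[of _ B, OF conjI]) simp
  then have "B ** (A ** matrix_inv A) = B" by simp
  then show ?thesis by (simp add: matrix_mul_assoc assms)
qed

text \<open>The inverse metric contributes \<open>exp (- \<phi>)\<close>, which cancels the factor
  \<open>exp \<phi>\<close> in every derivative of the metric. The hypotheses hold on an open set
  because these symbols are differentiated once more.\<close>

lemma christoffel_conformal:
  assumes U: "open U" "w \<in> U"
    and g: "\<And>w. w \<in> U \<Longrightarrow> g w = (\<chi> i j. if i = j then exp (\<phi> w) else 0)"
    and \<phi>: "\<And>w. w \<in> U \<Longrightarrow> (\<phi> has_derivative \<phi>' w) (at w)"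
  shows "christoffel g k i j w = 1 / 2 * ((if j = k then \<phi>' w (dir i) else 0)
    + (if i = k then \<phi>' w (dir j) else 0) - (if i = j then \<phi>' w (dir k) else 0))"
proof -
  have pd: "pd m (\<lambda>w. g w $ a $ b) w = (if a = b then exp (\<phi> w) * \<phi>' w (dir m) else 0)" for m a b
  proof -
    have "((\<lambda>w. if a = b then exp (\<phi> w) else 0) has_derivative
        (\<lambda>h. if a = b then exp (\<phi> w) * \<phi>' w h else 0)) (at w)"
      using \<phi>[OF U(2)] by (cases "a = b") (auto intro!: derivative_eq_intros)
    then have "((\<lambda>w. g w $ a $ b) has_derivative
        (\<lambda>h. if a = b then exp (\<phi> w) * \<phi>' w h else 0)) (at w)"
      by (rule has_derivative_transform_within_open[OF _ U]) (simp add: g)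
    from pd_eq[OF this] show ?thesis by simp
  qed
  have inv: "matrix_inv (g w) $ k $ l = (if k = l then exp (- \<phi> w) else 0)" for l
  proof -
    have "matrix_inv (g w) = (\<chi> i j. if i = j then exp (- \<phi> w) else 0)"
      by (rule matrix_inv_unique)
        (simp_all add: g[OF U(2)] matrix_matrix_mult_def mat_def vec_eq_iff forall_2 sum_2 exp_minus)
    then show ?thesis by simp
  qed
  have "christoffel g k i j w = 1 / 2 * (\<Sum>l\<in>UNIV. if k = l then exp (- \<phi> w) *
     (pd i (\<lambda>w. g w $ j $ l) w + pd j (\<lambda>w. g w $ i $ l) w - pd l (\<lambda>w. g w $ i $ j) w) else 0)"
    unfolding christoffel_def inv by (intro arg_cong2[where f = "(*)"] sum.cong) auto
  also have "\<dots> = 1 / 2 * (exp (- \<phi> w) *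
     (pd i (\<lambda>w. g w $ j $ k) w + pd j (\<lambda>w. g w $ i $ k) w - pd k (\<lambda>w. g w $ i $ j) w))"
    by simp
  also have "\<dots> = 1 / 2 * ((if j = k then \<phi>' w (dir i) else 0)
    + (if i = k then \<phi>' w (dir j) else 0) - (if i = j then \<phi>' w (dir k) else 0))"
    unfolding pd by (simp add: exp_minus field_simps)
  finally show ?thesis .
qed

text \<open>This is the formula K = - Laplacian(\<open>\<phi>\<close>) / (2 exp
  \<open>\<phi>\<close>). The complex function \<open>H\<close> encodes the differential of
  \<open>\<phi>\<close> as \<open>\<phi>\<close>_x - i \<open>\<phi>\<close>_y, so that the real
  part of \<open>H' 1 + H' \<i> * \<i>\<close> is \<open>\<phi>\<close>_xx +
  \<open>\<phi>\<close>_yy.\<close>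

lemma metric_curvature_conformal:
  assumes U: "open U" "z \<in> U"
    and g: "\<And>w. w \<in> U \<Longrightarrow> g w = (\<chi> i j. if i = j then exp (\<phi> w) else 0)"
    and \<phi>: "\<And>w. w \<in> U \<Longrightarrow> (\<phi> has_derivative (\<lambda>h. Re (H w * h))) (at w)"
    and H: "(H has_derivative H') (at z)"
  shows "metric_curvature g z = - Re (H' 1 + H' \<i> * \<i>) / (2 * exp (\<phi> z))"
proof -
  have chr: "christoffel g k i j w = 1 / 2 * ((if j = k then Re (H w * dir i) else 0)
    + (if i = k then Re (H w * dir j) else 0) - (if i = j then Re (H w * dir k) else 0))"
    if "w \<in> U" for k i j w
    using christoffel_conformal[OF U(1) that g \<phi>] by simp
  have pdchr: "pd m (christoffel g k i j) z = 1 / 2 * ((if j = k then Re (H' (dir m) * dir i) else 0)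
    + (if i = k then Re (H' (dir m) * dir j) else 0) - (if i = j then Re (H' (dir m) * dir k) else 0))"
    for m k i j
  proof -
    have *: "((\<lambda>w. Re (H w * c)) has_derivative (\<lambda>h. Re (H' h * c))) (at z)" for c
      by (auto intro!: derivative_eq_intros H)
    have "((\<lambda>w. 1 / 2 * ((if j = k then Re (H w * dir i) else 0)
       + (if i = k then Re (H w * dir j) else 0) - (if i = j then Re (H w * dir k) else 0)))
      has_derivative (\<lambda>h. 1 / 2 * ((if j = k then Re (H' h * dir i) else 0)
       + (if i = k then Re (H' h * dir j) else 0) - (if i = j then Re (H' h * dir k) else 0)))) (at z)"
      by (intro has_derivative_mult_right has_derivative_diff has_derivative_add has_derivative_if_0 *)
    then have "(christoffel g k i j has_derivative (\<lambda>h. 1 / 2 * ((if j = k then Re (H' h * dir i) else 0)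
       + (if i = k then Re (H' h * dir j) else 0) - (if i = j then Re (H' h * dir k) else 0)))) (at z)"
      by (rule has_derivative_transform_within_open[OF _ U]) (simp only: chr)
    from pd_eq[OF this] show ?thesis .
  qed
  have ne: "(1::2) \<noteq> 2" "(2::2) \<noteq> 1" by simp_all
  have R: "riemann g 1 2 2 1 z = - 1 / 2 * Re (H' 1 + H' \<i> * \<i>)"
    unfolding riemann_def chr[OF U(2)] pdchr sum_2 dir_def
    by (simp add: ne algebra_simps)
  have "det (g z) = exp (\<phi> z) * exp (\<phi> z)"
    by (simp add: det_2 g[OF U(2)])
  moreover have "(\<Sum>l\<in>UNIV. g z $ l $ 1 * riemann g 1 2 2 l z) = exp (\<phi> z) * riemann g 1 2 2 1 z"
    by (simp add: sum_2 g[OF U(2)])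
  ultimately show ?thesis
    unfolding metric_curvature_def R by (simp add: field_simps)
qed

section \<open>Bilinear and Hermitian algebra in complex 3-space\<close>

definition bil :: "complex^3 \<Rightarrow> complex^3 \<Rightarrow> complex" where
  "bil v w = (\<Sum>i\<in>UNIV. v $ i * w $ i)"

definition ccross :: "complex^3 \<Rightarrow> complex^3 \<Rightarrow> complex^3" where
  "ccross v w = vector [v $ 2 * w $ 3 - v $ 3 * w $ 2, v $ 3 * w $ 1 - v $ 1 * w $ 3, v $ 1 * w $ 2 - v $ 2 * w $ 1]"

definition vcnj :: "complex^3 \<Rightarrow> complex^3" where
  "vcnj v = (\<chi> i. cnj (v $ i))"

lemma herm_self: "herm v v = of_real ((norm v)\<^sup>2)"
  by (simp add: herm_def norm_vec_def L2_set_def complex_norm_square[symmetric] sum_nonneg)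

lemma herm_commute: "cnj (herm v w) = herm w v"
  by (simp add: herm_def mult.commute)

lemma herm_linear:
  "herm (v + v') w = herm v w + herm v' w" "herm (c *s v) w = c * herm v w"
  "herm v (w + w') = herm v w + herm v w'" "herm v (c *s w) = cnj c * herm v w"
  by (simp_all add: herm_def sum_3 algebra_simps)

lemma bounded_bilinear_herm: "bounded_bilinear herm"
  unfolding bilinear_conv_bounded_bilinear[symmetric] bilinear_def linear_iff
  by (auto simp: herm_def vector_scaleR_component scaleR_conv_of_real[where 'a = complex] algebra_simps sum.distrib sum_distrib_left)

lemma bounded_bilinear_ccross: "bounded_bilinear ccross"
  unfolding bilinear_conv_bounded_bilinear[symmetric] bilinear_def linear_iff
  by (auto simp: ccross_def vec_eq_iff forall_3 vector_3 algebra_simps)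

lemma bounded_bilinear_bil: "bounded_bilinear bil"
  unfolding bilinear_conv_bounded_bilinear[symmetric] bilinear_def linear_iff
  by (auto simp: bil_def vector_scaleR_component scaleR_conv_of_real[where 'a = complex] algebra_simps sum.distrib sum_distrib_left)

text \<open>Identifies the numerator of the Fubini-Study metric along a lift with the squared norm
  of the wedge product; the Cauchy-Schwarz inequality for \<open>herm\<close> is read off from it
  later.\<close>

lemma lagrange_identity:
  "herm v v * herm w w - herm w v * herm v w = herm (ccross v w) (ccross v w)"
  by (simp add: herm_def ccross_def sum_3 vector_3 algebra_simps)

text \<open>For \<open>a\<close>, \<open>b\<close>, \<open>c\<close> the values of a lift and of its
  first two derivatives, this is where their determinant enters the curvature.\<close>

lemma ccross_ccross_common: "ccross (ccross a b) (ccross a c) = bil (ccross a b) c *s a"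
  by (simp add: ccross_def bil_def sum_3 vec_eq_iff forall_3 vector_3 algebra_simps)

lemma ccross_ccross_right: "ccross a (ccross b c) = bil a c *s b - bil a b *s c"
  by (simp add: ccross_def bil_def sum_3 vec_eq_iff forall_3 vector_3 algebra_simps)

lemma ccross_scale: "ccross a (c *s b) = c *s ccross a b" "ccross (c *s a) b = c *s ccross a b"
  by (simp_all add: ccross_def vec_eq_iff forall_3 vector_3 algebra_simps)

lemma bil_scale: "bil (c *s a) b = c * bil a b" "bil a (c *s b) = c * bil a b"
  by (simp_all add: bil_def sum_3 algebra_simps)

lemma bil_commute: "bil a b = bil b a"
  by (simp add: bil_def mult.commute)

lemma bil_vcnj: "bil (vcnj a) b = herm b a"
  by (simp add: bil_def vcnj_def herm_def mult.commute)

lemma norm_scale_vec: "norm (c *s (v::complex^3)) = cmod c * norm v"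
  by (simp add: norm_vec_def L2_set_def norm_mult power_mult_distrib sum_distrib_left[symmetric] real_sqrt_mult)

lemma ccross_eq_0D:
  assumes "ccross p q = 0" "p \<noteq> 0"
  shows "\<exists>c. q = c *s p"
proof -
  obtain m where m: "p $ m \<noteq> 0" using assms(2) by (auto simp: vec_eq_iff)
  have e: "p $ 2 * q $ 3 = p $ 3 * q $ 2" "p $ 3 * q $ 1 = p $ 1 * q $ 3" "p $ 1 * q $ 2 = p $ 2 * q $ 1"
    using assms(1) by (auto simp: ccross_def vec_eq_iff forall_3 vector_3)
  have "q $ i * p $ m = q $ m * p $ i" for i
    using e exhaust_3[of i] exhaust_3[of m] by (auto simp: mult.commute)
  then have "q = (q $ m / p $ m) *s p"
    using m by (simp add: vec_eq_iff field_simps)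
  then show ?thesis by blast
qed

text \<open>Expanding \<open>p \<times> (a \<times> b)\<close> leaves only terms with
  \<open>bil p a\<close> and \<open>bil p b\<close>. Applied to a lift and its derivative, it makes
  their cross product a multiple of the gradient.\<close>

lemma ccross_parallel:
  assumes "bil p a = 0" "bil p b = 0" "p \<noteq> 0"
  shows "\<exists>\<mu>. ccross a b = \<mu> *s p"
  by (rule ccross_eq_0D) (simp_all add: assms ccross_ccross_right)

lemma dhpoly_bil: "dhpoly d a v w = bil (grad d a v) w"
  by (simp add: dhpoly_grad bil_def)

text \<open>\<open>conj v \<times> grad P\<close> is the tangent direction of the curve that is Hermitian orthogonal to \<open>v\<close>.\<close>

definition curv_term :: "nat \<Rightarrow> (nat \<times> nat \<times> nat \<Rightarrow> complex) \<Rightarrow> complex^3 \<Rightarrow> complex" where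
  "curv_term d a v = d2hpoly d a v (ccross (vcnj v) (grad d a v)) (ccross (vcnj v) (grad d a v))"

section \<open>Curvature of a holomorphic lift\<close>

lemma holomorphic_vec_has_derivative:
  fixes F :: "complex \<Rightarrow> complex^3"
  assumes "open U" "\<And>i. (\<lambda>z. F z $ i) holomorphic_on U" "z \<in> U"
  shows "(F has_derivative (\<lambda>h. h *s (\<chi> i. deriv (\<lambda>z. F z $ i) z))) (at z)"
proof -
  have d: "((\<lambda>z. F z $ i) has_derivative (\<lambda>h. h * deriv (\<lambda>z. F z $ i) z)) (at z)" for i
  proof -
    have "((\<lambda>z. F z $ i) has_field_derivative deriv (\<lambda>z. F z $ i) z) (at z)"
      by (rule holomorphic_derivI[OF assms(2,1,3)])
    then show ?thesis
      unfolding has_field_derivative_def by (rule has_derivative_eq_rhs) (simp add: fun_eq_iff)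
  qed
  have "((\<lambda>z. (F z $ 1) *s axis 1 1 + (F z $ 2) *s axis 2 1 + (F z $ 3) *s axis 3 (1::complex) :: complex^3)
    has_derivative (\<lambda>h. (h * deriv (\<lambda>z. F z $ 1) z) *s axis 1 1 + (h * deriv (\<lambda>z. F z $ 2) z) *s axis 2 1
      + (h * deriv (\<lambda>z. F z $ 3) z) *s axis 3 1)) (at z)"
    by (intro has_derivative_add bounded_linear.has_derivative[OF bounded_linear_scalar_vec] d)
  moreover have "(\<lambda>z. (F z $ 1) *s axis 1 1 + (F z $ 2) *s axis 2 1 + (F z $ 3) *s axis 3 (1::complex)) = F"
    by (auto simp: fun_eq_iff vec_eq_iff forall_3 axis_def)
  moreover have "(\<lambda>h. (h * deriv (\<lambda>z. F z $ 1) z) *s axis 1 1 + (h * deriv (\<lambda>z. F z $ 2) z) *s axis 2 1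
      + (h * deriv (\<lambda>z. F z $ 3) z) *s axis 3 1) = (\<lambda>h. h *s (\<chi> i. deriv (\<lambda>z. F z $ i) z))"
    by (auto simp: fun_eq_iff vec_eq_iff forall_3 axis_def)
  ultimately show ?thesis by simp
qed

text \<open>\<open>G\<close> enters holomorphically and its conjugate antiholomorphically, so the
  differential is twice the real part of the holomorphic half. This is the shape required of
  \<open>\<phi>\<close> in \<open>metric_curvature_conformal\<close>.\<close>

lemma has_derivative_ln_norm:
  fixes G :: "complex \<Rightarrow> complex^3"
  assumes G: "(G has_derivative (\<lambda>h. h *s G')) (at z)" and "G z \<noteq> 0"
  shows "((\<lambda>z. ln ((norm (G z))\<^sup>2)) has_derivative (\<lambda>h. Re (2 * herm G' (G z) / herm (G z) (G z) * h))) (at z)"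
proof -
  have "((\<lambda>z. Re (herm (G z) (G z))) has_derivative (\<lambda>h. Re (herm (G z) (h *s G') + herm (h *s G') (G z)))) (at z)"
    by (intro has_derivative_Re bounded_bilinear.FDERIV[OF bounded_bilinear_herm] G)
  then have "((\<lambda>z. (norm (G z))\<^sup>2) has_derivative (\<lambda>h. Re (herm (G z) (h *s G') + herm (h *s G') (G z)))) (at z)"
    by (simp add: herm_self)
  then have "((\<lambda>z. ln ((norm (G z))\<^sup>2)) has_derivative
      (\<lambda>h. Re (herm (G z) (h *s G') + herm (h *s G') (G z)) * inverse ((norm (G z))\<^sup>2))) (at z)"
    by (intro has_derivative_ln) (use assms in auto)
  then show ?thesis
  proof (rule has_derivative_eq_rhs, intro ext)
    fix h
    have "Re (herm (G z) (h *s G')) = Re (herm (h *s G') (G z))"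
      by (metis herm_commute cnj.simps(1))
    moreover have "2 * herm G' (G z) / herm (G z) (G z) * h = 2 * (h * herm G' (G z)) / of_real ((norm (G z))\<^sup>2)"
      by (simp add: herm_self)
    ultimately show "Re (herm (G z) (h *s G') + herm (h *s G') (G z)) * inverse ((norm (G z))\<^sup>2)
      = Re (2 * herm G' (G z) / herm (G z) (G z) * h)"
      by (simp only: Re_divide_of_real herm_linear) (simp add: field_simps)
  qed
qed

text \<open>The function differentiated is \<open>2 \<partial>\<^sub>z ln |G|\<^sup>2\<close>, so \<open>D 1 + D \<i> * \<i>\<close> is the Laplacian of \<open>ln |G|\<^sup>2\<close>.\<close>

lemma has_derivative_dln_norm:
  fixes G :: "complex \<Rightarrow> complex^3"
  assumes G: "(G has_derivative (\<lambda>h. h *s G' z)) (at z)" and G': "(G' has_derivative (\<lambda>h. h *s G'')) (at z)"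
    and "G z \<noteq> 0"
  shows "\<exists>D. ((\<lambda>z. 2 * herm (G' z) (G z) / herm (G z) (G z)) has_derivative D) (at z) \<and>
     D 1 + D \<i> * \<i> = of_real (4 * (norm (ccross (G z) (G' z)))\<^sup>2 / (norm (G z))^4)"
proof -
  define B where "B = herm (G z) (G z)"
  have B: "B \<noteq> 0" using assms(3) by (simp add: B_def herm_self)
  define D where "D = (\<lambda>h. 2 * (herm (G' z) (h *s G' z) + herm (h *s G'') (G z)) / B
      - 2 * herm (G' z) (G z) * (herm (G z) (h *s G' z) + herm (h *s G' z) (G z)) / (B * B))"
  have h1: "((\<lambda>z. 2 * herm (G' z) (G z)) has_derivative (\<lambda>h. 2 * (herm (G' z) (h *s G' z) + herm (h *s G'') (G z)))) (at z)"
    by (intro has_derivative_mult_right bounded_bilinear.FDERIV[OF bounded_bilinear_herm] G G')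
  have h2: "((\<lambda>z. herm (G z) (G z)) has_derivative (\<lambda>h. herm (G z) (h *s G' z) + herm (h *s G' z) (G z))) (at z)"
    by (intro bounded_bilinear.FDERIV[OF bounded_bilinear_herm] G)
  have "((\<lambda>z. 2 * herm (G' z) (G z) / herm (G z) (G z)) has_derivative D) (at z)"
    by (rule has_derivative_eq_rhs[OF has_derivative_divide[OF h1 h2]])
      (use B in \<open>auto simp: D_def B_def fun_eq_iff field_simps\<close>)
  \<comment> \<open>The parts of \<open>D\<close> that are complex linear in the increment cancel
    because 1 + i * i = 0, and with them every occurrence of \<open>G''\<close>; the
    conjugate-linear parts are doubled.\<close>
  moreover have "D 1 + D \<i> * \<i> = 4 * (herm (G z) (G z) * herm (G' z) (G' z) - herm (G' z) (G z) * herm (G z) (G' z)) / (B * B)"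
    using B unfolding D_def herm_linear by (simp add: B_def[symmetric] field_simps)
  moreover have "4 * (herm (G z) (G z) * herm (G' z) (G' z) - herm (G' z) (G z) * herm (G z) (G' z)) / (B * B)
      = of_real (4 * (norm (ccross (G z) (G' z)))\<^sup>2 / (norm (G z))^4)"
    unfolding lagrange_identity unfolding B_def herm_self of_real_mult[symmetric] of_real_divide[symmetric]
    by (simp add: power2_eq_square power4_eq_xxxx mult.assoc)
  ultimately show ?thesis by metis
qed

lemma ccross_self: "ccross a a = 0" "ccross a 0 = 0"
  by (simp_all add: ccross_def vec_eq_iff forall_3 vector_3 mult.commute)

definition vderiv :: "(complex \<Rightarrow> complex^3) \<Rightarrow> complex \<Rightarrow> complex^3" where
  "vderiv F z = (\<chi> i. deriv (\<lambda>z. F z $ i) z)"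

lemma vderiv_holomorphic:
  fixes F :: "complex \<Rightarrow> complex^3"
  assumes "open U" "\<And>i. (\<lambda>z. F z $ i) holomorphic_on U"
  shows "(\<lambda>z. vderiv F z $ i) holomorphic_on U"
  using holomorphic_deriv[OF assms(2,1)] by (simp add: vderiv_def)

lemma has_derivative_vderiv:
  fixes F :: "complex \<Rightarrow> complex^3"
  assumes "open U" "\<And>i. (\<lambda>z. F z $ i) holomorphic_on U" "z \<in> U"
  shows "(F has_derivative (\<lambda>h. h *s vderiv F z)) (at z)"
  using holomorphic_vec_has_derivative[OF assms] by (simp add: vderiv_def)

text \<open>With G the cross product of F and F', the logarithm of the conformal factor is ln |G|^2
  - 2 ln |F|^2 - ln pi. The Laplacian of ln |F|^2 is 4 pi times the conformal factor, whence the
  constant 4 pi, the curvature of a projective line of area 1. The Laplacian of ln |G|^2 is governed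
  by the cross product of G and G', which is the determinant of F, F', F'' times F.\<close>

lemma metric_curvature_lift:
  fixes F :: "complex \<Rightarrow> complex^3"
  assumes U: "open U" "z \<in> U" and hol: "\<And>i. (\<lambda>z. F z $ i) holomorphic_on U"
    and F0: "\<And>w. w \<in> U \<Longrightarrow> F w \<noteq> 0"
    and imm: "\<And>w. w \<in> U \<Longrightarrow> ccross (F w) (vderiv F w) \<noteq> 0"
  shows "metric_curvature (induced_metric F) z = 4 * pi - 2 * pi * (norm (F z))^6
    * (norm (bil (ccross (F z) (vderiv F z)) (vderiv (vderiv F) z)))\<^sup>2 / norm (ccross (F z) (vderiv F z)) ^ 6"
proof -
  define F1 F2 F3 where "F1 = vderiv F" and "F2 = vderiv F1" and "F3 = vderiv F2"
  have hol1: "(\<lambda>z. F1 z $ i) holomorphic_on U" for i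
    using vderiv_holomorphic[OF U(1) hol] by (simp add: F1_def)
  have hol2: "(\<lambda>z. F2 z $ i) holomorphic_on U" for i
    using vderiv_holomorphic[OF U(1) hol1] by (simp add: F2_def)
  have D: "(F has_derivative (\<lambda>h. h *s F1 w)) (at w)" "(F1 has_derivative (\<lambda>h. h *s F2 w)) (at w)"
     "(F2 has_derivative (\<lambda>h. h *s F3 w)) (at w)" if "w \<in> U" for w
    using has_derivative_vderiv[OF U(1) hol that] has_derivative_vderiv[OF U(1) hol1 that]
      has_derivative_vderiv[OF U(1) hol2 that] by (simp_all add: F1_def F2_def F3_def)
  define G G1 G2 where "G w = ccross (F w) (F1 w)" and "G1 w = ccross (F w) (F2 w)"
    and "G2 w = ccross (F w) (F3 w) + ccross (F1 w) (F2 w)" for w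
  have G0: "G w \<noteq> 0" if "w \<in> U" for w using imm[OF that] by (simp add: G_def F1_def)
  have DG: "(G has_derivative (\<lambda>h. h *s G1 w)) (at w)" if "w \<in> U" for w
    unfolding G_def
    by (rule has_derivative_eq_rhs[OF bounded_bilinear.FDERIV[OF bounded_bilinear_ccross D(1,2)[OF that]]])
      (simp add: fun_eq_iff ccross_scale G1_def ccross_self)
  have DG1: "(G1 has_derivative (\<lambda>h. h *s G2 w)) (at w)" if "w \<in> U" for w
    unfolding G1_def
    by (rule has_derivative_eq_rhs[OF bounded_bilinear.FDERIV[OF bounded_bilinear_ccross D(1,3)[OF that]]])
      (simp add: fun_eq_iff ccross_scale G2_def vec_eq_iff algebra_simps)
  define \<phi> where "\<phi> w = - ln pi + (ln ((norm (G w))\<^sup>2) - 2 * ln ((norm (F w))\<^sup>2))" for w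
  define H where "H w = 2 * herm (G1 w) (G w) / herm (G w) (G w) - 2 * (2 * herm (F1 w) (F w) / herm (F w) (F w))" for w
  have exp\<phi>: "exp (\<phi> w) = 1 / pi * ((norm (G w))\<^sup>2 / (norm (F w))^4)" if "w \<in> U" for w
  proof -
    have "exp (\<phi> w) = exp (ln ((norm (G w))\<^sup>2)) / (exp (ln ((norm (F w))\<^sup>2)) ^ 2 * pi)"
      unfolding \<phi>_def exp_add exp_diff exp_minus
      by (simp add: exp_double field_simps)
    also have "\<dots> = 1 / pi * ((norm (G w))\<^sup>2 / (norm (F w))^4)"
      using F0[OF that] G0[OF that] by (simp add: field_simps)
    finally show ?thesis .
  qed
  have metric: "induced_metric F w = (\<chi> i j. if i = j then exp (\<phi> w) else 0)" if w: "w \<in> U" for w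
  proof -
    have fd: "frechet_derivative F (at w) = (\<lambda>h. h *s F1 w)"
      using frechet_derivative_at[OF D(1)[OF w]] by simp
    have hn: "herm (F w) (F w) \<noteq> 0" using F0[OF w] by (simp add: herm_self)
    have "fubini_study (F w) (a *s F1 w) (b *s F1 w) = Re (a * cnj b) * exp (\<phi> w)" for a b
    proof -
      have "herm (a *s F1 w) (b *s F1 w) / herm (F w) (F w) - herm (a *s F1 w) (F w) * herm (F w) (b *s F1 w) / (herm (F w) (F w))\<^sup>2
         = a * cnj b * ((herm (F w) (F w) * herm (F1 w) (F1 w) - herm (F1 w) (F w) * herm (F w) (F1 w)) / (herm (F w) (F w))\<^sup>2)"
        using hn by (simp add: herm_linear field_simps power2_eq_square)
      also have "\<dots> = a * cnj b * of_real ((norm (G w))\<^sup>2 / (norm (F w))^4)"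
        unfolding lagrange_identity unfolding herm_self G_def[symmetric] by simp
      finally show ?thesis
        unfolding fubini_study_def exp\<phi>[OF w] by (simp only: Re_complex_of_real times_complex.sel) simp
    qed
    then show ?thesis
      unfolding induced_metric_def fd by (simp add: vec_eq_iff dir_def forall_2)
  qed
  have aux: "0 + (Re (x * h) - 2 * Re (y * h)) = Re ((x - 2 * y) * h)" for x y h
    by (simp add: algebra_simps)
  have D\<phi>: "(\<phi> has_derivative (\<lambda>h. Re (H w * h))) (at w)" if "w \<in> U" for w
    unfolding \<phi>_def H_def
    by (rule has_derivative_eq_rhs[OF has_derivative_add[OF has_derivative_const has_derivative_diff[OF
        has_derivative_ln_norm[OF DG[OF that] G0[OF that]]
        has_derivative_mult_right[OF has_derivative_ln_norm[OF D(1)[OF that] F0[OF that]]]]]])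
      (rule ext, rule aux)
  obtain D1 where D1: "((\<lambda>z. 2 * herm (G1 z) (G z) / herm (G z) (G z)) has_derivative D1) (at z)"
     "D1 1 + D1 \<i> * \<i> = of_real (4 * (norm (ccross (G z) (G1 z)))\<^sup>2 / (norm (G z))^4)"
    using has_derivative_dln_norm[OF DG[OF U(2)] DG1[OF U(2)] G0[OF U(2)]] by blast
  obtain D2 where D2: "((\<lambda>z. 2 * herm (F1 z) (F z) / herm (F z) (F z)) has_derivative D2) (at z)"
     "D2 1 + D2 \<i> * \<i> = of_real (4 * (norm (ccross (F z) (F1 z)))\<^sup>2 / (norm (F z))^4)"
    using has_derivative_dln_norm[OF D(1)[OF U(2)] D(2)[OF U(2)] F0[OF U(2)]] by blast
  have "(H has_derivative (\<lambda>h. D1 h - 2 * D2 h)) (at z)"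
    unfolding H_def by (intro has_derivative_diff has_derivative_mult_right D1 D2)
  from metric_curvature_conformal[OF U metric D\<phi> this]
  have "metric_curvature (induced_metric F) z
     = - Re ((D1 1 + D1 \<i> * \<i>) - 2 * (D2 1 + D2 \<i> * \<i>)) / (2 * exp (\<phi> z))"
    by (simp add: algebra_simps)
  also have "\<dots> = - (4 * (norm (bil (G z) (F2 z)) * norm (F z))\<^sup>2 / (norm (G z))^4
      - 8 * (norm (G z))\<^sup>2 / (norm (F z))^4) / (2 * (1 / pi * ((norm (G z))\<^sup>2 / (norm (F z))^4)))"
    unfolding D1(2) D2(2) exp\<phi>[OF U(2)]
    by (simp add: G_def G1_def ccross_ccross_common norm_scale_vec)
  also have "\<dots> = 4 * pi - 2 * pi * (norm (F z))^6 * (norm (bil (G z) (F2 z)))\<^sup>2 / norm (G z) ^ 6"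
    using F0[OF U(2)] G0[OF U(2)] by (simp add: field_simps power_mult_distrib flip: power_add)
  finally show ?thesis
    by (simp add: G_def F1_def F2_def)
qed

section \<open>Curvature of a zero locus in terms of its equation\<close>

lemma proj_eq: "proj v = range (\<lambda>c. c *s v)"
  by (simp add: Defs.proj_def vec.span_singleton)

lemma proj_eq_iff:
  assumes "v \<noteq> 0" "w \<noteq> 0"
  shows "proj v = proj w \<longleftrightarrow> (\<exists>c. c \<noteq> 0 \<and> w = c *s v)"
proof
  assume "proj v = proj w"
  moreover have "w \<in> proj w" unfolding proj_eq by (metis rangeI vector_smult_lid)
  ultimately obtain c where "w = c *s v" unfolding proj_eq by auto
  with assms show "\<exists>c. c \<noteq> 0 \<and> w = c *s v" by auto
next
  assume "\<exists>c. c \<noteq> 0 \<and> w = c *s v"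
  then obtain c where c: "c \<noteq> 0" "w = c *s v" by blast
  have "x *s v = (x / c) *s w" for x using c by (simp add: vec_eq_iff)
  moreover have "x *s w = (x * c) *s v" for x using c by (simp add: vec_eq_iff)
  ultimately show "proj v = proj w" unfolding proj_eq by blast
qed

lemma mem_zero_locus_iff:
  assumes "v \<noteq> 0"
  shows "proj v \<in> zero_locus (hpoly d a) \<longleftrightarrow> hpoly d a v = 0"
proof
  assume "proj v \<in> zero_locus (hpoly d a)"
  then obtain w where w: "w \<noteq> 0" "hpoly d a w = 0" "proj w = proj v" by (auto simp: zero_locus_def)
  then obtain c where "v = c *s w" using proj_eq_iff[OF w(1) assms] by auto
  then show "hpoly d a v = 0" by (simp add: hpoly_scale w)
qed (use assms in \<open>auto simp: zero_locus_def\<close>)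

text \<open>By the Gauss equation the subtracted term is the contribution of the second fundamental
  form. Curvature is thus at most 4 pi and can be large only by being very negative.\<close>

definition curvature_formula :: "nat \<Rightarrow> (nat \<times> nat \<times> nat \<Rightarrow> complex) \<Rightarrow> complex^3 \<Rightarrow> real" where
  "curvature_formula d a v =
     4 * pi - 2 * pi * (norm (curv_term d a v))\<^sup>2 / ((norm v)\<^sup>2 * norm (grad d a v) ^ 6)"

lemma dhpoly_zero_arg: "dhpoly d a v 0 = 0"
  using dhpoly_linear(2)[of d a v 0 0] by simp

text \<open>The dependence on the parametrization cancels. The cross product of \<open>F\<close> and
  \<open>F'\<close> is \<open>\<mu>\<close> times the gradient, and the tangent vector
  \<open>\<mu> W\<close> differs from a multiple of \<open>F'\<close> by a radial vector, which the
  Hessian does not see here; the powers of \<open>\<mu>\<close> then agree in numerator and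
  denominator.\<close>

lemma curvature_zero_locus:
  assumes S: "smooth_curve (hpoly d a)" and par: "local_parametrization (zero_locus (hpoly d a)) U F" and z: "z \<in> U"
  shows "metric_curvature (induced_metric F) z = curvature_formula d a (F z)"
proof -
  from par have U: "open U" and hol: "\<And>i. (\<lambda>z. F z $ i) holomorphic_on U" and F0: "\<And>z. z \<in> U \<Longrightarrow> F z \<noteq> 0"
    and sub: "openin (subtopology CP2_topology (zero_locus (hpoly d a))) ((proj \<circ> F) ` U)"
    and imm: "\<And>z. z \<in> U \<Longrightarrow> frechet_derivative F (at z) 1 \<notin> proj (F z)"
    unfolding local_parametrization_def by auto
  define F1 F2 where "F1 = vderiv F" and "F2 = vderiv F1"
  have hol1: "(\<lambda>z. F1 z $ i) holomorphic_on U" for i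
    using vderiv_holomorphic[OF U(1) hol] by (simp add: F1_def)
  have DF: "(F has_derivative (\<lambda>h. h *s F1 w)) (at w)" "(F1 has_derivative (\<lambda>h. h *s F2 w)) (at w)"
    if "w \<in> U" for w
    using has_derivative_vderiv[OF U(1) hol that] has_derivative_vderiv[OF U(1) hol1 that]
    by (simp_all add: F1_def F2_def)
  have ind: "ccross (F w) (F1 w) \<noteq> 0" if "w \<in> U" for w
  proof
    assume "ccross (F w) (F1 w) = 0"
    from ccross_eq_0D[OF this F0[OF that]] have "F1 w \<in> proj (F w)" by (auto simp: proj_eq)
    moreover have "frechet_derivative F (at w) 1 = F1 w"
      using frechet_derivative_at[OF DF(1)[OF that]] by (metis vector_smult_lid)
    ultimately show False using imm[OF that] by simp
  qed
  have P0: "hpoly d a (F w) = 0" if "w \<in> U" for w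
  proof -
    have "(proj \<circ> F) ` U \<subseteq> zero_locus (hpoly d a)"
      using openin_subset[OF sub] by (simp add: topspace_subtopology)
    then show ?thesis using mem_zero_locus_iff[OF F0[OF that]] that by auto
  qed
  have P1: "dhpoly d a (F w) (F1 w) = 0" if "w \<in> U" for w
  proof -
    have "((\<lambda>w. hpoly d a (F w)) has_derivative (\<lambda>h. dhpoly d a (F w) (h *s F1 w))) (at w)"
      by (rule has_derivative_compose[OF DF(1)[OF that] has_derivative_hpoly])
    moreover have "((\<lambda>w. hpoly d a (F w)) has_derivative (\<lambda>h. 0)) (at w)"
      by (rule has_derivative_transform_within_open[OF has_derivative_const[of 0] U that]) (simp add: P0)
    ultimately have "(\<lambda>h. dhpoly d a (F w) (h *s F1 w)) = (\<lambda>h. 0)"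
      by (rule has_derivative_unique)
    from fun_cong[OF this, of 1] show ?thesis by simp
  qed
  let ?p = "grad d a (F z)" and ?D2 = "d2hpoly d a (F z)"
  have DD: "((\<lambda>w. bil (grad d a (F w)) (F1 w)) has_derivative
      (\<lambda>h. bil ?p (h *s F2 z) + bil (\<chi> m. ?D2 (axis m 1) (h *s F1 z)) (F1 z))) (at z)"
  proof (rule bounded_bilinear.FDERIV[OF bounded_bilinear_bil _ DF(2)[OF z]])
    have dm: "((\<lambda>w. dhpoly d a (F w) u) has_derivative (\<lambda>h. ?D2 u (h *s F1 z))) (at z)" for u
      by (rule has_derivative_compose[OF DF(1)[OF z] has_derivative_dhpoly])
    have "((\<lambda>z. (dhpoly d a (F z) (axis 1 1)) *s axis 1 1 + (dhpoly d a (F z) (axis 2 1)) *s axis 2 1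
        + (dhpoly d a (F z) (axis 3 1)) *s axis 3 (1::complex) :: complex^3)
      has_derivative (\<lambda>h. (?D2 (axis 1 1) (h *s F1 z)) *s axis 1 1 + (?D2 (axis 2 1) (h *s F1 z)) *s axis 2 1
        + (?D2 (axis 3 1) (h *s F1 z)) *s axis 3 1)) (at z)"
      by (intro has_derivative_add bounded_linear.has_derivative[OF bounded_linear_scalar_vec] dm)
    then show "((\<lambda>w. grad d a (F w)) has_derivative (\<lambda>h. \<chi> m. ?D2 (axis m 1) (h *s F1 z))) (at z)"
      by (rule has_derivative_eq_rhs[OF has_derivative_transform[OF UNIV_I, rotated]])
        (auto simp: grad_def fun_eq_iff vec_eq_iff forall_3 axis_def)
  qed
  have "((\<lambda>w. bil (grad d a (F w)) (F1 w)) has_derivative (\<lambda>h. 0)) (at z)"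
    by (rule has_derivative_transform_within_open[OF has_derivative_const[of 0] U z])
      (simp add: P1 dhpoly_bil[symmetric])
  from fun_cong[OF has_derivative_unique[OF DD this], of 1]
  have "bil ?p (F2 z) + bil (\<chi> m. ?D2 (axis m 1) (F1 z)) (F1 z) = 0"
    by simp
  moreover have "bil (\<chi> m. ?D2 (axis m 1) (F1 z)) (F1 z) = ?D2 (F1 z) (F1 z)"
  proof -
    have e: "F1 z = F1 z $ 1 *s axis 1 1 + F1 z $ 2 *s axis 2 1 + F1 z $ 3 *s axis 3 1"
      by (simp add: vec_eq_iff forall_3 axis_def)
    have "?D2 (F1 z) u = ?D2 (F1 z $ 1 *s axis 1 1 + F1 z $ 2 *s axis 2 1 + F1 z $ 3 *s axis 3 1) u" for u
      by (subst e) simp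
    then show ?thesis unfolding d2hpoly_linear by (simp add: bil_def sum_3 mult.commute)
  qed
  ultimately have det: "bil ?p (F2 z) = - ?D2 (F1 z) (F1 z)"
    by (simp add: add_eq_0_iff2)
  have p0: "?p \<noteq> 0"
    using S F0[OF z] P0[OF z] by (auto simp: smooth_curve_hpoly_iff)
  have "bil ?p (F z) = 0" by (simp add: dhpoly_bil[symmetric] dhpoly_euler P0[OF z])
  moreover have "bil ?p (F1 z) = 0" by (simp add: dhpoly_bil[symmetric] P1[OF z])
  ultimately obtain \<mu> where \<mu>: "ccross (F z) (F1 z) = \<mu> *s ?p"
    using ccross_parallel p0 by blast
  have \<mu>0: "\<mu> \<noteq> 0" using ind[OF z] \<mu> by auto
  define W where "W = ccross (vcnj (F z)) ?p"
  define n where "n = norm (F z)"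
  have n0: "n \<noteq> 0" using F0[OF z] by (simp add: n_def)
  \<comment> \<open>Since \<open>\<mu>\<close> times the gradient is itself a cross product,
    \<open>\<mu> W\<close> is a double cross product: up to the factor - |F|^2 it is the component
    of \<open>F'\<close> orthogonal to \<open>F\<close>.\<close>
  have W: "\<mu> *s W = herm (F1 z) (F z) *s F z + (- of_real (n\<^sup>2)) *s F1 z"
    unfolding W_def ccross_scale(1)[symmetric] \<mu>[symmetric] ccross_ccross_right bil_vcnj herm_self n_def
    by (simp add: vec_eq_iff)
  have z1: "?D2 u (F z) = of_nat (d - 1) * bil ?p u" for u
    by (simp add: d2hpoly_euler dhpoly_bil)
  have z2: "?D2 (F z) u = of_nat (d - 1) * bil ?p u" for u
    using z1 d2hpoly_commute by metis
  have "\<mu>\<^sup>2 * ?D2 W W = ?D2 (\<mu> *s W) (\<mu> *s W)"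
    by (simp add: d2hpoly_linear power2_eq_square)
  \<comment> \<open>All terms with a radial slot are, by Euler's identity, multiples of the first
    derivative along \<open>F\<close> or \<open>F'\<close>, and both vanish on the curve.\<close>
  also have "\<dots> = of_real (n ^ 4) * ?D2 (F1 z) (F1 z)"
    unfolding W d2hpoly_linear z1 z2 using \<open>bil ?p (F z) = 0\<close> \<open>bil ?p (F1 z) = 0\<close>
    by (simp add: bil_scale power_def numeral_eq_Suc)
  finally have "norm (\<mu>\<^sup>2 * ?D2 W W) = norm (of_real (n ^ 4) * ?D2 (F1 z) (F1 z))" by simp
  then have nD: "norm (?D2 (F1 z) (F1 z)) = (norm \<mu>)\<^sup>2 * norm (?D2 W W) / n ^ 4"
    using n0 by (simp add: norm_mult norm_power field_simps)
  have "metric_curvature (induced_metric F) z = 4 * pi - 2 * pi * n^6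
    * (norm (bil (\<mu> *s ?p) (F2 z)))\<^sup>2 / norm (\<mu> *s ?p) ^ 6"
    unfolding n_def \<mu>[symmetric] F2_def F1_def
    by (rule metric_curvature_lift[OF U z hol F0]) (use ind in \<open>auto simp: F1_def\<close>)
  also have "(norm (bil (\<mu> *s ?p) (F2 z)))\<^sup>2 = ((norm \<mu>) ^ 3 * norm (?D2 W W) / n ^ 4)\<^sup>2"
    unfolding bil_scale det norm_mult norm_minus_cancel nD by (simp add: power2_eq_square power3_eq_cube)
  also have "4 * pi - 2 * pi * n^6 * \<dots> / norm (\<mu> *s ?p) ^ 6 = curvature_formula d a (F z)"
    unfolding curvature_formula_def curv_term_def W_def[symmetric] norm_scale_vec n_def[symmetric]
    using n0 p0 \<mu>0 by (simp add: field_simps power_mult_distrib flip: power_add)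
  finally show ?thesis .
qed

section \<open>Existence of local parametrizations\<close>

lemma continuous_on_dhpoly: "continuous_on S (\<lambda>w. dhpoly d a w u)"
  using has_derivative_continuous[OF has_derivative_dhpoly] by (simp add: continuous_at_imp_continuous_on)

lemma continuous_on_hpoly: "continuous_on S (hpoly d a)"
  using has_derivative_continuous[OF has_derivative_hpoly] by (simp add: continuous_at_imp_continuous_on)

lemma continuous_on_herm: "continuous_on S (\<lambda>w. herm w u)"
  unfolding herm_def by (intro continuous_intros)

lemma topspace_CP2: "topspace CP2_topology = CP2"
proof -
  have "{v. v \<noteq> 0 \<and> proj v \<in> CP2} = - {0}" by (auto simp: CP2_def)
  then have "openin CP2_topology CP2" by (simp add: openin_CP2_topology open_Compl)
  then show ?thesis
    by (metis openin_CP2_topology openin_subset openin_topspace subset_antisym)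
qed

lemma herm_eq_0_iff: "herm v v = 0 \<longleftrightarrow> v = 0"
  by (simp add: herm_self)

text \<open>An implicit function theorem in the affine chart around \<open>v\<close>. Without a
  chart at the point, the description defining \<open>gauss_curvature\<close> would have no
  witness.\<close>

lemma exists_local_parametrization:
  assumes v: "v \<noteq> 0" "hpoly d a v = 0" and p: "grad d a v \<noteq> 0"
  shows "\<exists>U F z. local_parametrization (zero_locus (hpoly d a)) U F \<and> z \<in> U \<and> proj (F z) = proj v"
proof -
  define p where "p = grad d a v"
  \<comment> \<open>The derivative of the polynomial is |p|^2 along \<open>n\<close> and 0 along
    \<open>t\<close>. The vectors \<open>v\<close>, \<open>t\<close>, \<open>n\<close> are pairwise
    Hermitian orthogonal, \<open>n\<close> and \<open>v\<close> because Euler's identity gives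
    \<open>bil p v = 0\<close>.\<close>
  define n where "n = vcnj p"
  define t where "t = ccross p (vcnj v)"
  have p0: "p \<noteq> 0" using p by (simp add: p_def)
  have pv: "bil p v = 0" unfolding p_def dhpoly_bil[symmetric] dhpoly_euler v by simp
  have nv: "herm n v = 0"
  proof -
    have "herm n v = cnj (bil p v)" by (simp add: herm_def bil_def n_def vcnj_def)
    then show ?thesis by (simp add: pv)
  qed
  have tv: "herm t v = 0" and tn: "herm t n = 0" and pt: "bil p t = 0"
    by (simp_all add: herm_def bil_def n_def vcnj_def t_def ccross_def sum_3 vector_3 algebra_simps)
  have vt: "herm v t = 0" and vn: "herm v n = 0" and nt: "herm n t = 0"
    using nv tv tn herm_commute by (metis complex_cnj_zero)+
  have pn: "bil p n = of_real ((norm p)\<^sup>2)"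
    unfolding herm_self[symmetric] by (simp add: bil_def herm_def n_def vcnj_def)
  have "p \<noteq> 0 \<Longrightarrow> n \<noteq> 0" by (auto simp: n_def vcnj_def vec_eq_iff)
  then have n0: "n \<noteq> 0" using p0 by simp
  have t0: "t \<noteq> 0"
  proof
    assume "t = 0"
    then obtain c where c: "vcnj v = c *s p" using ccross_eq_0D p0 unfolding t_def by blast
    have "herm v v = bil (vcnj v) v" by (simp add: bil_vcnj)
    also have "\<dots> = 0" by (simp add: c bil_scale pv)
    finally show False using v by (simp add: herm_eq_0_iff)
  qed
  have orth0: "w = 0" if "herm w v = 0" "herm w t = 0" "herm w n = 0" for w
  proof (rule ccontr)
    assume w: "w \<noteq> 0"
    have "bil w (vcnj v) = 0" using that(1) by (metis bil_vcnj bil_commute)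
    moreover have "bil w p = 0" using that(3) by (simp add: bil_def herm_def n_def vcnj_def)
    ultimately obtain \<mu> where "ccross p (vcnj v) = \<mu> *s w" using ccross_parallel w by blast
    then have "herm t t = \<mu> * herm w t" unfolding t_def[symmetric] by (metis herm_linear(2))
    then show False using that(2) t0 by (simp add: herm_eq_0_iff)
  qed
  \<comment> \<open>\<open>line\<close> parametrizes the affine plane through \<open>v\<close>
    spanned by \<open>t\<close> and \<open>n\<close>. The functions \<open>\<zeta>\<close> and
    \<open>\<eta>\<close> are its inverse, made invariant under scaling so that they are coordinates
    of projective points.\<close>
  define line where "line x = v + fst x *s t + snd x *s n" for x :: "complex \<times> complex"
  define \<zeta> where "\<zeta> w = herm w t * herm v v / (herm t t * herm w v)" for w
  define \<eta> where "\<eta> w = herm w n * herm v v / (herm n n * herm w v)" for w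
  have hv: "herm v v \<noteq> 0" and ht: "herm t t \<noteq> 0" and hn: "herm n n \<noteq> 0"
    using v t0 n0 by (simp_all add: herm_eq_0_iff)
  have decomp: "w = (herm w v / herm v v) *s line (\<zeta> w, \<eta> w)" if "herm w v \<noteq> 0" for w
  proof -
    let ?w = "w + (-1) *s ((herm w v / herm v v) *s line (\<zeta> w, \<eta> w))"
    have "?w = 0"
      by (rule orth0; unfold line_def herm_linear \<zeta>_def \<eta>_def fst_conv snd_conv vt vn nt nv tv tn;
          use that hv ht hn in \<open>simp add: field_simps\<close>)
    then show ?thesis by (simp add: vec_eq_iff)
  qed
  have hl: "herm (line x) v = herm v v" "herm (line x) t = fst x * herm t t" "herm (line x) n = snd x * herm n n" for x
    unfolding line_def herm_linear by (simp_all add: vt vn nt nv tv tn)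
  have \<zeta>\<eta>_line: "\<zeta> (line x) = fst x" "\<eta> (line x) = snd x" for x
    unfolding \<zeta>_def \<eta>_def hl using hv ht hn by simp_all
  have \<zeta>\<eta>_scale: "\<zeta> (c *s w) = \<zeta> w" "\<eta> (c *s w) = \<eta> w" if "c \<noteq> 0" for c w
    unfolding \<zeta>_def \<eta>_def herm_linear using that by simp_all
  have line0: "line x \<noteq> 0" for x using hl(1)[of x] hv by (auto simp: herm_def)

  \<comment> \<open>The second coordinate is traded for the value of the polynomial, so the curve
    becomes the slice where that coordinate is 0.\<close>
  define \<Phi> where "\<Phi> x = (fst x, hpoly d a (line x))" for x
  define \<Phi>' where "\<Phi>' x h = (fst h, dhpoly d a (line x) (fst h *s t + snd h *s n))" for x h :: "complex \<times> complex"
  have Dline: "(line has_derivative (\<lambda>h. fst h *s t + snd h *s n)) (at x)" for x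
    unfolding line_def[abs_def]
    by (rule has_derivative_eq_rhs[OF has_derivative_add[OF has_derivative_add[OF has_derivative_const
          bounded_linear.has_derivative[OF bounded_linear_scalar_vec has_derivative_fst[OF has_derivative_ident]]]
          bounded_linear.has_derivative[OF bounded_linear_scalar_vec has_derivative_snd[OF has_derivative_ident]]]])
      (simp add: fun_eq_iff)
  have D\<Phi>: "(\<Phi> has_derivative \<Phi>' x) (at x)" for x
    unfolding \<Phi>_def[abs_def] \<Phi>'_def[abs_def]
    by (intro has_derivative_Pair has_derivative_fst has_derivative_ident has_derivative_compose[OF Dline has_derivative_hpoly])
  have app: "blinfun_apply (Blinfun (\<Phi>' x)) = \<Phi>' x" for x
    by (rule bounded_linear_Blinfun_apply[OF has_derivative_bounded_linear[OF D\<Phi>]])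
  have cline: "continuous_on S line" for S
    using has_derivative_continuous[OF Dline] by (simp add: continuous_at_imp_continuous_on)
  have cont: "continuous_on UNIV (\<lambda>x. Blinfun (\<Phi>' x))"
  proof (rule continuous_on_blinfun_componentwise)
    fix i :: "complex \<times> complex"
    show "continuous_on UNIV (\<lambda>x. blinfun_apply (Blinfun (\<Phi>' x)) i)"
      unfolding app \<Phi>'_def
      by (intro continuous_on_Pair continuous_on_const continuous_on_compose2[OF continuous_on_dhpoly[of UNIV] cline]) auto
  qed
  \<comment> \<open>At the origin the derivative of \<open>\<Phi>\<close> is diagonal, with entries
    1 and |p|^2.\<close>
  define inv0 where "inv0 h = (fst h, snd h / of_real ((norm p)\<^sup>2))" for h :: "complex \<times> complex"
  have "bounded_linear inv0"
    unfolding linear_conv_bounded_linear[symmetric] inv0_def[abs_def]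
    by (intro linearI) (auto simp: add_divide_distrib scaleR_conv_of_real[where 'a = complex])
  then have appi: "blinfun_apply (Blinfun inv0) = inv0" by (rule bounded_linear_Blinfun_apply)
  have line00: "line (0, 0) = v" by (simp add: line_def)
  have invcomp: "Blinfun inv0 o\<^sub>L Blinfun (\<Phi>' (0, 0)) = id_blinfun"
  proof (rule blinfun_eqI)
    fix h
    have *: "dhpoly d a v (fst h *s t + snd h *s n) = snd h * of_real ((norm p)\<^sup>2)"
      unfolding dhpoly_linear unfolding dhpoly_bil p_def[symmetric] pt pn by simp
    show "blinfun_apply (Blinfun inv0 o\<^sub>L Blinfun (\<Phi>' (0, 0))) h = blinfun_apply id_blinfun h"
      using p0 * by (simp add: app appi \<Phi>'_def inv0_def line00)
  qed
  obtain U' V g g' where U': "open U'" "(0, 0) \<in> U'" and V: "open V" "\<Phi> (0, 0) \<in> V"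
    and hom: "homeomorphism U' V \<Phi> g" and Dg: "\<And>y. y \<in> V \<Longrightarrow> (g has_derivative g' y) (at y)"
    and bij: "\<And>y. y \<in> V \<Longrightarrow> bij (blinfun_apply (Blinfun (\<Phi>' (g y))))"
  proof (rule inverse_function_theorem[OF open_UNIV _ cont UNIV_I invcomp, of \<Phi>])
    show "(\<Phi> has_derivative blinfun_apply (Blinfun (\<Phi>' x))) (at x)" for x
      unfolding app by (rule D\<Phi>)
    fix U' V g g'
    assume "open U'" "(0, 0) \<in> U'" "open V" "\<Phi> (0, 0) \<in> V" "homeomorphism U' V \<Phi> g"
      "\<And>y. y \<in> V \<Longrightarrow> (g has_derivative g' y) (at y)" "\<And>y. y \<in> V \<Longrightarrow> bij (blinfun_apply (Blinfun (\<Phi>' (g y))))"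
    then show thesis by (rule that)
  qed
  define U where "U = {z. (z, 0) \<in> V}"
  have openU: "open U"
  proof -
    have "open ((\<lambda>z. (z, 0 :: complex)) -` V)"
      by (rule open_vimage[OF V(1)]) (intro continuous_intros)
    then show ?thesis by (simp add: U_def vimage_def)
  qed
  define y where "y z = snd (g (z, 0))" for z
  define F where "F z = line (z, y z)" for z
  have g\<Phi>: "g (\<Phi> x) = x" if "x \<in> U'" for x using hom that by (simp add: homeomorphism_def)
  have \<Phi>g: "\<Phi> (g x) = x" "g x \<in> U'" if "x \<in> V" for x using hom that by (auto simp: homeomorphism_def)
  have gU: "g (z, 0) = (z, y z)" if "z \<in> U" for z
    using \<Phi>g(1)[of "(z, 0)"] that by (auto simp: U_def \<Phi>_def y_def prod_eq_iff)
  have PF: "hpoly d a (F z) = 0" if "z \<in> U" for z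
    using \<Phi>g(1)[of "(z, 0)"] gU[OF that] that by (auto simp: U_def \<Phi>_def F_def)
  have "0 \<in> U"
    using V(2) by (simp add: \<Phi>_def line00 v U_def)
  have "y 0 = 0"
    using g\<Phi>[OF U'(2)] by (simp add: \<Phi>_def line00 v y_def)
  then have "F 0 = v" by (simp add: F_def line00)
  \<comment> \<open>The inverse function theorem gives only real differentiability of
    \<open>y\<close>. Differentiating P(F) = 0 yields a complex linear equation for the derivative
    \<open>L\<close>, solvable because the derivative of P along \<open>n\<close> is nonzero; so
    \<open>L\<close> is multiplication by a complex number.\<close>
  have y': "\<exists>c. (y has_field_derivative c) (at z)" if z: "z \<in> U" for z
  proof -
    have zV: "(z, 0) \<in> V" using z by (simp add: U_def)
    define L where "L h = snd (g' (z, 0) (h, 0))" for h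
    have Dy: "(y has_derivative L) (at z)"
      unfolding y_def[abs_def] L_def[abs_def]
      by (rule has_derivative_snd, rule has_derivative_compose[where f = "\<lambda>z. (z, 0)" and g = g,
            OF has_derivative_Pair[OF has_derivative_ident has_derivative_const] Dg[OF zV]])
    have "(F has_derivative (\<lambda>h. h *s t + L h *s n)) (at z)"
      using has_derivative_compose[OF has_derivative_Pair[OF has_derivative_ident Dy] Dline]
      by (simp add: F_def[abs_def])
    from has_derivative_compose[OF this has_derivative_hpoly]
    have "((\<lambda>z. hpoly d a (F z)) has_derivative (\<lambda>h. dhpoly d a (F z) (h *s t + L h *s n))) (at z)" .
    moreover have "((\<lambda>z. hpoly d a (F z)) has_derivative (\<lambda>h. 0)) (at z)"
      by (rule has_derivative_transform_within_open[OF has_derivative_const[of 0] openU z]) (simp add: PF)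
    ultimately have "(\<lambda>h. dhpoly d a (F z) (h *s t + L h *s n)) = (\<lambda>h. 0)"
      by (rule has_derivative_unique)
    then have e: "dhpoly d a (F z) (h *s t + L h *s n) = 0" for h
      by (rule fun_cong)
    have "dhpoly d a (F z) n \<noteq> 0"
    proof
      assume "dhpoly d a (F z) n = 0"
      then have "\<Phi>' (g (z, 0)) (0, 1) = \<Phi>' (g (z, 0)) (0, 0)"
        by (simp add: \<Phi>'_def gU[OF z] F_def dhpoly_zero_arg)
      from injD[OF bij_is_inj[OF bij[OF zV, unfolded app]] this] show False by simp
    qed
    then have "L h = - dhpoly d a (F z) t / dhpoly d a (F z) n * h" for h
      using e[of h] unfolding dhpoly_linear by (simp add: field_simps add_eq_0_iff2)
    then have "(y has_field_derivative (- dhpoly d a (F z) t / dhpoly d a (F z) n)) (at z)"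
      unfolding has_field_derivative_def
      by (intro has_derivative_eq_rhs[OF Dy]) (simp add: fun_eq_iff)
    then show ?thesis ..
  qed
  then have holy: "y holomorphic_on U"
    using holomorphic_on_open[OF openU] by blast
  have hol: "(\<lambda>z. F z $ i) holomorphic_on U" for i
    unfolding F_def line_def by (simp) (intro holomorphic_intros holy)
  have DF: "\<exists>c. (F has_derivative (\<lambda>h. h *s (t + c *s n))) (at z)" if z: "z \<in> U" for z
  proof -
    obtain c where "(y has_field_derivative c) (at z)" using y'[OF z] by blast
    then have Dy: "(y has_derivative (\<lambda>h. c * h)) (at z)" by (simp add: has_field_derivative_def)
    have "(F has_derivative (\<lambda>h. h *s t + (c * h) *s n)) (at z)"
      using has_derivative_compose[OF has_derivative_Pair[OF has_derivative_ident Dy] Dline]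
      by (simp add: F_def[abs_def])
    then have "(F has_derivative (\<lambda>h. h *s (t + c *s n))) (at z)"
      by (rule has_derivative_eq_rhs) (simp add: fun_eq_iff vec_eq_iff algebra_simps)
    then show ?thesis ..
  qed
  have imm: "frechet_derivative F (at z) 1 \<notin> proj (F z)" if z: "z \<in> U" for z
  proof
    assume A: "frechet_derivative F (at z) 1 \<in> proj (F z)"
    obtain c where "(F has_derivative (\<lambda>h. h *s (t + c *s n))) (at z)" using DF[OF z] by blast
    from frechet_derivative_at[OF this] have "frechet_derivative F (at z) 1 = t + c *s n"
      by (metis vector_smult_lid)
    then obtain x where x: "t + c *s n = x *s F z" using A by (auto simp: proj_eq)
    have "herm (t + c *s n) v = x * herm v v" unfolding x by (simp add: herm_linear F_def hl)
    then have "x = 0" using hv by (simp add: herm_linear tv nv)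
    then have "herm (t + c *s n) t = 0" unfolding x by (simp add: herm_def)
    then show False using ht by (simp add: herm_linear nt)
  qed
  \<comment> \<open>Open sets of nonzero vectors, saturated under scaling, so that their images in
    the projective plane are open. Intersected with the zero locus they give exactly the images of
    the sets \<open>U0\<close>, which yields both relative openness and the embedding.\<close>
  define W where "W U0 = {w. herm w v \<noteq> 0 \<and> (\<zeta> w, \<eta> w) \<in> U' \<and> \<zeta> w \<in> U0}" for U0
  have W_scale: "c *s w \<in> W U0 \<longleftrightarrow> w \<in> W U0" if "c \<noteq> 0" for c w U0
    using that by (simp add: W_def \<zeta>\<eta>_scale herm_linear)
  have W0: "w \<noteq> 0" if "w \<in> W U0" for w U0
    using that by (auto simp: W_def herm_def)
  have openW: "open (W U0)" if "open U0" for U0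
  proof -
    have o: "open {w. herm w v \<noteq> 0}"
      by (intro open_Collect_neq continuous_on_herm continuous_on_const)
    have c: "continuous_on {w. herm w v \<noteq> 0} (\<lambda>w. (\<zeta> w, \<eta> w))"
      unfolding \<zeta>_def \<eta>_def using ht hn by (intro continuous_intros continuous_on_herm) auto
    have "open ({w. herm w v \<noteq> 0} \<inter> (\<lambda>w. (\<zeta> w, \<eta> w)) -` (U' \<inter> U0 \<times> UNIV))"
      by (rule continuous_open_preimage[OF c o]) (intro open_Int U' open_Times that open_UNIV)
    also have "{w. herm w v \<noteq> 0} \<inter> (\<lambda>w. (\<zeta> w, \<eta> w)) -` (U' \<inter> U0 \<times> UNIV) = W U0"
      by (auto simp: W_def)
    finally show ?thesis .
  qed
  have projW: "proj w \<in> proj ` W U0 \<longleftrightarrow> w \<in> W U0" if "w \<noteq> 0" for w U0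
  proof
    assume "proj w \<in> proj ` W U0"
    then obtain w' where w': "w' \<in> W U0" "proj w = proj w'" by auto
    then show "w \<in> W U0" using proj_eq_iff[OF that W0[OF w'(1)]] W_scale by auto
  qed auto
  have openprojW: "openin CP2_topology (proj ` W U0)" if "open U0" for U0
  proof -
    have "{w. w \<noteq> 0 \<and> proj w \<in> proj ` W U0} = W U0" using projW W0 by blast
    then show ?thesis using openW[OF that] W0 by (auto simp: openin_CP2_topology CP2_def)
  qed
  have image: "(proj \<circ> F) ` U0 = zero_locus (hpoly d a) \<inter> proj ` W U0" if "U0 \<subseteq> U" for U0
  proof (intro equalityI subsetI)
    fix x assume "x \<in> (proj \<circ> F) ` U0"
    then obtain z where z: "z \<in> U0" "x = proj (F z)" by auto
    then have zU: "z \<in> U" using that by auto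
    have "F z \<in> W U0"
      using z \<Phi>g(2)[of "(z, 0)"] gU[OF zU] zU hv by (auto simp: W_def F_def \<zeta>\<eta>_line hl U_def)
    then show "x \<in> zero_locus (hpoly d a) \<inter> proj ` W U0"
      using z PF[OF zU] line0 mem_zero_locus_iff[of "F z"] by (auto simp: F_def)
  next
    fix x assume x: "x \<in> zero_locus (hpoly d a) \<inter> proj ` W U0"
    then obtain w where w: "w \<in> W U0" "x = proj w" by auto
    have "hpoly d a w = 0" using x w mem_zero_locus_iff[OF W0[OF w(1)]] by auto
    have hw: "herm w v \<noteq> 0" "(\<zeta> w, \<eta> w) \<in> U'" "\<zeta> w \<in> U0" using w(1) by (auto simp: W_def)
    have c: "herm w v / herm v v \<noteq> 0" using hw hv by simp
    have "hpoly d a ((herm w v / herm v v) *s line (\<zeta> w, \<eta> w)) = 0"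
      using decomp[OF hw(1)] \<open>hpoly d a w = 0\<close> by simp
    then have "hpoly d a (line (\<zeta> w, \<eta> w)) = 0" using c by (simp add: hpoly_scale)
    then have "\<Phi> (\<zeta> w, \<eta> w) = (\<zeta> w, 0)" by (simp add: \<Phi>_def)
    then have "g (\<zeta> w, 0) = (\<zeta> w, \<eta> w)" using g\<Phi>[OF hw(2)] by simp
    then have "F (\<zeta> w) = line (\<zeta> w, \<eta> w)" by (simp add: F_def y_def)
    then have "w = (herm w v / herm v v) *s F (\<zeta> w)" using decomp[OF hw(1)] by simp
    then have "proj w = proj (F (\<zeta> w))"
      using proj_eq_iff[of "F (\<zeta> w)" w] W0[OF w(1)] line0 c by (metis F_def)
    then show "x \<in> (proj \<circ> F) ` U0" using w hw by auto
  qed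
  have contF: "continuous_on U F"
    unfolding F_def
    by (intro continuous_on_compose2[OF cline[of UNIV]] continuous_intros holomorphic_on_imp_continuous_on[OF holy]) auto
  have emb: "embedding_map (top_of_set U) CP2_topology (proj \<circ> F)"
    unfolding embedding_map_def
  proof (rule bijective_open_imp_homeomorphic_map)
    have im: "(proj \<circ> F) ` U \<subseteq> CP2" using line0 by (auto simp: CP2_def F_def)
    show "continuous_map (top_of_set U) (subtopology CP2_topology ((proj \<circ> F) ` topspace (top_of_set U))) (proj \<circ> F)"
      unfolding continuous_map_in_subtopology
    proof (intro conjI)
      show "continuous_map (top_of_set U) CP2_topology (proj \<circ> F)"
        unfolding continuous_map
      proof (intro conjI allI impI)
        show "(proj \<circ> F) ` topspace (top_of_set U) \<subseteq> topspace CP2_topology"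
          using im by (simp add: topspace_CP2)
        fix O' assume "openin CP2_topology O'"
        then have "open {w. w \<noteq> 0 \<and> proj w \<in> O'}" by (simp add: openin_CP2_topology)
        from continuous_openin_preimage_gen[OF contF this]
        have "openin (top_of_set U) (U \<inter> F -` {w. w \<noteq> 0 \<and> proj w \<in> O'})" .
        also have "U \<inter> F -` {w. w \<noteq> 0 \<and> proj w \<in> O'} = {x \<in> topspace (top_of_set U). (proj \<circ> F) x \<in> O'}"
          using line0 by (auto simp: F_def)
        finally show "openin (top_of_set U) {x \<in> topspace (top_of_set U). (proj \<circ> F) x \<in> O'}" .
      qed
    qed auto
    show "open_map (top_of_set U) (subtopology CP2_topology ((proj \<circ> F) ` topspace (top_of_set U))) (proj \<circ> F)"
      unfolding open_map_def
    proof (intro allI impI)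
      fix U0 assume "openin (top_of_set U) U0"
      then have U0: "open U0" "U0 \<subseteq> U" using openU by (auto simp: openin_open_eq)
      have "(proj \<circ> F) ` U0 = (proj \<circ> F) ` U \<inter> proj ` W U0"
      proof -
        have "W U0 \<subseteq> W U" using U0(2) by (auto simp: W_def)
        then have "proj ` W U0 \<subseteq> proj ` W U" by (rule image_mono)
        then show ?thesis unfolding image[OF U0(2)] image[OF order_refl] by blast
      qed
      then show "openin (subtopology CP2_topology ((proj \<circ> F) ` topspace (top_of_set U))) ((proj \<circ> F) ` U0)"
        unfolding openin_subtopology
        by (intro exI[of _ "proj ` W U0"] conjI openprojW[OF U0(1)]) (simp add: Int_commute)
    qed
    show "(proj \<circ> F) ` topspace (top_of_set U) = topspace (subtopology CP2_topology ((proj \<circ> F) ` topspace (top_of_set U)))"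
      using im by (auto simp: topspace_CP2)
    show "inj_on (proj \<circ> F) (topspace (top_of_set U))"
    proof (rule inj_onI)
      fix z z' assume "(proj \<circ> F) z = (proj \<circ> F) z'"
      then obtain c where "c \<noteq> 0" "F z' = c *s F z" using proj_eq_iff[of "F z" "F z'"] line0 by (auto simp: F_def)
      then have "\<zeta> (F z') = \<zeta> (F z)" by (simp add: \<zeta>\<eta>_scale)
      then show "z = z'" by (simp add: F_def \<zeta>\<eta>_line)
    qed
  qed
  have "local_parametrization (zero_locus (hpoly d a)) U F"
    unfolding local_parametrization_def
  proof (intro conjI allI ballI openU hol emb imm)
    show "F z \<noteq> 0" for z using line0 by (simp add: F_def)
    show "openin (subtopology CP2_topology (zero_locus (hpoly d a))) ((proj \<circ> F) ` U)"
      unfolding openin_subtopology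
      by (intro exI[of _ "proj ` W U"] conjI openprojW[OF openU]) (simp only: image[OF order_refl] Int_commute)
  qed
  then show ?thesis using \<open>0 \<in> U\<close> \<open>F 0 = v\<close> by blast
qed

section \<open>Well-definedness of the curvature at a point\<close>

lemma vcnj_scale: "vcnj (c *s v) = cnj c *s vcnj v"
  by (simp add: vcnj_def vec_eq_iff)

text \<open>The tangent vector scales by \<open>cnj c * c ^ (d - 1)\<close> and the Hessian by
  \<open>c ^ (d - 2)\<close>, so numerator and denominator both scale by |c|^(6 d - 4). The
  condition \<open>2 \<le> d\<close> keeps \<open>d - 2\<close> from being truncated.\<close>

lemma curvature_formula_scale:
  assumes "c \<noteq> 0" "2 \<le> d"
  shows "curvature_formula d a (c *s v) = curvature_formula d a v"
proof -
  have "curv_term d a (c *s v) = c ^ (d - 2) * (cnj c * c ^ (d - 1))\<^sup>2 * curv_term d a v"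
    unfolding curv_term_def vcnj_scale grad_scale ccross_scale d2hpoly_scale d2hpoly_linear
    by (simp add: power2_eq_square)
  then have "(norm (curv_term d a (c *s v)))\<^sup>2 = (norm c ^ (d - 2) * (norm c * norm c ^ (d - 1))\<^sup>2)\<^sup>2 * (norm (curv_term d a v))\<^sup>2"
    by (simp add: norm_mult norm_power power_mult_distrib)
  moreover have "(norm c ^ (d - 2) * (norm c * norm c ^ (d - 1))\<^sup>2)\<^sup>2 = (norm c)\<^sup>2 * (norm c ^ (d - 1)) ^ 6"
  proof -
    obtain e where e: "d = Suc (Suc e)" using assms(2) by (metis Suc_le_D numeral_2_eq_2 Suc_le_mono)
    have "(y * (x * (x * y))\<^sup>2)\<^sup>2 = x\<^sup>2 * (x * y) ^ 6" for x y :: real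
      by (simp add: numeral_eq_Suc)
    from this[where x = "norm c" and y = "norm c ^ e"] show ?thesis by (simp add: e)
  qed
  ultimately show ?thesis
    unfolding curvature_formula_def grad_scale norm_scale_vec norm_power power_mult_distrib
    using assms(1) by simp
qed

text \<open>Uniqueness comes without proving that curvature is invariant under changes of
  coordinates: every admissible chart yields the same closed formula, at possibly different
  representatives of the point.\<close>

lemma gauss_curvature_eq:
  assumes S: "smooth_curve (hpoly d a)" and d: "2 \<le> d" and v: "v \<noteq> 0" "hpoly d a v = 0"
  shows "gauss_curvature (zero_locus (hpoly d a)) (proj v) = curvature_formula d a v"
  unfolding gauss_curvature_def
proof (rule the_equality)
  have eq: "metric_curvature (induced_metric F) z = curvature_formula d a v"
    if par: "local_parametrization (zero_locus (hpoly d a)) U F" "z \<in> U" "proj (F z) = proj v" for U F z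
  proof -
    have "F z \<noteq> 0" using par by (auto simp: local_parametrization_def)
    then obtain c where "c \<noteq> 0" "F z = c *s v" using proj_eq_iff[OF v(1), of "F z"] par(3) by auto
    then show ?thesis
      using curvature_zero_locus[OF S par(1,2)] curvature_formula_scale[OF _ d] by simp
  qed
  have "grad d a v \<noteq> 0" using S v by (simp add: smooth_curve_hpoly_iff)
  from exists_local_parametrization[OF v this]
  show "\<exists>U F z. local_parametrization (zero_locus (hpoly d a)) U F \<and> z \<in> U \<and> proj (F z) = proj v \<and>
     curvature_formula d a v = metric_curvature (induced_metric F) z"
    using eq by metis
  show "k = curvature_formula d a v"
    if "\<exists>U F z. local_parametrization (zero_locus (hpoly d a)) U F \<and> z \<in> U \<and> proj (F z) = proj v \<and>
     k = metric_curvature (induced_metric F) z" for k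
    using that eq by metis
qed

section \<open>Gaussian measures\<close>

lemma integral_complex_prod:
  fixes f g :: "real \<Rightarrow> 'b::{real_normed_field,banach,second_countable_topology}"
  assumes f: "integrable lborel f" and g: "integrable lborel g"
  shows "integrable lborel (\<lambda>z. f (Re z) * g (Im z))"
    and "(\<integral>z. f (Re z) * g (Im z) \<partial>lborel) = (\<integral>x. f x \<partial>lborel) * (\<integral>x. g x \<partial>lborel)"
proof -
  interpret product_sigma_finite "\<lambda>_::complex. lborel :: real measure"
    by (simp add: product_sigma_finite_def sigma_finite_lborel)
  define h where "h = (\<lambda>b::complex. if b = 1 then f else g)"
  have ne: "(1::complex) \<noteq> \<i>" by (simp add: complex_eq_iff)
  have h: "integrable lborel (h b)" for b using f g by (simp add: h_def)
  have ph: "(\<Prod>b\<in>Basis. h b (x b)) = f (x 1) * g (x \<i>)" for x :: "complex \<Rightarrow> real"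
    using ne by (simp add: Basis_complex_def h_def)
  have sm: "Re (\<Sum>b\<in>Basis. x b *\<^sub>R b) = x 1" "Im (\<Sum>b\<in>Basis. x b *\<^sub>R b) = x \<i>" for x :: "complex \<Rightarrow> real"
    using ne by (simp_all add: Basis_complex_def)
  have [measurable]: "f \<in> borel_measurable borel" "g \<in> borel_measurable borel"
    using f g by auto
  have m: "(\<lambda>z. f (Re z) * g (Im z)) \<in> borel_measurable borel"
    by (measurable; simp)
  have T: "(\<lambda>x. \<Sum>b\<in>Basis. x b *\<^sub>R b) \<in> (\<Pi>\<^sub>M b\<in>(Basis::complex set). lborel) \<rightarrow>\<^sub>M borel"
    by measurable
  have "integrable (\<Pi>\<^sub>M b\<in>(Basis::complex set). lborel) (\<lambda>x. \<Prod>b\<in>Basis. h b (x b))"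
    by (rule product_integrable_prod) (use h in auto)
  then show "integrable lborel (\<lambda>z. f (Re z) * g (Im z))"
    by (subst lborel_eq, subst integrable_distr_eq[OF T m]) (simp only: sm ph)
  have "(\<integral>x. (\<Prod>b\<in>Basis. h b (x b)) \<partial>(\<Pi>\<^sub>M b\<in>(Basis::complex set). lborel)) = (\<Prod>b\<in>Basis. \<integral>x. h b x \<partial>lborel)"
    by (rule product_integral_prod) (use h in auto)
  also have "\<dots> = (\<integral>x. f x \<partial>lborel) * (\<integral>x. g x \<partial>lborel)"
    using ne by (simp add: Basis_complex_def h_def)
  finally show "(\<integral>z. f (Re z) * g (Im z) \<partial>lborel) = (\<integral>x. f x \<partial>lborel) * (\<integral>x. g x \<partial>lborel)"
    by (subst lborel_eq, subst integral_distr[OF T m]) (simp only: sm ph)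
qed

lemma exp_square_normal_density:
  "exp (- x\<^sup>2 + t * x) = sqrt pi * exp (t\<^sup>2 / 4) * normal_density (t / 2) (1 / sqrt 2) x"
proof -
  have "normal_density (t / 2) (1 / sqrt 2) x = 1 / sqrt pi * exp (- (x - t / 2)\<^sup>2)"
    by (simp add: normal_density_def power_divide)
  moreover have "exp (- x\<^sup>2 + t * x) = exp (t\<^sup>2 / 4) * exp (- (x - t / 2)\<^sup>2)"
    unfolding exp_add[symmetric] by (simp add: power2_eq_square field_simps)
  ultimately show ?thesis by simp
qed

lemma gaussian_exp_integral:
  "integrable lborel (\<lambda>x::real. exp (- x\<^sup>2 + t * x))"
  "(\<integral>x. exp (- x\<^sup>2 + t * x) \<partial>lborel) = sqrt pi * exp (t\<^sup>2 / 4)"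
  unfolding exp_square_normal_density by simp_all

lemma gaussian_fourier_integral:
  "integrable lborel (\<lambda>x::real. of_real (exp (- x\<^sup>2)) * cis (t * x))"
  "(\<integral>x. of_real (exp (- x\<^sup>2)) * cis (t * x) \<partial>lborel) = of_real (sqrt pi * exp (- t\<^sup>2 / 4))"
proof -
  have nd: "std_normal_density (0 + sqrt 2 * x) = exp (- x\<^sup>2) / sqrt (2 * pi)" for x
    by (simp add: std_normal_density_def power_mult_distrib)
  have i0: "integrable lborel (\<lambda>x. std_normal_density x *\<^sub>R cis (t / sqrt 2 * x))"
  proof (rule Bochner_Integration.integrable_bound[OF integrable_normal_density[where \<mu> = 0 and \<sigma> = 1]])
    show "(\<lambda>x. std_normal_density x *\<^sub>R cis (t / sqrt 2 * x)) \<in> borel_measurable lborel"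
      unfolding cis_conv_exp by measurable
  qed (auto simp: normal_density_nonneg)
  have "complex_of_real (exp (- (t / sqrt 2)\<^sup>2 / 2)) = char std_normal_distribution (t / sqrt 2)"
    by (simp add: char_std_normal_distribution)
  also have "\<dots> = (\<integral>x. std_normal_density x *\<^sub>R cis (t / sqrt 2 * x) \<partial>lborel)"
    unfolding char_def cis_conv_exp
    by (subst integral_density) (auto simp: normal_density_nonneg)
  \<comment> \<open>The substitution by sqrt 2 passes from variance 1 to variance 1/2, that is, to
    the weight exp (- x^2).\<close>
  also have "\<dots> = \<bar>sqrt 2\<bar> *\<^sub>R (\<integral>x. std_normal_density (0 + sqrt 2 * x) *\<^sub>R cis (t / sqrt 2 * (0 + sqrt 2 * x)) \<partial>lborel)"
    by (rule lborel_integral_real_affine) simp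
  also have "\<dots> = sqrt 2 *\<^sub>R (\<integral>x. (1 / sqrt (2 * pi)) *\<^sub>R (of_real (exp (- x\<^sup>2)) * cis (t * x)) \<partial>lborel)"
    unfolding nd by (simp add: scaleR_conv_of_real)
  also have "\<dots> = sqrt 2 *\<^sub>R (1 / sqrt (2 * pi)) *\<^sub>R (\<integral>x. of_real (exp (- x\<^sup>2)) * cis (t * x) \<partial>lborel)"
    by (subst integral_scaleR_right) simp
  also have "\<dots> = (1 / sqrt pi) *\<^sub>R (\<integral>x. of_real (exp (- x\<^sup>2)) * cis (t * x) \<partial>lborel)"
    by (simp add: real_sqrt_mult)
  finally have "sqrt pi *\<^sub>R complex_of_real (exp (- (t / sqrt 2)\<^sup>2 / 2)) = (\<integral>x. of_real (exp (- x\<^sup>2)) * cis (t * x) \<partial>lborel)"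
    by simp
  then show "(\<integral>x. of_real (exp (- x\<^sup>2)) * cis (t * x) \<partial>lborel) = of_real (sqrt pi * exp (- t\<^sup>2 / 4))"
    by (simp add: power_divide scaleR_conv_of_real)
  from lborel_integrable_real_affine[OF i0, of "sqrt 2" 0]
  have "integrable lborel (\<lambda>x. sqrt (2 * pi) *\<^sub>R (std_normal_density (0 + sqrt 2 * x) *\<^sub>R cis (t / sqrt 2 * (0 + sqrt 2 * x))))"
    by (intro integrable_scaleR_right) simp
  then show "integrable lborel (\<lambda>x::real. of_real (exp (- x\<^sup>2)) * cis (t * x))"
    unfolding nd by (simp add: scaleR_conv_of_real)
qed

text \<open>Standard complex Gaussian density: the squared modulus has mean 1, real and imaginary
  part have variance 1/2.\<close>

definition cgauss :: "complex \<Rightarrow> real" where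
  "cgauss z = exp (- (norm z)\<^sup>2) / pi"

lemma cgauss_nonneg: "0 \<le> cgauss z" and cgauss_pos: "0 < cgauss z"
  by (simp_all add: cgauss_def)

lemma measurable_cgauss[measurable]: "cgauss \<in> borel_measurable borel"
  unfolding cgauss_def by measurable

lemma cgauss_exp_integral:
  "integrable lborel (\<lambda>z. cgauss z * exp (Re (z * b)))"
  "(\<integral>z. cgauss z * exp (Re (z * b)) \<partial>lborel) = exp ((norm b)\<^sup>2 / 4)"
proof -
  have eq: "cgauss z * exp (Re (z * b)) = 1 / pi * (exp (- (Re z)\<^sup>2 + Re b * Re z) * exp (- (Im z)\<^sup>2 + (- Im b) * Im z))" for z
    unfolding cgauss_def exp_add[symmetric] by (simp add: cmod_power2 exp_add[symmetric] algebra_simps)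
  show "integrable lborel (\<lambda>z. cgauss z * exp (Re (z * b)))"
    unfolding eq by (intro integrable_mult_right integral_complex_prod gaussian_exp_integral)
  have sq: "1 / pi * (sqrt pi * u * (sqrt pi * v)) = u * v" for u v
  proof -
    have "1 / pi * (sqrt pi * u * (sqrt pi * v)) = 1 / pi * (sqrt pi * sqrt pi) * (u * v)" by (simp only: mult_ac)
    also have "sqrt pi * sqrt pi = pi" by simp
    finally show ?thesis by simp
  qed
  have e: "1 / pi * (sqrt pi * exp ((Re b)\<^sup>2 / 4) * (sqrt pi * exp ((- Im b)\<^sup>2 / 4))) = exp ((norm b)\<^sup>2 / 4)"
    unfolding sq by (simp add: cmod_power2 add_divide_distrib exp_add)
  show "(\<integral>z. cgauss z * exp (Re (z * b)) \<partial>lborel) = exp ((norm b)\<^sup>2 / 4)"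
    unfolding eq integral_mult_right_zero
      integral_complex_prod(2)[OF gaussian_exp_integral(1) gaussian_exp_integral(1)] gaussian_exp_integral(2)
    by (rule e)
qed

lemma cgauss_fourier_integral:
  "integrable lborel (\<lambda>z. of_real (cgauss z) * cis (Re (z * b)))"
  "(\<integral>z. of_real (cgauss z) * cis (Re (z * b)) \<partial>lborel) = of_real (exp (- (norm b)\<^sup>2 / 4))"
proof -
  have eq: "of_real (cgauss z) * cis (Re (z * b)) = of_real (1 / pi) * ((of_real (exp (- (Re z)\<^sup>2)) * cis (Re b * Re z))
     * (of_real (exp (- (Im z)\<^sup>2)) * cis ((- Im b) * Im z)))" for z
  proof -
    have "cgauss z = 1 / pi * (exp (- (Re z)\<^sup>2) * exp (- (Im z)\<^sup>2))"
      unfolding cgauss_def exp_add[symmetric] by (simp add: cmod_power2)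
    moreover have "cis (Re (z * b)) = cis (Re b * Re z) * cis ((- Im b) * Im z)"
      unfolding cis_mult by (simp add: algebra_simps)
    ultimately show ?thesis by simp
  qed
  show "integrable lborel (\<lambda>z. of_real (cgauss z) * cis (Re (z * b)))"
    unfolding eq by (intro integrable_mult_right integral_complex_prod gaussian_fourier_integral)
  have "1 / pi * (sqrt pi * u * (sqrt pi * v)) = u * v" for u v
  proof -
    have "1 / pi * (sqrt pi * u * (sqrt pi * v)) = 1 / pi * (sqrt pi * sqrt pi) * (u * v)" by (simp only: mult_ac)
    also have "sqrt pi * sqrt pi = pi" by simp
    finally show ?thesis by simp
  qed
  then have *: "1 / pi * (sqrt pi * exp (- (Re b)\<^sup>2 / 4) * (sqrt pi * exp (- (- Im b)\<^sup>2 / 4))) = exp (- (norm b)\<^sup>2 / 4)"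
    by (simp add: cmod_power2 field_simps flip: exp_add)
  show "(\<integral>z. of_real (cgauss z) * cis (Re (z * b)) \<partial>lborel) = of_real (exp (- (norm b)\<^sup>2 / 4))"
    unfolding eq integral_mult_right_zero
      integral_complex_prod(2)[OF gaussian_fourier_integral(1) gaussian_fourier_integral(1)]
      gaussian_fourier_integral(2) of_real_mult[symmetric] * ..
qed

lemma cgauss_integral: "integrable lborel cgauss" "(\<integral>z. cgauss z \<partial>lborel) = 1"
  using cgauss_exp_integral[of 0] by simp_all

text \<open>The extra factor only rescales the Gaussian by \<open>sqrt (1 + s)\<close>, and the
  Jacobian in real dimension two is \<open>1 + s\<close>.\<close>

lemma cgauss_quadratic_integral:
  assumes "0 \<le> s"
  shows "integrable lborel (\<lambda>z. cgauss z * exp (- s * (norm z)\<^sup>2))"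
    "(\<integral>z. cgauss z * exp (- s * (norm z)\<^sup>2) \<partial>lborel) = 1 / (1 + s)"
proof -
  define r where "r = sqrt (1 + s)"
  have r: "r > 0" "r\<^sup>2 = 1 + s" using assms by (auto simp: r_def)
  have eq: "cgauss z * exp (- s * (norm z)\<^sup>2) = cgauss (0 + r *\<^sub>R z)" for z
    unfolding cgauss_def by (simp add: power_mult_distrib r exp_add[symmetric] algebra_simps)
  have l: "(lborel :: complex measure) = density (distr lborel borel (\<lambda>x. 0 + r *\<^sub>R x)) (\<lambda>_. \<bar>r\<bar>^DIM(complex))"
    by (rule lborel_affine) (use r in simp)
  have D: "(\<lambda>x::complex. 0 + r *\<^sub>R x) \<in> lborel \<rightarrow>\<^sub>M borel" by measurable
  have "integrable (density (distr lborel borel (\<lambda>x. 0 + r *\<^sub>R x)) (\<lambda>_. \<bar>r\<bar>^DIM(complex))) cgauss"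
    using cgauss_integral(1) l by simp
  then have "integrable (distr lborel borel (\<lambda>x. 0 + r *\<^sub>R x)) cgauss"
    using r assms by (subst (asm) integrable_density) auto
  then show "integrable lborel (\<lambda>z. cgauss z * exp (- s * (norm z)\<^sup>2))"
    unfolding eq by (subst (asm) integrable_distr_eq) auto
  have "1 = (\<integral>z. cgauss z \<partial>density (distr lborel borel (\<lambda>x. 0 + r *\<^sub>R x)) (\<lambda>_. \<bar>r\<bar>^DIM(complex)))"
    using cgauss_integral(2) l by simp
  also have "\<dots> = (\<integral>z. r\<^sup>2 * cgauss z \<partial>distr lborel borel (\<lambda>x. 0 + r *\<^sub>R x))"
    using r assms by (subst integral_density) auto
  also have "\<dots> = r\<^sup>2 * (\<integral>z. cgauss (0 + r *\<^sub>R z) \<partial>lborel)"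
    by (subst integral_distr) auto
  finally show "(\<integral>z. cgauss z * exp (- s * (norm z)\<^sup>2) \<partial>lborel) = 1 / (1 + s)"
    unfolding eq using r assms by (simp add: field_simps)
qed

section \<open>The Gaussian measure on coefficient vectors\<close>

definition gdens :: "'i set \<Rightarrow> ('i \<Rightarrow> complex) \<Rightarrow> real" where
  "gdens I a = (\<Prod>i\<in>I. cgauss (a i))"

definition gmeas :: "'i set \<Rightarrow> ('i \<Rightarrow> complex) measure" where
  "gmeas I = density (\<Pi>\<^sub>M i\<in>I. lborel) (\<lambda>a. ennreal (gdens I a))"

lemma gdens_nonneg: "0 \<le> gdens I a" and gdens_pos: "0 < gdens I a"
  unfolding gdens_def by (simp_all add: prod_nonneg prod_pos cgauss_nonneg cgauss_pos)

lemma measurable_gdens[measurable]: "gdens I \<in> borel_measurable (\<Pi>\<^sub>M i\<in>I. lborel)"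
  unfolding gdens_def by measurable

lemma sets_gmeas: "sets (gmeas I) = sets (\<Pi>\<^sub>M i\<in>I. borel)"
  unfolding gmeas_def by (simp cong: sets_PiM_cong)

lemma space_gmeas: "space (gmeas I) = extensional I"
  by (simp add: gmeas_def space_PiM PiE_def)

lemma product_sigma_finite_lborel: "product_sigma_finite (\<lambda>_. lborel :: complex measure)"
  by (simp add: product_sigma_finite_def sigma_finite_lborel)

lemma sigma_finite_PiM_lborel: "finite I \<Longrightarrow> sigma_finite_measure (\<Pi>\<^sub>M i\<in>I. lborel :: complex measure)"
  using product_sigma_finite.sigma_finite[OF product_sigma_finite_lborel] .

lemma integral_gdens_prod:
  fixes h :: "'i \<Rightarrow> complex \<Rightarrow> 'b::{real_normed_field,banach,second_countable_topology}"
  assumes "finite I" "\<And>i. i \<in> I \<Longrightarrow> integrable lborel (\<lambda>z. of_real (cgauss z) * h i z)"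
  shows "integrable (\<Pi>\<^sub>M i\<in>I. lborel) (\<lambda>a. of_real (gdens I a) * (\<Prod>i\<in>I. h i (a i)))"
    and "(\<integral>a. of_real (gdens I a) * (\<Prod>i\<in>I. h i (a i)) \<partial>(\<Pi>\<^sub>M i\<in>I. lborel))
      = (\<Prod>i\<in>I. \<integral>z. of_real (cgauss z) * h i z \<partial>lborel)"
proof -
  interpret product_sigma_finite "\<lambda>_::'i. lborel :: complex measure"
    by (rule product_sigma_finite_lborel)
  have eq: "of_real (gdens I a) * (\<Prod>i\<in>I. h i (a i)) = (\<Prod>i\<in>I. of_real (cgauss (a i)) * h i (a i))" for a
    by (simp add: gdens_def prod.distrib)
  show "integrable (\<Pi>\<^sub>M i\<in>I. lborel) (\<lambda>a. of_real (gdens I a) * (\<Prod>i\<in>I. h i (a i)))"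
    unfolding eq by (rule product_integrable_prod[OF assms])
  show "(\<integral>a. of_real (gdens I a) * (\<Prod>i\<in>I. h i (a i)) \<partial>(\<Pi>\<^sub>M i\<in>I. lborel))
      = (\<Prod>i\<in>I. \<integral>z. of_real (cgauss z) * h i z \<partial>lborel)"
    unfolding eq by (rule product_integral_prod[OF assms])
qed

lemma integral_gdens:
  assumes "finite I"
  shows "integrable (\<Pi>\<^sub>M i\<in>I. lborel) (gdens I)" "(\<integral>a. gdens I a \<partial>(\<Pi>\<^sub>M i\<in>I. lborel)) = 1"
  using integral_gdens_prod[OF assms, of "\<lambda>_ _. 1::real"] cgauss_integral by simp_all

lemma prob_space_gmeas: "finite I \<Longrightarrow> prob_space (gmeas I)"
  unfolding gmeas_def
  by (rule prob_spaceI) (simp add: emeasure_density nn_integral_eq_integral integral_gdens gdens_nonneg cong: nn_integral_cong)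

text \<open>Markov's inequality with a majorant \<open>h\<close> of the indicator; the small-ball
  and the tail estimate both use it with an exponential \<open>h\<close>.\<close>

lemma measure_gmeas_le:
  assumes A: "A \<in> sets (\<Pi>\<^sub>M i\<in>I. borel)"
    and int: "integrable (\<Pi>\<^sub>M i\<in>I. lborel) (\<lambda>a. gdens I a * h a)"
    and h: "\<And>a. a \<in> A \<Longrightarrow> 1 \<le> h a" "\<And>a. 0 \<le> h a"
  shows "measure (gmeas I) A \<le> (\<integral>a. gdens I a * h a \<partial>(\<Pi>\<^sub>M i\<in>I. lborel))"
proof -
  have A': "A \<in> sets (\<Pi>\<^sub>M i\<in>I. lborel)" using A by (simp cong: sets_PiM_cong)
  have "emeasure (gmeas I) A = (\<integral>\<^sup>+a. ennreal (gdens I a) * indicator A a \<partial>(\<Pi>\<^sub>M i\<in>I. lborel))"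
    unfolding gmeas_def by (rule emeasure_density[OF _ A']) measurable
  also have "\<dots> \<le> (\<integral>\<^sup>+a. ennreal (gdens I a * h a) \<partial>(\<Pi>\<^sub>M i\<in>I. lborel))"
  proof (rule nn_integral_mono)
    fix a
    have "gdens I a * 1 \<le> gdens I a * h a" if "a \<in> A"
      using h(1)[OF that] gdens_nonneg by (rule mult_left_mono)
    then show "ennreal (gdens I a) * indicator A a \<le> ennreal (gdens I a * h a)"
      by (auto simp: indicator_def intro!: ennreal_leI)
  qed
  also have "\<dots> = ennreal (\<integral>a. gdens I a * h a \<partial>(\<Pi>\<^sub>M i\<in>I. lborel))"
    by (rule nn_integral_eq_integral[OF int]) (simp add: h gdens_nonneg)
  finally show ?thesis
    unfolding measure_def
    by (rule enn2real_leI[rotated]) (intro integral_nonneg_AE, simp add: h gdens_nonneg)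
qed

lemma cis_sum: "finite A \<Longrightarrow> cis (\<Sum>i\<in>A. f i) = (\<Prod>i\<in>A. cis (f i))"
  by (induction A rule: finite_induct) (simp_all add: cis_mult[symmetric])

lemma integral_gdens_cis:
  assumes "finite I"
  shows "integrable (\<Pi>\<^sub>M i\<in>I. lborel) (\<lambda>a. of_real (gdens I a) * cis (Re (\<Sum>i\<in>I. a i * c i)))"
    and "(\<integral>a. of_real (gdens I a) * cis (Re (\<Sum>i\<in>I. a i * c i)) \<partial>(\<Pi>\<^sub>M i\<in>I. lborel))
      = of_real (exp (- (\<Sum>i\<in>I. (norm (c i))\<^sup>2) / 4))"
proof -
  have eq: "cis (Re (\<Sum>i\<in>I. a i * c i)) = (\<Prod>i\<in>I. cis (Re (a i * c i)))" for a
    unfolding Re_sum by (rule cis_sum[OF assms])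
  show "integrable (\<Pi>\<^sub>M i\<in>I. lborel) (\<lambda>a. of_real (gdens I a) * cis (Re (\<Sum>i\<in>I. a i * c i)))"
    unfolding eq by (intro integral_gdens_prod assms cgauss_fourier_integral)
  have "(\<integral>a. of_real (gdens I a) * cis (Re (\<Sum>i\<in>I. a i * c i)) \<partial>(\<Pi>\<^sub>M i\<in>I. lborel))
      = (\<Prod>i\<in>I. of_real (exp (- (norm (c i))\<^sup>2 / 4)))"
    unfolding eq by (subst integral_gdens_prod(2)[OF assms cgauss_fourier_integral(1)]) (simp only: cgauss_fourier_integral(2))
  also have "\<dots> = of_real (exp (- (\<Sum>i\<in>I. (norm (c i))\<^sup>2) / 4))"
    by (simp add: exp_sum[OF assms] sum_divide_distrib sum_negf[symmetric])
  finally show "(\<integral>a. of_real (gdens I a) * cis (Re (\<Sum>i\<in>I. a i * c i)) \<partial>(\<Pi>\<^sub>M i\<in>I. lborel))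
      = of_real (exp (- (\<Sum>i\<in>I. (norm (c i))\<^sup>2) / 4))" .
qed

lemma pythagoras_orthogonal:
  assumes "finite J" and orth: "\<And>j k. j \<in> J \<Longrightarrow> k \<in> J \<Longrightarrow> j \<noteq> k \<Longrightarrow> (\<Sum>i\<in>I. b j i * cnj (b k i)) = 0"
  shows "(\<Sum>i\<in>I. (norm (\<Sum>j\<in>J. w j * b j i))\<^sup>2) = (\<Sum>j\<in>J. (norm (w j))\<^sup>2 * (\<Sum>i\<in>I. (norm (b j i))\<^sup>2))"
proof -
  have "complex_of_real (\<Sum>i\<in>I. (norm (\<Sum>j\<in>J. w j * b j i))\<^sup>2) = (\<Sum>i\<in>I. (\<Sum>j\<in>J. w j * b j i) * cnj (\<Sum>j\<in>J. w j * b j i))"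
    unfolding of_real_sum complex_norm_square ..
  also have "\<dots> = (\<Sum>i\<in>I. \<Sum>j\<in>J. \<Sum>k\<in>J. w j * cnj (w k) * (b j i * cnj (b k i)))"
    by (simp add: sum_product mult_ac)
  also have "\<dots> = (\<Sum>j\<in>J. \<Sum>k\<in>J. \<Sum>i\<in>I. w j * cnj (w k) * (b j i * cnj (b k i)))"
    by (subst sum.swap) (rule sum.cong[OF refl], rule sum.swap)
  also have "\<dots> = (\<Sum>j\<in>J. \<Sum>k\<in>J. if k = j then w j * cnj (w k) * (\<Sum>i\<in>I. b j i * cnj (b k i)) else 0)"
    by (intro sum.cong refl) (auto simp: sum_distrib_left[symmetric] orth)
  also have "\<dots> = (\<Sum>j\<in>J. w j * cnj (w j) * (\<Sum>i\<in>I. b j i * cnj (b j i)))"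
    using assms(1) by simp
  also have "\<dots> = complex_of_real (\<Sum>j\<in>J. (norm (w j))\<^sup>2 * (\<Sum>i\<in>I. (norm (b j i))\<^sup>2))"
    unfolding of_real_sum of_real_mult complex_norm_square ..
  finally show ?thesis by (simp only: of_real_eq_iff)
qed

text \<open>\<open>exp (- |l|\<^sup>2)\<close> is the Fourier transform of a Gaussian; exchanging the two Gaussian integrals
  turns the linear forms \<open>l\<close> into coefficients, where their orthogonality decouples them.\<close>

lemma integral_gdens_linear_forms:
  fixes b :: "'j \<Rightarrow> 'i \<Rightarrow> complex"
  assumes I: "finite I" and J: "finite J"
    and orth: "\<And>j k. j \<in> J \<Longrightarrow> k \<in> J \<Longrightarrow> j \<noteq> k \<Longrightarrow> (\<Sum>i\<in>I. b j i * cnj (b k i)) = 0"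
  shows "integrable (\<Pi>\<^sub>M i\<in>I. lborel) (\<lambda>a. gdens I a * exp (- (\<Sum>j\<in>J. (norm (\<Sum>i\<in>I. a i * b j i))\<^sup>2)))"
    and "(\<integral>a. gdens I a * exp (- (\<Sum>j\<in>J. (norm (\<Sum>i\<in>I. a i * b j i))\<^sup>2)) \<partial>(\<Pi>\<^sub>M i\<in>I. lborel))
      = (\<Prod>j\<in>J. 1 / (1 + (\<Sum>i\<in>I. (norm (b j i))\<^sup>2)))"
proof -
  let ?LI = "\<Pi>\<^sub>M i\<in>I. lborel :: complex measure" and ?LJ = "\<Pi>\<^sub>M j\<in>J. lborel :: complex measure"
  have sI: "sigma_finite_measure ?LI" and sJ: "sigma_finite_measure ?LJ"
    using sigma_finite_PiM_lborel I J by auto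
  interpret P: pair_sigma_finite ?LI ?LJ
    using sI sJ by (simp add: pair_sigma_finite_def)
  define lf where "lf a j = (\<Sum>i\<in>I. a i * b j i)" for a j
  \<comment> \<open>The factor 2 offsets the 1/4 in the exponent of
    \<open>integral_gdens_cis\<close>, so that integrating out \<open>w\<close> leaves exactly exp
    (- |l|^2).\<close>
  define f where "f a w = complex_of_real (gdens I a) * (of_real (gdens J w) * cis (Re (\<Sum>j\<in>J. w j * (2 * lf a j))))" for a w
  have f': "f a w = of_real (gdens J w) * (of_real (gdens I a) * cis (Re (\<Sum>i\<in>I. a i * (\<Sum>j\<in>J. 2 * w j * b j i))))" for a w
  proof -
    have "(\<Sum>j\<in>J. w j * (2 * lf a j)) = (\<Sum>j\<in>J. \<Sum>i\<in>I. a i * (2 * w j * b j i))"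
      by (simp add: lf_def sum_distrib_left mult_ac)
    also have "\<dots> = (\<Sum>i\<in>I. a i * (\<Sum>j\<in>J. 2 * w j * b j i))"
      by (subst sum.swap) (simp add: sum_distrib_left)
    finally show ?thesis by (simp add: f_def mult_ac)
  qed
  have int_w: "(\<integral>w. f a w \<partial>?LJ) = of_real (gdens I a * exp (- (\<Sum>j\<in>J. (norm (lf a j))\<^sup>2)))" for a
    unfolding f_def integral_mult_right_zero integral_gdens_cis(2)[OF J]
    by (simp add: norm_mult power_mult_distrib sum_distrib_left[symmetric])
  have pyth: "(\<Sum>i\<in>I. (norm (\<Sum>j\<in>J. w j * b j i))\<^sup>2) = (\<Sum>j\<in>J. (norm (w j))\<^sup>2 * (\<Sum>i\<in>I. (norm (b j i))\<^sup>2))" for w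
    by (rule pythagoras_orthogonal[OF J]) (use orth in simp)
  have int_a: "(\<integral>a. f a w \<partial>?LI) = of_real (gdens J w * (\<Prod>j\<in>J. exp (- (\<Sum>i\<in>I. (norm (b j i))\<^sup>2) * (norm (w j))\<^sup>2)))" for w
  proof -
    have "(\<Sum>i\<in>I. (norm (\<Sum>j\<in>J. 2 * w j * b j i))\<^sup>2) / 4 = (\<Sum>j\<in>J. (norm (w j))\<^sup>2 * (\<Sum>i\<in>I. (norm (b j i))\<^sup>2))"
      using pyth[of "\<lambda>j. 2 * w j"]
      by (simp add: norm_mult power_mult_distrib mult.assoc sum_distrib_left[symmetric])
    then show ?thesis
      unfolding f' integral_mult_right_zero integral_gdens_cis(2)[OF I]
      by (simp add: exp_sum[OF J, symmetric] sum_negf mult.commute)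
  qed
  have nf: "norm (f a w) = gdens I a * gdens J w" for a w
    unfolding f_def norm_mult by (simp add: abs_of_nonneg[OF gdens_nonneg])
  have int_f: "integrable (?LI \<Otimes>\<^sub>M ?LJ) (case_prod f)"
  proof (rule P.Fubini_integrable)
    show "case_prod f \<in> borel_measurable (?LI \<Otimes>\<^sub>M ?LJ)"
      unfolding f_def lf_def gdens_def cis_conv_exp by measurable
    show "integrable ?LI (\<lambda>a. \<integral>w. norm (case (a, w) of (a, w) \<Rightarrow> f a w) \<partial>?LJ)"
      using integral_gdens[OF I] integral_gdens[OF J] by (simp add: nf)
    show "AE a in ?LI. integrable ?LJ (\<lambda>w. case (a, w) of (a, w) \<Rightarrow> f a w)"
      unfolding f_def prod.case by (intro AE_I2 integrable_mult_right integral_gdens_cis(1)[OF J])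
  qed
  from P.integrable_fst'[OF int_f]
  have "integrable ?LI (\<lambda>a. complex_of_real (gdens I a * exp (- (\<Sum>j\<in>J. (norm (lf a j))\<^sup>2))))"
    by (simp only: prod.case int_w)
  from integrable_Re[OF this]
  show "integrable ?LI (\<lambda>a. gdens I a * exp (- (\<Sum>j\<in>J. (norm (\<Sum>i\<in>I. a i * b j i))\<^sup>2)))"
    by (simp only: Re_complex_of_real lf_def)
  have "complex_of_real (\<integral>a. gdens I a * exp (- (\<Sum>j\<in>J. (norm (lf a j))\<^sup>2)) \<partial>?LI)
      = (\<integral>a. (\<integral>w. f a w \<partial>?LJ) \<partial>?LI)"
    unfolding int_w by (rule integral_complex_of_real[symmetric])
  also have "\<dots> = (\<integral>w. (\<integral>a. f a w \<partial>?LI) \<partial>?LJ)"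
    by (rule P.Fubini_integral[OF int_f, symmetric])
  also have "\<dots> = of_real (\<integral>w. gdens J w * (\<Prod>j\<in>J. exp (- (\<Sum>i\<in>I. (norm (b j i))\<^sup>2) * (norm (w j))\<^sup>2)) \<partial>?LJ)"
    unfolding int_a by (rule integral_complex_of_real)
  also have "(\<integral>w. gdens J w * (\<Prod>j\<in>J. exp (- (\<Sum>i\<in>I. (norm (b j i))\<^sup>2) * (norm (w j))\<^sup>2)) \<partial>?LJ)
      = (\<Prod>j\<in>J. \<integral>z. cgauss z * exp (- (\<Sum>i\<in>I. (norm (b j i))\<^sup>2) * (norm z)\<^sup>2) \<partial>lborel)"
    using integral_gdens_prod(2)[OF J, of "\<lambda>j z. exp (- (\<Sum>i\<in>I. (norm (b j i))\<^sup>2) * (norm z)\<^sup>2)"]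
      cgauss_quadratic_integral(1) by (simp add: sum_nonneg)
  also have "\<dots> = (\<Prod>j\<in>J. 1 / (1 + (\<Sum>i\<in>I. (norm (b j i))\<^sup>2)))"
    by (intro prod.cong refl cgauss_quadratic_integral(2)) (simp add: sum_nonneg)
  finally show "(\<integral>a. gdens I a * exp (- (\<Sum>j\<in>J. (norm (\<Sum>i\<in>I. a i * b j i))\<^sup>2)) \<partial>?LI)
      = (\<Prod>j\<in>J. 1 / (1 + (\<Sum>i\<in>I. (norm (b j i))\<^sup>2)))"
    by (simp only: of_real_eq_iff lf_def)
qed

text \<open>On the event each form divided by its radius has modulus at most 1, so e^|J| times the
  Gaussian weight of these quotients majorizes the indicator. By orthogonality its mean is a product
  of factors 1 / (1 + U/r^2), each at most r^2/U.\<close>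

lemma gaussian_small_ball:
  fixes u :: "'j \<Rightarrow> 'i \<Rightarrow> complex"
  assumes I: "finite I" and J: "finite J"
    and orth: "\<And>j k. j \<in> J \<Longrightarrow> k \<in> J \<Longrightarrow> j \<noteq> k \<Longrightarrow> (\<Sum>i\<in>I. u j i * cnj (u k i)) = 0"
    and u: "\<And>j. j \<in> J \<Longrightarrow> (\<Sum>i\<in>I. (norm (u j i))\<^sup>2) = U j" "\<And>j. j \<in> J \<Longrightarrow> 0 < U j"
    and r: "\<And>j. j \<in> J \<Longrightarrow> 0 < r j"
  shows "measure (gmeas I) {a \<in> space (gmeas I). \<forall>j\<in>J. norm (\<Sum>i\<in>I. a i * u j i) \<le> r j}
    \<le> exp (card J) * (\<Prod>j\<in>J. (r j)\<^sup>2 / U j)"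
proof -
  define b where "b j i = u j i / of_real (r j)" for j i
  define h where "h a = exp (card J) * exp (- (\<Sum>j\<in>J. (norm (\<Sum>i\<in>I. a i * b j i))\<^sup>2))" for a
  have bu: "norm (\<Sum>i\<in>I. a i * b j i) = norm (\<Sum>i\<in>I. a i * u j i) / r j" if "j \<in> J" for a j
    using r[OF that] by (simp add: b_def sum_divide_distrib[symmetric] norm_divide)
  have orthb: "(\<Sum>i\<in>I. b j i * cnj (b k i)) = 0" if "j \<in> J" "k \<in> J" "j \<noteq> k" for j k
    using orth[OF that] by (simp add: b_def sum_divide_distrib[symmetric])
  have nb: "(\<Sum>i\<in>I. (norm (b j i))\<^sup>2) = U j / (r j)\<^sup>2" if "j \<in> J" for j
    using u(1)[OF that] by (simp add: b_def norm_divide power_divide sum_divide_distrib[symmetric])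
  have int: "integrable (\<Pi>\<^sub>M i\<in>I. lborel) (\<lambda>a. gdens I a * exp (- (\<Sum>j\<in>J. (norm (\<Sum>i\<in>I. a i * b j i))\<^sup>2)))"
    "(\<integral>a. gdens I a * exp (- (\<Sum>j\<in>J. (norm (\<Sum>i\<in>I. a i * b j i))\<^sup>2)) \<partial>(\<Pi>\<^sub>M i\<in>I. lborel))
      = (\<Prod>j\<in>J. 1 / (1 + (\<Sum>i\<in>I. (norm (b j i))\<^sup>2)))"
    by (rule integral_gdens_linear_forms[OF I J]; use orthb in simp)+
  have "{a \<in> space (gmeas I). \<forall>j\<in>J. norm (\<Sum>i\<in>I. a i * u j i) \<le> r j} \<in> sets (\<Pi>\<^sub>M i\<in>I. borel)"
    (is "?A \<in> _")
  proof -
    have "{a \<in> space (\<Pi>\<^sub>M i\<in>I. borel :: complex measure). \<forall>j\<in>J. norm (\<Sum>i\<in>I. a i * u j i) \<le> r j} \<in> sets (\<Pi>\<^sub>M i\<in>I. borel)"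
      by (rule sets.sets_Collect_finite_All[OF _ J]) measurable
    then show ?thesis by (simp add: space_gmeas space_PiM PiE_def)
  qed
  then have "measure (gmeas I) ?A \<le> (\<integral>a. gdens I a * h a \<partial>(\<Pi>\<^sub>M i\<in>I. lborel))"
  proof (rule measure_gmeas_le)
    show "integrable (\<Pi>\<^sub>M i\<in>I. lborel) (\<lambda>a. gdens I a * h a)"
      using integrable_mult_right[OF int(1), of "exp (card J)"] by (simp add: h_def mult_ac)
    show "0 \<le> h a" for a by (simp add: h_def)
    show "1 \<le> h a" if "a \<in> ?A" for a
    proof -
      have "(norm (\<Sum>i\<in>I. a i * b j i))\<^sup>2 \<le> 1" if "j \<in> J" for j
        using that \<open>a \<in> ?A\<close> r[OF that] by (auto simp: bu[OF that] power_le_one divide_le_eq_1)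
      then have "(\<Sum>j\<in>J. (norm (\<Sum>i\<in>I. a i * b j i))\<^sup>2) \<le> (\<Sum>j\<in>J. 1)" by (rule sum_mono)
      then show ?thesis by (simp add: h_def exp_add[symmetric])
    qed
  qed
  also have "\<dots> = exp (card J) * (\<Prod>j\<in>J. 1 / (1 + (\<Sum>i\<in>I. (norm (b j i))\<^sup>2)))"
    unfolding int(2)[symmetric] h_def
    by (subst integral_mult_right_zero[symmetric]) (simp add: mult_ac)
  also have "(\<Prod>j\<in>J. 1 / (1 + (\<Sum>i\<in>I. (norm (b j i))\<^sup>2))) \<le> (\<Prod>j\<in>J. (r j)\<^sup>2 / U j)"
  proof (rule prod_mono)
    fix j assume j: "j \<in> J"
    have "1 / (1 + U j / (r j)\<^sup>2) \<le> 1 / (U j / (r j)\<^sup>2)"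
      using u(2)[OF j] r[OF j] by (intro divide_left_mono) (auto simp: field_simps add_pos_pos)
    then show "0 \<le> 1 / (1 + (\<Sum>i\<in>I. (norm (b j i))\<^sup>2)) \<and> 1 / (1 + (\<Sum>i\<in>I. (norm (b j i))\<^sup>2)) \<le> (r j)\<^sup>2 / U j"
      using u(2)[OF j] r[OF j] by (simp add: nb[OF j])
  qed
  finally show ?thesis by simp
qed

lemma gaussian_tail_Re:
  assumes I: "finite I" and u: "(\<Sum>i\<in>I. (norm (u i))\<^sup>2) \<le> U" "0 < U" and s: "0 \<le> s"
  shows "measure (gmeas I) {a \<in> space (gmeas I). s \<le> Re (\<Sum>i\<in>I. a i * u i)} \<le> exp (- s\<^sup>2 / U)"
proof -
  \<comment> \<open>The minimizer of - l s + l^2 U / 4, the exponent in the Chernoff bound.\<close>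
  define l where "l = 2 * s / U"
  define h where "h a = exp (- (l * s)) * exp (Re (\<Sum>i\<in>I. a i * (of_real l * u i)))" for a
  have e: "exp (Re (\<Sum>i\<in>I. a i * c i)) = (\<Prod>i\<in>I. exp (Re (a i * c i)))" for a c :: "'a \<Rightarrow> complex"
    unfolding Re_sum by (rule exp_sum[OF I])
  have int: "integrable (\<Pi>\<^sub>M i\<in>I. lborel) (\<lambda>a. gdens I a * exp (Re (\<Sum>i\<in>I. a i * c i)))"
    "(\<integral>a. gdens I a * exp (Re (\<Sum>i\<in>I. a i * c i)) \<partial>(\<Pi>\<^sub>M i\<in>I. lborel)) = (\<Prod>i\<in>I. exp ((norm (c i))\<^sup>2 / 4))" for c
    unfolding e using integral_gdens_prod[OF I, of "\<lambda>i z. exp (Re (z * c i))"] cgauss_exp_integral[of "c _"]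
    by simp_all
  have "{a \<in> space (\<Pi>\<^sub>M i\<in>I. borel :: complex measure). s \<le> Re (\<Sum>i\<in>I. a i * u i)} \<in> sets (\<Pi>\<^sub>M i\<in>I. borel)"
    by measurable
  then have "{a \<in> space (gmeas I). s \<le> Re (\<Sum>i\<in>I. a i * u i)} \<in> sets (\<Pi>\<^sub>M i\<in>I. borel)" (is "?A \<in> _")
    by (simp add: space_gmeas space_PiM PiE_def)
  then have "measure (gmeas I) ?A \<le> (\<integral>a. gdens I a * h a \<partial>(\<Pi>\<^sub>M i\<in>I. lborel))"
  proof (rule measure_gmeas_le)
    show "integrable (\<Pi>\<^sub>M i\<in>I. lborel) (\<lambda>a. gdens I a * h a)"
      using integrable_mult_right[OF int(1), of "exp (- (l * s))" "\<lambda>i. of_real l * u i"] by (simp add: h_def mult_ac)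
    show "0 \<le> h a" for a by (simp add: h_def)
    show "1 \<le> h a" if "a \<in> ?A" for a
    proof -
      have "(\<Sum>i\<in>I. a i * (of_real l * u i)) = of_real l * (\<Sum>i\<in>I. a i * u i)"
        by (simp add: sum_distrib_left mult_ac)
      moreover have "l * s \<le> l * Re (\<Sum>i\<in>I. a i * u i)"
        using that s u(2) by (intro mult_left_mono) (auto simp: l_def)
      ultimately show ?thesis by (simp add: h_def exp_add[symmetric])
    qed
  qed
  also have "\<dots> = exp (- (l * s)) * (\<Prod>i\<in>I. exp ((norm (of_real l * u i))\<^sup>2 / 4))"
    unfolding int(2)[symmetric] h_def
    by (subst integral_mult_right_zero[symmetric]) (simp add: mult_ac)
  also have "\<dots> = exp (- (l * s) + l\<^sup>2 * (\<Sum>i\<in>I. (norm (u i))\<^sup>2) / 4)"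
    unfolding exp_add exp_sum[OF I, symmetric]
    by (simp add: norm_mult power_mult_distrib sum_distrib_left sum_divide_distrib)
  also have "\<dots> \<le> exp (- (l * s) + l\<^sup>2 * U / 4)"
    using u by (simp add: mult_left_mono)
  also have "- (l * s) + l\<^sup>2 * U / 4 = - s\<^sup>2 / U"
    using u(2) by (simp add: l_def field_simps power2_eq_square)
  finally show ?thesis .
qed

text \<open>If |z| is at least s, then one of the four rotations of z by 1, -1, i, -i has real part
  at least s / sqrt 2. This costs the factor 4 and doubles \<open>U\<close>.\<close>

lemma gaussian_tail:
  assumes I: "finite I" and u: "(\<Sum>i\<in>I. (norm (u i))\<^sup>2) \<le> U" "0 < U" and s: "0 \<le> s"
  shows "measure (gmeas I) {a \<in> space (gmeas I). s \<le> norm (\<Sum>i\<in>I. a i * u i)} \<le> 4 * exp (- s\<^sup>2 / (2 * U))"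
proof -
  interpret prob_space "gmeas I" by (rule prob_space_gmeas[OF I])
  define A where "A c = {a \<in> space (gmeas I). s / sqrt 2 \<le> Re (\<Sum>i\<in>I. a i * (c * u i))}" for c
  have eq: "(\<Sum>i\<in>I. a i * (c * u i)) = c * (\<Sum>i\<in>I. a i * u i)" for a c
    by (simp add: sum_distrib_left mult_ac)
  have m: "A c \<in> events" for c
  proof -
    have "{a \<in> space (\<Pi>\<^sub>M i\<in>I. borel :: complex measure). s / sqrt 2 \<le> Re (\<Sum>i\<in>I. a i * (c * u i))} \<in> sets (\<Pi>\<^sub>M i\<in>I. borel)"
      by measurable
    then show ?thesis by (simp add: A_def space_gmeas space_PiM PiE_def sets_gmeas)
  qed
  have p: "prob (A c) \<le> exp (- s\<^sup>2 / (2 * U))" if "norm c = 1" for c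
    using gaussian_tail_Re[OF I, of "\<lambda>i. c * u i" U "s / sqrt 2"] u s that
    by (simp add: A_def norm_mult power_divide)
  have "{a \<in> space (gmeas I). s \<le> norm (\<Sum>i\<in>I. a i * u i)} \<subseteq> (\<Union>c\<in>{1, -1, \<i>, -\<i>}. A c)"
  proof
    fix a assume a: "a \<in> {a \<in> space (gmeas I). s \<le> norm (\<Sum>i\<in>I. a i * u i)}"
    define z where "z = (\<Sum>i\<in>I. a i * u i)"
    have "s / sqrt 2 \<le> \<bar>Re z\<bar> \<or> s / sqrt 2 \<le> \<bar>Im z\<bar>"
    proof (rule ccontr)
      assume "\<not> ?thesis"
      then have "\<bar>Re z\<bar> < s / sqrt 2" "\<bar>Im z\<bar> < s / sqrt 2" by auto
      from this[THEN power_strict_mono, of 2] have "(Re z)\<^sup>2 < (s / sqrt 2)\<^sup>2" "(Im z)\<^sup>2 < (s / sqrt 2)\<^sup>2"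
        by simp_all
      then have "(norm z)\<^sup>2 < s\<^sup>2" by (simp add: cmod_power2 power_divide)
      then show False using a s by (auto simp: z_def dest: power2_less_imp_less)
    qed
    then have "\<exists>c\<in>{1, -1, \<i>, -\<i>}. s / sqrt 2 \<le> Re (c * z)"
      by (auto simp: abs_if split: if_splits)
    then show "a \<in> (\<Union>c\<in>{1, -1, \<i>, -\<i>}. A c)"
      using a by (auto simp: A_def eq z_def)
  qed
  then have "prob {a \<in> space (gmeas I). s \<le> norm (\<Sum>i\<in>I. a i * u i)} \<le> prob (\<Union>c\<in>{1, -1, \<i>, -\<i>}. A c)"
    using m by (intro finite_measure_mono) auto
  also have "\<dots> \<le> (\<Sum>c\<in>{1, -1, \<i>, -\<i>}. prob (A c))"
    using m by (intro finite_measure_subadditive_finite) auto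
  also have "\<dots> \<le> (\<Sum>c\<in>{1, -1, \<i>, -\<i>::complex}. exp (- s\<^sup>2 / (2 * U)))"
    by (intro sum_mono p) auto
  also have "\<dots> \<le> 4 * exp (- s\<^sup>2 / (2 * U))"
  proof -
    have "card {1, -1, \<i>, -\<i>::complex} \<le> 4" by (intro card_insert_le_m1) auto
    then show ?thesis by (simp add: mult_right_mono del: card_insert_disjoint)
  qed
  finally show ?thesis .
qed

section \<open>Measures of cones\<close>

lemma emeasure_lborel_scale:
  fixes A :: "complex set"
  assumes c: "0 < c" and A: "A \<in> sets borel"
  shows "emeasure lborel A = ennreal (c\<^sup>2) * emeasure lborel ((\<lambda>z. of_real c * z) -` A)"
proof -
  have l: "(lborel :: complex measure) = density (distr lborel borel (\<lambda>x. 0 + c *\<^sub>R x)) (\<lambda>_. \<bar>c\<bar>^DIM(complex))"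
    by (rule lborel_affine) (use c in simp)
  have "emeasure lborel A = emeasure (density (distr lborel borel (\<lambda>x::complex. 0 + c *\<^sub>R x)) (\<lambda>_. \<bar>c\<bar>^DIM(complex))) A"
    using l by simp
  also have "\<dots> = ennreal (c\<^sup>2) * emeasure (distr lborel borel (\<lambda>x::complex. 0 + c *\<^sub>R x)) A"
    using A c by (subst emeasure_density) (simp_all add: nn_integral_cmult_indicator)
  also have "emeasure (distr lborel borel (\<lambda>x::complex. 0 + c *\<^sub>R x)) A = emeasure lborel ((\<lambda>z. of_real c * z) -` A)"
    using A by (subst emeasure_distr) (auto simp: scaleR_conv_of_real)
  finally show ?thesis .
qed

lemma emeasure_PiM_lborel_scale:
  fixes A :: "('i \<Rightarrow> complex) set"
  assumes I: "finite I" and c: "0 < c" and A: "A \<in> sets (\<Pi>\<^sub>M i\<in>I. lborel)"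
  shows "emeasure (\<Pi>\<^sub>M i\<in>I. lborel) A = ennreal (c ^ (2 * card I)) *
    emeasure (\<Pi>\<^sub>M i\<in>I. lborel) ((\<lambda>a. \<lambda>i\<in>I. of_real c * a i) -` A \<inter> space (\<Pi>\<^sub>M i\<in>I. lborel))"
proof -
  interpret product_sigma_finite "\<lambda>_::'i. lborel :: complex measure"
    by (rule product_sigma_finite_lborel)
  let ?L = "\<Pi>\<^sub>M i\<in>I. lborel :: complex measure" and ?T = "\<lambda>a::'i \<Rightarrow> complex. \<lambda>i\<in>I. of_real c * a i"
  have T: "?T \<in> ?L \<rightarrow>\<^sub>M ?L" by measurable
  have "scale_measure (ennreal (c ^ (2 * card I))) (distr ?L ?L ?T) = ?L"
  proof (rule PiM_eqI[OF I])
    show "sets (scale_measure (ennreal (c ^ (2 * card I))) (distr ?L ?L ?T)) = sets ?L" by simp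
    fix B :: "'i \<Rightarrow> complex set" assume B: "\<And>i. i \<in> I \<Longrightarrow> B i \<in> sets lborel"
    have B': "(\<lambda>z. of_real c * z) -` B i \<in> sets lborel" if "i \<in> I" for i
    proof -
      have "(\<lambda>z::complex. of_real c * z) \<in> borel \<rightarrow>\<^sub>M borel" by measurable
      from measurable_sets[OF this, of "B i"] show ?thesis using B[OF that] by simp
    qed
    have PB: "Pi\<^sub>E I B \<in> sets ?L" using B I by (intro sets_PiM_I_finite) auto
    have "?T -` Pi\<^sub>E I B \<inter> space ?L = Pi\<^sub>E I (\<lambda>i. (\<lambda>z. of_real c * z) -` B i)"
      by (auto simp: space_PiM PiE_iff extensional_def)
    then have "emeasure (distr ?L ?L ?T) (Pi\<^sub>E I B) = (\<Prod>i\<in>I. emeasure lborel ((\<lambda>z. of_real c * z) -` B i))"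
      using B' by (simp add: emeasure_distr[OF T PB] emeasure_PiM[OF I])
    moreover have "(\<Prod>i\<in>I. emeasure lborel (B i)) = ennreal (c ^ (2 * card I)) * (\<Prod>i\<in>I. emeasure lborel ((\<lambda>z. of_real c * z) -` B i))"
    proof -
      have "(\<Prod>i\<in>I. emeasure lborel (B i)) = (\<Prod>i\<in>I. ennreal (c\<^sup>2) * emeasure lborel ((\<lambda>z. of_real c * z) -` B i))"
        using B c by (intro prod.cong refl emeasure_lborel_scale) auto
      then show ?thesis using c by (simp add: prod.distrib ennreal_power power_mult)
    qed
    ultimately show "emeasure (scale_measure (ennreal (c ^ (2 * card I))) (distr ?L ?L ?T)) (Pi\<^sub>E I B) = (\<Prod>i\<in>I. emeasure lborel (B i))"
      by simp
  qed
  then have "emeasure ?L A = emeasure (scale_measure (ennreal (c ^ (2 * card I))) (distr ?L ?L ?T)) A" by simp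
  also have "\<dots> = ennreal (c ^ (2 * card I)) * emeasure ?L (?T -` A \<inter> space ?L)"
    by (simp add: emeasure_distr[OF T A])
  finally show ?thesis .
qed

lemma nn_integral_exp_atLeast:
  assumes "0 \<le> x"
  shows "(\<integral>\<^sup>+s. ennreal (exp (- s)) * indicator {x..} s \<partial>lborel) = ennreal (exp (- x))"
proof -
  have "(\<integral>\<^sup>+s. ennreal (exp (- s)) * indicator {x..} s \<partial>lborel) = ennreal (0 - (- exp (- x)))"
  proof (rule nn_integral_FTC_atLeast)
    show "((\<lambda>s::real. - exp (- s)) \<longlongrightarrow> 0) at_top" by real_asymp
  qed (auto intro!: derivative_eq_intros)
  then show ?thesis by simp
qed

definition cone :: "'i set \<Rightarrow> ('i \<Rightarrow> complex) set \<Rightarrow> bool" where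
  "cone I A \<longleftrightarrow> (\<forall>a \<in> extensional I. \<forall>c>0. (\<lambda>i\<in>I. of_real c * a i) \<in> A \<longleftrightarrow> a \<in> A)"

text \<open>Writing \<open>exp (- |a|\<^sup>2)\<close> as the integral of \<open>exp (- s)\<close> over \<open>s \<ge> |a|\<^sup>2\<close> shows that the Gaussian
  measure of a cone is proportional to the volume of its intersection with the unit ball.\<close>

lemma emeasure_gmeas_cone:
  assumes I: "finite I" and A: "A \<in> sets (\<Pi>\<^sub>M i\<in>I. lborel)" "cone I A"
  shows "emeasure (gmeas I) A = ennreal ((1 / pi) ^ card I) *
     ((\<integral>\<^sup>+s. ennreal (exp (- s) * s ^ card I) * indicator {0<..} s \<partial>lborel)
       * emeasure (\<Pi>\<^sub>M i\<in>I. lborel) (A \<inter> unit_ball I))"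
proof -
  let ?L = "\<Pi>\<^sub>M i\<in>I. lborel :: complex measure"
  interpret P: pair_sigma_finite ?L lborel
    using sigma_finite_PiM_lborel[OF I] by (simp add: pair_sigma_finite_def sigma_finite_lborel)
  define q where "q a = (\<Sum>i\<in>I. (norm (a i))\<^sup>2)" for a :: "'a \<Rightarrow> complex"
  have q[measurable]: "q \<in> borel_measurable ?L" unfolding q_def by measurable
  have q0: "0 \<le> q a" for a by (simp add: q_def sum_nonneg)
  note [measurable] = A(1)
  have g: "gdens I a = (1 / pi) ^ card I * exp (- q a)" for a
    unfolding gdens_def cgauss_def q_def prod_dividef exp_sum[OF I, symmetric]
    by (simp add: sum_negf exp_sum[OF I] power_one_over divide_inverse mult.commute power_inverse flip: exp_sum[OF I])
  \<comment> \<open>The slice is the part of the cone in the unit ball, dilated by sqrt s; in real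
    dimension 2 |I| the volume grows by s^|I|.\<close>
  have slice: "emeasure ?L {a \<in> space ?L. a \<in> A \<and> q a \<le> s} = ennreal (s ^ card I) * emeasure ?L (A \<inter> unit_ball I)"
    if s: "0 < s" for s
  proof -
    have r: "0 < sqrt s" using s by simp
    have B: "{a \<in> space ?L. a \<in> A \<and> q a \<le> s} \<in> sets ?L" by measurable
    have "(\<lambda>a. \<lambda>i\<in>I. of_real (sqrt s) * a i) -` {a \<in> space ?L. a \<in> A \<and> q a \<le> s} \<inter> space ?L = A \<inter> unit_ball I"
    proof -
      have "q (\<lambda>i\<in>I. of_real (sqrt s) * a i) = s * q a" for a
        using s unfolding q_def sum_distrib_left
        by (intro sum.cong refl) (simp add: norm_mult power_mult_distrib)
      moreover have "L2_set (\<lambda>i. norm (a i)) I \<le> 1 \<longleftrightarrow> q a \<le> 1" for a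
        by (simp add: L2_set_def q_def)
      moreover have "A \<subseteq> extensional I" using sets.sets_into_space[OF A(1)] by (simp add: space_PiM PiE_def)
      moreover have "(\<lambda>i\<in>I. of_real (sqrt s) * a i) \<in> A \<longleftrightarrow> a \<in> A" if "a \<in> extensional I" for a
        using A(2) that r unfolding cone_def by blast
      ultimately show ?thesis
        using s by (auto simp: space_PiM PiE_def unit_ball_def)
    qed
    moreover have "sqrt s ^ (2 * card I) = s ^ card I" using s by (simp add: power_mult)
    ultimately show ?thesis
      using emeasure_PiM_lborel_scale[OF I r B] by simp
  qed
  have "emeasure (gmeas I) A = (\<integral>\<^sup>+a. ennreal (gdens I a) * indicator A a \<partial>?L)"
    unfolding gmeas_def by (rule emeasure_density[OF _ A(1)]) measurable
  also have "\<dots> = (\<integral>\<^sup>+a. ennreal ((1 / pi) ^ card I) * (ennreal (exp (- q a)) * indicator A a) \<partial>?L)"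
    unfolding g by (simp add: ennreal_mult mult.assoc)
  also have "\<dots> = ennreal ((1 / pi) ^ card I) * (\<integral>\<^sup>+a. ennreal (exp (- q a)) * indicator A a \<partial>?L)"
    by (rule nn_integral_cmult) measurable
  also have "(\<integral>\<^sup>+a. ennreal (exp (- q a)) * indicator A a \<partial>?L)
      = (\<integral>\<^sup>+a. (\<integral>\<^sup>+s. ennreal (exp (- s)) * indicator {q a..} s * indicator A a \<partial>lborel) \<partial>?L)"
    by (subst nn_integral_multc) (auto simp: nn_integral_exp_atLeast[OF q0])
  also have "\<dots> = (\<integral>\<^sup>+a. (\<integral>\<^sup>+s. ennreal (exp (- s)) * (if q a \<le> s \<and> a \<in> A then 1 else 0) \<partial>lborel) \<partial>?L)"
    by (intro nn_integral_cong) (auto simp: indicator_def)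
  also have "\<dots> = (\<integral>\<^sup>+s. (\<integral>\<^sup>+a. ennreal (exp (- s)) * (if q a \<le> s \<and> a \<in> A then 1 else 0) \<partial>?L) \<partial>lborel)"
    by (rule P.Fubini'[symmetric]) measurable
  also have "\<dots> = (\<integral>\<^sup>+s. ennreal (exp (- s)) * emeasure ?L {a \<in> space ?L. a \<in> A \<and> q a \<le> s} \<partial>lborel)"
  proof (rule nn_integral_cong)
    fix s :: real
    have "(\<integral>\<^sup>+a. ennreal (exp (- s)) * (if q a \<le> s \<and> a \<in> A then 1 else 0) \<partial>?L)
        = (\<integral>\<^sup>+a. ennreal (exp (- s)) * indicator {a \<in> space ?L. a \<in> A \<and> q a \<le> s} a \<partial>?L)"
      by (intro nn_integral_cong) (auto simp: indicator_def)
    also have "\<dots> = ennreal (exp (- s)) * emeasure ?L {a \<in> space ?L. a \<in> A \<and> q a \<le> s}"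
      by (rule nn_integral_cmult_indicator) measurable
    finally show "(\<integral>\<^sup>+a. ennreal (exp (- s)) * (if q a \<le> s \<and> a \<in> A then 1 else 0) \<partial>?L)
        = ennreal (exp (- s)) * emeasure ?L {a \<in> space ?L. a \<in> A \<and> q a \<le> s}" .
  qed
  also have "\<dots> = (\<integral>\<^sup>+s. (ennreal (exp (- s) * s ^ card I) * indicator {0<..} s) * emeasure ?L (A \<inter> unit_ball I) \<partial>lborel)"
  \<comment> \<open>At \<open>s = 0\<close> the slice can contain the origin while the right-hand
    side is 0, so equality is claimed only almost everywhere.\<close>
  proof (rule nn_integral_cong_AE)
    have "AE s in lborel. s \<noteq> (0::real)" by (rule AE_lborel_singleton)
    then show "AE s in lborel. ennreal (exp (- s)) * emeasure ?L {a \<in> space ?L. a \<in> A \<and> q a \<le> s}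
        = (ennreal (exp (- s) * s ^ card I) * indicator {0<..} s) * emeasure ?L (A \<inter> unit_ball I)"
    proof eventually_elim
      case (elim s)
      show ?case
      proof (cases "0 < s")
        case True
        then show ?thesis by (simp add: slice ennreal_mult mult.assoc)
      next
        case False
        then have "{a \<in> space ?L. a \<in> A \<and> q a \<le> s} = {}"
          using elim q0 by (auto intro: order_trans) (metis antisym linorder_not_less order_trans)
        then have "emeasure ?L {a \<in> space ?L. a \<in> A \<and> q a \<le> s} = 0" by (simp only: emeasure_empty)
        then show ?thesis using False by simp
      qed
    qed
  qed
  also have "\<dots> = (\<integral>\<^sup>+s. ennreal (exp (- s) * s ^ card I) * indicator {0<..} s \<partial>lborel) * emeasure ?L (A \<inter> unit_ball I)"
    by (rule nn_integral_multc) measurable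
  finally show ?thesis .
qed

text \<open>A cone is its own preimage under radial projection, so its measure on the sphere is the
  fraction of the unit ball it fills. Its Gaussian measure is the same volume times a constant, and
  applying this to the whole space fixes the constant without evaluating the radial
  integral.\<close>

lemma measure_uniform_sphere_cone:
  assumes I: "finite I" and A: "A \<in> sets (\<Pi>\<^sub>M i\<in>I. borel)" "cone I A"
  shows "measure (uniform_sphere I) A = measure (gmeas I) A"
proof -
  let ?L = "\<Pi>\<^sub>M i\<in>I. lborel :: complex measure"
  let ?f = "\<lambda>a::'a \<Rightarrow> complex. \<lambda>i\<in>I. a i / of_real (L2_set (\<lambda>j. norm (a j)) I)"
  have A': "A \<in> sets ?L" using A by (simp cong: sets_PiM_cong)
  have subA: "A \<subseteq> extensional I" using sets.sets_into_space[OF A(1)] by (simp add: space_PiM PiE_def)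
  have "(\<lambda>a. \<lambda>i\<in>I. a i / of_real (sqrt (\<Sum>i\<in>I. (norm (a i))\<^sup>2))) \<in> ?L \<rightarrow>\<^sub>M (\<Pi>\<^sub>M i\<in>I. borel)"
    by measurable
  then have meas: "?f \<in> uniform_measure ?L (unit_ball I) \<rightarrow>\<^sub>M (\<Pi>\<^sub>M i\<in>I. borel)"
    by (simp add: L2_set_def measurable_def)
  have fA: "?f -` A \<inter> space ?L = A"
  proof -
    have "?f a \<in> A \<longleftrightarrow> a \<in> A" if a: "a \<in> extensional I" for a
    proof (cases "L2_set (\<lambda>j. norm (a j)) I = 0")
      \<comment> \<open>Division by zero sends the zero vector to itself, so membership in the cone
        is preserved there as well.\<close>
      case True
      then have "\<forall>i\<in>I. a i = 0" using I by (simp add: L2_set_eq_0_iff)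
      then have "?f a = a" using a by (auto simp: extensional_def fun_eq_iff)
      then show ?thesis by simp
    next
      case False
      then have "0 < inverse (L2_set (\<lambda>j. norm (a j)) I)" by (simp add: less_le L2_set_nonneg)
      moreover have "?f a = (\<lambda>i\<in>I. of_real (inverse (L2_set (\<lambda>j. norm (a j)) I)) * a i)"
        by (simp add: divide_inverse mult.commute of_real_inverse)
      ultimately show ?thesis using A(2) a unfolding cone_def by metis
    qed
    then show ?thesis using subA by (auto simp: space_PiM PiE_def)
  qed
  have UB: "unit_ball I \<in> sets ?L" by (rule sets_unit_ball[OF I])
  have "emeasure (uniform_sphere I) A = emeasure (uniform_measure ?L (unit_ball I)) A"
    unfolding uniform_sphere_def using A(1) fA by (subst emeasure_distr[OF meas]) auto
  also have "\<dots> = emeasure ?L (A \<inter> unit_ball I) / emeasure ?L (unit_ball I)"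
    using A' UB by (simp add: emeasure_uniform_measure Int_commute)
  finally have us: "emeasure (uniform_sphere I) A = emeasure ?L (A \<inter> unit_ball I) / emeasure ?L (unit_ball I)" .
  define J where "J = ennreal ((1 / pi) ^ card I) * (\<integral>\<^sup>+s. ennreal (exp (- s) * s ^ card I) * indicator {0<..} s \<partial>lborel)"
  define b where "b = emeasure ?L (unit_ball I :: ('a \<Rightarrow> complex) set)"
  have b: "b \<noteq> 0" "b \<noteq> \<infinity>" unfolding b_def by (rule emeasure_unit_ball[OF I])+
  have "space ?L \<in> sets ?L" by simp
  moreover have "cone I (space ?L)" by (auto simp: cone_def space_PiM PiE_def extensional_def)
  ultimately have "emeasure (gmeas I) (space ?L) = J * emeasure ?L (space ?L \<inter> unit_ball I)"
    using emeasure_gmeas_cone[OF I] by (simp add: J_def mult.assoc)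
  moreover have "emeasure (gmeas I) (space ?L) = 1"
    using prob_space.emeasure_space_1[OF prob_space_gmeas[OF I]] by (simp add: space_gmeas space_PiM PiE_def)
  moreover have "space ?L \<inter> unit_ball I = unit_ball I"
    using sets.sets_into_space[OF UB] by blast
  ultimately have Jb: "J * b = 1" by (simp add: b_def)
  then have J: "J \<noteq> 0" "J \<noteq> \<infinity>" using b by (auto simp: ennreal_top_mult)
  have "emeasure (gmeas I) A = J * emeasure ?L (A \<inter> unit_ball I)"
    using emeasure_gmeas_cone[OF I A' A(2)] by (simp add: J_def mult.assoc)
  also have "\<dots> = emeasure ?L (A \<inter> unit_ball I) / b"
  proof -
    have "b / b = 1" using b by (simp add: ennreal_divide_self top.not_eq_extremum)
    then have "J = J * (b / b)" by simp
    also have "\<dots> = 1 / b" by (simp only: ennreal_times_divide Jb)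
    finally have "J = 1 / b" .
    then show ?thesis by (subst mult.commute) (simp add: ennreal_times_divide)
  qed
  finally show ?thesis using us by (simp add: measure_def b_def)
qed

section \<open>The curvature event\<close>

text \<open>A nonnegative continuous function on a compact set has a zero iff its infimum is 0, and
  that infimum can be taken over a countable dense subset.\<close>

lemma sets_ex_compact_zero:
  fixes \<phi> :: "'a \<Rightarrow> 'b::euclidean_space \<Rightarrow> real"
  assumes K: "compact K" and meas: "\<And>v. v \<in> K \<Longrightarrow> (\<lambda>a. \<phi> a v) \<in> borel_measurable M"
    and cont: "\<And>a. continuous_on K (\<phi> a)" and nn: "\<And>a v. 0 \<le> \<phi> a v"
  shows "{a \<in> space M. \<exists>v\<in>K. \<phi> a v = 0} \<in> sets M"
proof -
  obtain D where D: "countable D" "D \<subseteq> K" "K \<subseteq> closure D" using separable by blast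
  have eq: "(\<exists>v\<in>K. \<phi> a v = 0) \<longleftrightarrow> (\<forall>n. \<exists>v\<in>D. \<phi> a v < 1 / real (Suc n))" for a
  proof
    assume "\<exists>v\<in>K. \<phi> a v = 0"
    then obtain v where v: "v \<in> K" "\<phi> a v = 0" by blast
    show "\<forall>n. \<exists>v\<in>D. \<phi> a v < 1 / real (Suc n)"
    proof
      fix n
      obtain \<delta> where \<delta>: "\<delta> > 0" "\<And>w. w \<in> K \<Longrightarrow> dist w v < \<delta> \<Longrightarrow> dist (\<phi> a w) (\<phi> a v) < 1 / real (Suc n)"
        using cont[of a] v(1) unfolding continuous_on_iff by (metis of_nat_0_less_iff zero_less_Suc zero_less_divide_1_iff)
      obtain w where "w \<in> D" "dist w v < \<delta>"
        using D(3) v(1) \<delta>(1) closure_approachable by blast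
      then show "\<exists>v\<in>D. \<phi> a v < 1 / real (Suc n)"
        using \<delta>(2)[of w] D(2) v(2) by (intro bexI[of _ w]) (auto simp: dist_real_def)
    qed
  next
    assume A: "\<forall>n. \<exists>v\<in>D. \<phi> a v < 1 / real (Suc n)"
    then have "K \<noteq> {}" using D(2) by blast
    then obtain v where v: "v \<in> K" "\<And>w. w \<in> K \<Longrightarrow> \<phi> a v \<le> \<phi> a w"
      using continuous_attains_inf[OF K _ cont] by blast
    have "\<phi> a v \<le> 0"
    proof (rule ccontr)
      assume "\<not> \<phi> a v \<le> 0"
      then obtain n where "1 / real (Suc n) < \<phi> a v" using nat_approx_posE[of "\<phi> a v"] by auto
      moreover obtain w where "w \<in> D" "\<phi> a w < 1 / real (Suc n)" using A by blast
      ultimately show False using v(2)[of w] D(2) by auto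
    qed
    then show "\<exists>v\<in>K. \<phi> a v = 0" using v(1) nn[of a v] by (intro bexI[of _ v]) auto
  qed
  have [measurable]: "(\<lambda>a. \<phi> a v) \<in> borel_measurable M" if "v \<in> D" for v
    using meas D(2) that by blast
  have "{a \<in> space M. \<forall>n. \<exists>v\<in>D. \<phi> a v < 1 / real (Suc n)} \<in> sets M"
    by (rule sets.sets_Collect_countable_All, rule sets.sets_Collect_countable_Ex'[OF _ D(1)]) measurable
  then show ?thesis by (simp only: eq)
qed

text \<open>The curvature bound on unit representatives, with denominators cleared so that both
  sides are polynomial in the coefficients and their conjugates.\<close>

definition good_coeffs :: "nat \<Rightarrow> real \<Rightarrow> (nat \<times> nat \<times> nat \<Rightarrow> complex) set" where
  "good_coeffs d C = {a \<in> extensional (exponents d). \<forall>v. norm v = 1 \<and> hpoly d a v = 0 \<longrightarrow>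
     grad d a v \<noteq> 0 \<and> (norm (curv_term d a v))\<^sup>2 \<le> C * norm (grad d a v) ^ 6}"

lemma continuous_on_mon: "continuous_on S (mon \<alpha>)"
  using has_derivative_continuous[OF has_derivative_mon] by (simp add: continuous_at_imp_continuous_on)

lemma continuous_on_dmon [continuous_intros]:
  fixes f :: "'a::topological_space \<Rightarrow> complex^3"
  assumes "\<And>i. continuous_on S (\<lambda>v. f v $ i)" "continuous_on S g"
  shows "continuous_on S (\<lambda>v. dmon \<alpha> (g v) (f v))"
proof -
  obtain i j k where \<alpha>: "\<alpha> = (i, j, k)" by (cases \<alpha>)
  show ?thesis unfolding \<alpha> dmon_def prod.case
    by (intro continuous_intros assms continuous_on_compose2[OF continuous_on_mon assms(2) subset_UNIV])
qed

lemma continuous_on_d2mon [continuous_intros]: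
  fixes f h :: "'a::topological_space \<Rightarrow> complex^3"
  assumes "\<And>i. continuous_on S (\<lambda>v. f v $ i)" "\<And>i. continuous_on S (\<lambda>v. h v $ i)" "continuous_on S g"
  shows "continuous_on S (\<lambda>v. d2mon \<alpha> (g v) (f v) (h v))"
proof -
  obtain i j k where \<alpha>: "\<alpha> = (i, j, k)" by (cases \<alpha>)
  show ?thesis unfolding \<alpha> d2mon_def prod.case
    by (intro continuous_intros assms)
qed

lemma continuous_on_grad_nth: "continuous_on S (\<lambda>v. grad d a v $ m)"
  unfolding grad_def dhpoly_def by (simp, intro continuous_intros)

lemma continuous_on_ccross_nth:
  fixes f g :: "'a::topological_space \<Rightarrow> complex^3"
  assumes "\<And>i. continuous_on S (\<lambda>v. f v $ i)" "\<And>i. continuous_on S (\<lambda>v. g v $ i)"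
  shows "continuous_on S (\<lambda>v. ccross (f v) (g v) $ m)"
  using exhaust_3[of m]
  by (elim disjE; simp only: ccross_def vector_3; intro continuous_on_diff continuous_on_mult assms)

lemma continuous_on_curv_term: "continuous_on S (curv_term d a)"
  unfolding curv_term_def[abs_def] d2hpoly_def vcnj_def
  by (intro continuous_on_sum continuous_on_mult continuous_on_const continuous_on_d2mon continuous_on_ccross_nth
      continuous_on_grad_nth continuous_on_id) (simp_all add: continuous_intros)

lemma norm_vec_3: "norm (v::complex^3) = sqrt ((norm (v $ 1))\<^sup>2 + (norm (v $ 2))\<^sup>2 + (norm (v $ 3))\<^sup>2)"
  by (simp add: norm_vec_def L2_set_def sum_3)

lemma continuous_on_norm_grad: "continuous_on S (\<lambda>v. norm (grad d a v))"
  unfolding norm_vec_3 by (intro continuous_intros continuous_on_grad_nth)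

lemma measurable_hpoly: "(\<lambda>a. hpoly d a v) \<in> borel_measurable (\<Pi>\<^sub>M i\<in>exponents d. borel)"
  unfolding hpoly_eq by measurable

lemma measurable_grad_nth: "(\<lambda>a. grad d a v $ m) \<in> borel_measurable (\<Pi>\<^sub>M i\<in>exponents d. borel)"
  unfolding grad_def dhpoly_def by (simp, measurable)

lemma measurable_norm_grad: "(\<lambda>a. norm (grad d a v)) \<in> borel_measurable (\<Pi>\<^sub>M i\<in>exponents d. borel)"
  unfolding norm_vec_3 using measurable_grad_nth[of d v] by measurable

lemma measurable_curv_term: "(\<lambda>a. curv_term d a v) \<in> borel_measurable (\<Pi>\<^sub>M i\<in>exponents d. borel)"
proof -
  let ?M = "\<Pi>\<^sub>M i\<in>exponents d. borel :: complex measure"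
  note [measurable] = measurable_grad_nth[of d v]
  have W: "(\<lambda>a. ccross (vcnj v) (grad d a v) $ m) \<in> borel_measurable ?M" for m
    using exhaust_3[of m] unfolding ccross_def by (auto simp: vector_3)
  note [measurable] = W[of 1] W[of 2] W[of 3]
  have "(\<lambda>a. d2mon \<alpha> v (ccross (vcnj v) (grad d a v)) (ccross (vcnj v) (grad d a v))) \<in> borel_measurable ?M" for \<alpha>
  proof -
    obtain i j k where \<alpha>: "\<alpha> = (i, j, k)" by (cases \<alpha>)
    show ?thesis unfolding \<alpha> d2mon_def dmon_def prod.case by measurable
  qed
  then show ?thesis unfolding curv_term_def d2hpoly_def by measurable
qed

lemma sets_good_coeffs: "good_coeffs d C \<in> sets (\<Pi>\<^sub>M i\<in>exponents d. borel)"
proof -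
  let ?M = "\<Pi>\<^sub>M i\<in>exponents d. borel :: complex measure" and ?S = "sphere 0 1 :: (complex^3) set"
  note m = measurable_hpoly[measurable] measurable_norm_grad[measurable] measurable_curv_term[measurable]
  define \<phi> where "\<phi> a v = norm (hpoly d a v) + norm (grad d a v)" for a v
  \<comment> \<open>Violating the bound is a strict inequality and thus not a closed condition. For
    fixed \<open>n\<close>, a zero of \<open>\<psi> n a\<close> is a point of the curve where the
    bound fails by at least \<open>1 / real (Suc n)\<close>; the union over \<open>n\<close> gives
    all violations.\<close>
  define \<psi> where "\<psi> n a v = norm (hpoly d a v) + max 0 (1 / real (Suc n)
     - ((norm (curv_term d a v))\<^sup>2 - C * norm (grad d a v) ^ 6))" for n a v
  have B1: "{a \<in> space ?M. \<exists>v\<in>?S. \<phi> a v = 0} \<in> sets ?M" (is "?B1 \<in> _")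
  proof (rule sets_ex_compact_zero[OF compact_sphere])
    show "(\<lambda>a. \<phi> a v) \<in> borel_measurable ?M" for v unfolding \<phi>_def by measurable
    show "continuous_on ?S (\<phi> a)" for a
      unfolding \<phi>_def[abs_def] by (intro continuous_intros continuous_on_hpoly continuous_on_norm_grad)
  qed (simp add: \<phi>_def)
  have B2: "{a \<in> space ?M. \<exists>v\<in>?S. \<psi> n a v = 0} \<in> sets ?M" (is "?B2 n \<in> _") for n
  proof (rule sets_ex_compact_zero[OF compact_sphere])
    show "(\<lambda>a. \<psi> n a v) \<in> borel_measurable ?M" for v unfolding \<psi>_def by measurable
    show "continuous_on ?S (\<psi> n a)" for a
      unfolding \<psi>_def[abs_def] by (intro continuous_intros continuous_on_hpoly continuous_on_norm_grad continuous_on_curv_term)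
  qed (simp add: \<psi>_def)
  have "good_coeffs d C = space ?M - ?B1 - (\<Union>n. ?B2 n)"
  proof -
    have 1: "\<phi> a v = 0 \<longleftrightarrow> hpoly d a v = 0 \<and> grad d a v = 0" for a v
      by (simp add: \<phi>_def add_nonneg_eq_0_iff)
    have 2: "(\<exists>n. \<psi> n a v = 0) \<longleftrightarrow> hpoly d a v = 0 \<and> \<not> (norm (curv_term d a v))\<^sup>2 \<le> C * norm (grad d a v) ^ 6" for a v
    proof -
      have "\<psi> n a v = 0 \<longleftrightarrow> hpoly d a v = 0 \<and> 1 / real (Suc n) \<le> (norm (curv_term d a v))\<^sup>2 - C * norm (grad d a v) ^ 6" for n
        unfolding \<psi>_def by (subst add_nonneg_eq_0_iff) (auto simp: max_def)
      moreover have "(\<exists>n. 1 / real (Suc n) \<le> x) \<longleftrightarrow> \<not> x \<le> 0" for x :: real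
      proof
        assume "\<exists>n. 1 / real (Suc n) \<le> x"
        then obtain n where "1 / real (Suc n) \<le> x" ..
        moreover have "0 < 1 / real (Suc n)" by simp
        ultimately show "\<not> x \<le> 0" by linarith
      next
        assume "\<not> x \<le> 0"
        then have "0 < x" by simp
        then obtain n where "1 / real (Suc n) < x" by (rule nat_approx_posE)
        then have "1 / real (Suc n) \<le> x" by simp
        then show "\<exists>n. 1 / real (Suc n) \<le> x" by (rule exI)
      qed
      ultimately show ?thesis by auto
    qed
    have e: "a \<in> good_coeffs d C \<longleftrightarrow> a \<in> space ?M \<and> \<not> (\<exists>v\<in>?S. \<phi> a v = 0) \<and> \<not> (\<exists>v\<in>?S. \<exists>n. \<psi> n a v = 0)" for a
      unfolding good_coeffs_def 1 2 by (auto simp: space_PiM PiE_def)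
    show ?thesis by (rule set_eqI) (unfold e, auto)
  qed
  then show ?thesis using B1 B2 by auto
qed

lemma space_mu: "space (mu d) = extensional (exponents d)"
  by (simp add: mu_def uniform_sphere_def space_PiM PiE_def)

text \<open>For \<open>2 \<le> d\<close> the upper bound 4 pi of the curvature is below 32 and hence
  below \<open>d ^ 5\<close>. Only the lower bound - \<open>d ^ 5\<close> is a restriction, and
  solving it for the subtracted term gives the constant on the right.\<close>

lemma curvature_event_eq:
  assumes d: "2 \<le> d"
  shows "{a \<in> space (mu d). smooth_curve (hpoly d a) \<and>
      (SUP x\<in>zero_locus (hpoly d a). ereal \<bar>gauss_curvature (zero_locus (hpoly d a)) x\<bar>) \<le> ereal (real d ^ 5)}
    = good_coeffs d ((real d ^ 5 + 4 * pi) / (2 * pi))"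
proof -
  let ?C = "(real d ^ 5 + 4 * pi) / (2 * pi)"
  have d5: "4 * pi \<le> real d ^ 5"
  proof -
    have "(2::real) ^ 5 \<le> real d ^ 5" using d by (intro power_mono) auto
    then show ?thesis using pi_less_4 by simp
  qed
  have iff: "\<bar>curvature_formula d a v\<bar> \<le> real d ^ 5 \<longleftrightarrow> (norm (curv_term d a v))\<^sup>2 \<le> ?C * norm (grad d a v) ^ 6"
    if v: "norm v = 1" "grad d a v \<noteq> 0" for a v
  proof -
    define X where "X = (norm (curv_term d a v))\<^sup>2 / norm (grad d a v) ^ 6"
    have X: "0 \<le> X" by (simp add: X_def)
    have "curvature_formula d a v = 4 * pi - 2 * pi * X"
      using v by (simp add: curvature_formula_def X_def)
    then have "\<bar>curvature_formula d a v\<bar> \<le> real d ^ 5 \<longleftrightarrow> X \<le> ?C"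
    proof -
      have aux: "0 \<le> y \<Longrightarrow> p \<le> r \<Longrightarrow> \<bar>p - y\<bar> \<le> r \<longleftrightarrow> y \<le> r + p" for y p r :: real
        by (auto simp: abs_le_iff)
      have "0 \<le> 2 * pi * X" using X by simp
      then have "\<bar>4 * pi - 2 * pi * X\<bar> \<le> real d ^ 5 \<longleftrightarrow> X * (2 * pi) \<le> real d ^ 5 + 4 * pi"
        using aux[of "2 * pi * X", OF _ d5] by (simp only: mult.commute[of X])
      also have "\<dots> \<longleftrightarrow> X \<le> ?C" by (rule pos_le_divide_eq[symmetric]) simp
      finally show ?thesis using \<open>curvature_formula d a v = 4 * pi - 2 * pi * X\<close> by simp
    qed
    also have "\<dots> \<longleftrightarrow> (norm (curv_term d a v))\<^sup>2 \<le> ?C * norm (grad d a v) ^ 6"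
      using v(2) unfolding X_def by (subst pos_divide_le_eq) auto
    finally show ?thesis .
  qed
  have unit: "\<exists>c u. c \<noteq> 0 \<and> norm u = 1 \<and> v = c *s u" if "v \<noteq> 0" for v :: "complex^3"
  proof (intro exI conjI)
    show "of_real (norm v) \<noteq> (0::complex)" using that by simp
    show "norm (of_real (inverse (norm v)) *s v) = 1" using that by (simp add: norm_scale_vec norm_inverse)
    show "v = of_real (norm v) *s (of_real (inverse (norm v)) *s v)"
      using that by (simp add: vec_eq_iff)
  qed
  have "smooth_curve (hpoly d a) \<and>
      (SUP x\<in>zero_locus (hpoly d a). ereal \<bar>gauss_curvature (zero_locus (hpoly d a)) x\<bar>) \<le> ereal (real d ^ 5)
    \<longleftrightarrow> (\<forall>v. norm v = 1 \<and> hpoly d a v = 0 \<longrightarrow>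
     grad d a v \<noteq> 0 \<and> (norm (curv_term d a v))\<^sup>2 \<le> ?C * norm (grad d a v) ^ 6)" (is "?S \<and> ?sup \<longleftrightarrow> ?R") for a
  proof
    assume A: "?S \<and> ?sup"
    show ?R
    proof (intro allI impI)
      fix v :: "complex^3" assume v: "norm v = 1 \<and> hpoly d a v = 0"
      then have v0: "v \<noteq> 0" by auto
      then have g: "grad d a v \<noteq> 0" using A v by (auto simp: smooth_curve_hpoly_iff)
      have "proj v \<in> zero_locus (hpoly d a)" using mem_zero_locus_iff[OF v0] v by simp
      then have "\<bar>gauss_curvature (zero_locus (hpoly d a)) (proj v)\<bar> \<le> real d ^ 5"
        using A by (auto simp: SUP_le_iff)
      then show "grad d a v \<noteq> 0 \<and> (norm (curv_term d a v))\<^sup>2 \<le> ?C * norm (grad d a v) ^ 6"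
        using gauss_curvature_eq[OF _ d v0] A v iff[OF _ g] g by auto
    qed
  next
    assume R: ?R
    have S: ?S unfolding smooth_curve_hpoly_iff
    proof (intro allI impI)
      fix v :: "complex^3" assume v: "v \<noteq> 0 \<and> hpoly d a v = 0"
      then obtain c u where u: "c \<noteq> 0" "norm u = 1" "v = c *s u" using unit by blast
      then have "hpoly d a u = 0" using v by (simp add: hpoly_scale)
      then have "grad d a u \<noteq> 0" using R u by blast
      then show "grad d a v \<noteq> 0" using u by (simp add: grad_scale)
    qed
    have ?sup unfolding SUP_le_iff
    proof
      fix x assume "x \<in> zero_locus (hpoly d a)"
      then obtain v where v: "v \<noteq> 0" "hpoly d a v = 0" "x = proj v" by (auto simp: zero_locus_def)
      then obtain c u where u: "c \<noteq> 0" "norm u = 1" "v = c *s u" using unit by blast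
      then have "hpoly d a u = 0" using v by (simp add: hpoly_scale)
      then have "\<bar>curvature_formula d a u\<bar> \<le> real d ^ 5" using R u iff by blast
      then show "ereal \<bar>gauss_curvature (zero_locus (hpoly d a)) x\<bar> \<le> ereal (real d ^ 5)"
        using gauss_curvature_eq[OF S d v(1,2)] v(3) u curvature_formula_scale[OF u(1) d, of a u] by simp
    qed
    with S show "?S \<and> ?sup" by blast
  qed
  then show ?thesis by (simp only: good_coeffs_def space_mu)
qed

text \<open>\<open>curv_term\<close> is cubic in the coefficients up to conjugation, one Hessian and
  two gradients, so its square has the degree 6 of the right-hand side.\<close>

lemma cone_good_coeffs: "cone (exponents d) (good_coeffs d C)"
  unfolding cone_def
proof (intro ballI allI impI)
  fix a :: "nat \<times> nat \<times> nat \<Rightarrow> complex" and c :: real assume a: "a \<in> extensional (exponents d)" and c: "0 < c"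
  define b where "b = (\<lambda>i\<in>exponents d. of_real c * a i)"
  have P: "hpoly d b v = of_real c * hpoly d a v" for v
    unfolding hpoly_eq sum_distrib_left by (intro sum.cong) (auto simp: b_def)
  have "dhpoly d b v w = of_real c * dhpoly d a v w" for v w
    unfolding dhpoly_def sum_distrib_left by (intro sum.cong) (auto simp: b_def)
  then have G: "grad d b v = of_real c *s grad d a v" for v
    by (simp add: grad_def vec_eq_iff)
  have D2: "d2hpoly d b v w u = of_real c * d2hpoly d a v w u" for v w u
    unfolding d2hpoly_def sum_distrib_left by (intro sum.cong) (auto simp: b_def)
  have T: "curv_term d b v = of_real c ^ 3 * curv_term d a v" for v
    unfolding curv_term_def D2 G ccross_scale d2hpoly_linear by (simp add: power3_eq_cube)
  have "(norm (curv_term d b v))\<^sup>2 = c ^ 6 * (norm (curv_term d a v))\<^sup>2" for v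
    using c by (simp add: T norm_mult norm_power power_mult_distrib)
  moreover have "norm (grad d b v) ^ 6 = c ^ 6 * norm (grad d a v) ^ 6" for v
    using c by (simp add: G norm_scale_vec power_mult_distrib)
  ultimately have "(norm (curv_term d b v))\<^sup>2 \<le> C * norm (grad d b v) ^ 6 \<longleftrightarrow>
     (norm (curv_term d a v))\<^sup>2 \<le> C * norm (grad d a v) ^ 6" for v
    using c by (simp add: mult.left_commute)
  moreover have "b \<in> extensional (exponents d)" by (simp add: b_def)
  ultimately have "b \<in> good_coeffs d C \<longleftrightarrow> a \<in> good_coeffs d C"
    using a c unfolding good_coeffs_def by (simp add: P G)
  then show "((\<lambda>i\<in>exponents d. of_real c * a i) \<in> good_coeffs d C) = (a \<in> good_coeffs d C)"
    by (simp add: b_def)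
qed

lemma measure_curvature_event:
  assumes d: "2 \<le> d"
  shows "measure (mu d) {a \<in> space (mu d). smooth_curve (hpoly d a) \<and>
      (SUP x\<in>zero_locus (hpoly d a). ereal \<bar>gauss_curvature (zero_locus (hpoly d a)) x\<bar>) \<le> ereal (real d ^ 5)}
    = measure (gmeas (exponents d)) (good_coeffs d ((real d ^ 5 + 4 * pi) / (2 * pi)))"
  unfolding curvature_event_eq[OF d] unfolding mu_def
  by (rule measure_uniform_sphere_cone[OF finite_exponents sets_good_coeffs cone_good_coeffs])

section \<open>The covariance kernel\<close>

definition Ndim :: "nat \<Rightarrow> real" where
  "Ndim d = real (d + 2) * real (d + 1) / 2"

lemma trinomial:
  fixes x y z :: complex
  shows "(x + y + z) ^ d = (\<Sum>(i, j, k)\<in>exponents d. fact d / (fact i * fact j * fact k) * x ^ i * y ^ j * z ^ k)"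
proof -
  let ?f = "\<lambda>i j. fact d / (fact i * fact j * fact (d - i - j)) * x ^ i * y ^ j * z ^ (d - i - j)"
  have "(x + y + z) ^ d = (x + (y + z)) ^ d" by (simp add: add.assoc)
  also have "\<dots> = (\<Sum>i\<le>d. of_nat (d choose i) * x ^ i * (y + z) ^ (d - i))"
    by (rule binomial_ring)
  also have "\<dots> = (\<Sum>i\<le>d. \<Sum>j\<le>d - i. ?f i j)"
  proof (intro sum.cong refl)
    fix i assume i: "i \<in> {..d}"
    have "of_nat (d choose i) * x ^ i * (y + z) ^ (d - i)
       = (\<Sum>j\<le>d - i. of_nat (d choose i) * x ^ i * (of_nat (d - i choose j) * y ^ j * z ^ (d - i - j)))"
      by (subst binomial_ring) (simp add: sum_distrib_left)
    also have "\<dots> = (\<Sum>j\<le>d - i. ?f i j)"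
      using i by (intro sum.cong refl) (simp add: binomial_fact mult.assoc)
    finally show "of_nat (d choose i) * x ^ i * (y + z) ^ (d - i) = (\<Sum>j\<le>d - i. ?f i j)" .
  qed
  also have "\<dots> = (\<Sum>(i, j)\<in>(SIGMA i:{..d}. {..d - i}). ?f i j)"
    by (rule sum.Sigma) auto
  also have "\<dots> = (\<Sum>(i, j, k)\<in>exponents d. fact d / (fact i * fact j * fact k) * x ^ i * y ^ j * z ^ k)"
    by (rule sum.reindex_bij_witness[where i = "\<lambda>(i, j, k). (i, j)" and j = "\<lambda>(i, j). (i, j, d - i - j)"])
      (auto simp: exponents_def)
  finally show ?thesis .
qed

text \<open>The normalization of the random polynomial is chosen for this: the squared weights are
  trinomial coefficients times the number of coefficients, so the kernel is a power of the Hermitian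
  product.\<close>

lemma weight_square:
  assumes "(i, j, k) \<in> exponents d"
  shows "(weight d (i, j, k))\<^sup>2 = Ndim d * (fact d / (fact i * fact j * fact k))"
  by (simp add: weight_def Ndim_def field_simps)

text \<open>The covariance kernel of the random polynomial. Its derivatives show that the value and the
  two tangential derivatives at a unit vector are orthogonal linear forms in the coefficients.\<close>

lemma kernel_0:
  "(\<Sum>\<alpha>\<in>exponents d. of_real ((weight d \<alpha>)\<^sup>2) * mon \<alpha> v * cnj (mon \<alpha> w)) = of_real (Ndim d) * herm v w ^ d"
proof -
  have "herm v w ^ d = (\<Sum>(i, j, k)\<in>exponents d. fact d / (fact i * fact j * fact k) *
     (v $ 1 * cnj (w $ 1)) ^ i * (v $ 2 * cnj (w $ 2)) ^ j * (v $ 3 * cnj (w $ 3)) ^ k)"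
    unfolding herm_def sum_3 by (rule trinomial)
  then show ?thesis
    unfolding sum_distrib_left
  proof (simp only: sum_distrib_left, intro sum.cong refl, clarify)
    fix i j k assume "(i, j, k) \<in> exponents d"
    then show "complex_of_real ((weight d (i, j, k))\<^sup>2) * mon (i, j, k) v * cnj (mon (i, j, k) w)
      = of_real (Ndim d) * (fact d / (fact i * fact j * fact k) *
        (v $ 1 * cnj (w $ 1)) ^ i * (v $ 2 * cnj (w $ 2)) ^ j * (v $ 3 * cnj (w $ 3)) ^ k)"
      by (subst weight_square) (simp_all add: mon_def power_mult_distrib mult_ac)
  qed
qed

lemma bounded_linear_herm_left: "bounded_linear (\<lambda>v. herm v w)"
  by (rule bounded_bilinear.bounded_linear_left[OF bounded_bilinear_herm])

lemma has_derivative_herm_power: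
  "((\<lambda>v. herm v w ^ n) has_derivative (\<lambda>t. of_nat n * herm v w ^ (n - 1) * herm t w)) (at v)"
proof -
  have "((\<lambda>v. herm v w) has_derivative (\<lambda>t. herm t w)) (at v)"
    by (rule bounded_linear_imp_has_derivative[OF bounded_linear_herm_left])
  from has_derivative_power[OF this, of n] show ?thesis
    by (rule has_derivative_eq_rhs) (simp add: fun_eq_iff mult_ac)
qed

text \<open>Both sides of \<open>kernel_0\<close> are differentiated in the first argument; the
  second one stays fixed.\<close>

lemma kernel_1:
  "(\<Sum>\<alpha>\<in>exponents d. of_real ((weight d \<alpha>)\<^sup>2) * dmon \<alpha> v t * cnj (mon \<alpha> w))
    = of_real (Ndim d) * (of_nat d * herm v w ^ (d - 1) * herm t w)"
proof -
  have "((\<lambda>v. \<Sum>\<alpha>\<in>exponents d. of_real ((weight d \<alpha>)\<^sup>2) * mon \<alpha> v * cnj (mon \<alpha> w)) has_derivative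
    (\<lambda>t. \<Sum>\<alpha>\<in>exponents d. of_real ((weight d \<alpha>)\<^sup>2) * dmon \<alpha> v t * cnj (mon \<alpha> w))) (at v)"
    by (intro has_derivative_sum has_derivative_mult_left has_derivative_mult_right has_derivative_mon)
  moreover have "((\<lambda>v. of_real (Ndim d) * herm v w ^ d) has_derivative
    (\<lambda>t. of_real (Ndim d) * (of_nat d * herm v w ^ (d - 1) * herm t w))) (at v)"
    by (intro has_derivative_mult_right has_derivative_herm_power)
  ultimately have "(\<lambda>t. \<Sum>\<alpha>\<in>exponents d. of_real ((weight d \<alpha>)\<^sup>2) * dmon \<alpha> v t * cnj (mon \<alpha> w))
    = (\<lambda>t. of_real (Ndim d) * (of_nat d * herm v w ^ (d - 1) * herm t w))"
    unfolding kernel_0 by (rule has_derivative_unique)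
  from fun_cong[OF this, of t] show ?thesis .
qed

text \<open>Conjugating \<open>kernel_1\<close> exchanges the arguments, which makes the other one
  accessible to the same differentiation.\<close>

lemma kernel_2:
  "(\<Sum>\<alpha>\<in>exponents d. of_real ((weight d \<alpha>)\<^sup>2) * dmon \<alpha> w u * cnj (dmon \<alpha> v t))
    = of_real (Ndim d) * of_nat d *
      (herm w v ^ (d - 1) * herm u t + of_nat (d - 1) * herm w v ^ (d - 1 - 1) * herm u v * herm w t)"
proof -
  have k: "(\<Sum>\<alpha>\<in>exponents d. of_real ((weight d \<alpha>)\<^sup>2) * mon \<alpha> w * cnj (dmon \<alpha> v t))
    = of_real (Ndim d) * of_nat d * (herm w v ^ (d - 1) * herm w t)" for w
    using arg_cong[OF kernel_1[of d v t w], of cnj] by (simp add: herm_commute mult_ac)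
  have "((\<lambda>w. \<Sum>\<alpha>\<in>exponents d. of_real ((weight d \<alpha>)\<^sup>2) * mon \<alpha> w * cnj (dmon \<alpha> v t)) has_derivative
    (\<lambda>u. \<Sum>\<alpha>\<in>exponents d. of_real ((weight d \<alpha>)\<^sup>2) * dmon \<alpha> w u * cnj (dmon \<alpha> v t))) (at w)"
    by (intro has_derivative_sum has_derivative_mult_left has_derivative_mult_right has_derivative_mon)
  moreover have "((\<lambda>w. of_real (Ndim d) * of_nat d * (herm w v ^ (d - 1) * herm w t)) has_derivative
    (\<lambda>u. of_real (Ndim d) * of_nat d * (herm w v ^ (d - 1) * herm u t +
      (of_nat (d - 1) * herm w v ^ (d - 1 - 1) * herm u v) * herm w t))) (at w)"
    by (intro has_derivative_mult_right has_derivative_mult has_derivative_herm_power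
        bounded_linear_imp_has_derivative[OF bounded_linear_herm_left])
  ultimately have "(\<lambda>u. \<Sum>\<alpha>\<in>exponents d. of_real ((weight d \<alpha>)\<^sup>2) * dmon \<alpha> w u * cnj (dmon \<alpha> v t))
    = (\<lambda>u. of_real (Ndim d) * of_nat d * (herm w v ^ (d - 1) * herm u t +
      (of_nat (d - 1) * herm w v ^ (d - 1 - 1) * herm u v) * herm w t))"
    unfolding k by (rule has_derivative_unique)
  from fun_cong[OF this, of u] show ?thesis .
qed

section \<open>Cauchy estimates\<close>

lemma cauchy_estimate_line:
  fixes f f' :: "complex \<Rightarrow> complex"
  assumes f: "\<And>s. (f has_field_derivative f' s) (at s)" and r: "0 < r"
    and B: "\<And>s. norm s = r \<Longrightarrow> norm (f s) \<le> B"
  shows "norm (f' 0) \<le> B / r"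
proof -
  have "f holomorphic_on UNIV" using f by (auto simp: holomorphic_on_open)
  then have h: "f holomorphic_on ball 0 r" "continuous_on (cball 0 r) f"
    by (auto intro: holomorphic_on_subset holomorphic_on_imp_continuous_on[THEN continuous_on_subset])
  have "norm ((deriv ^^ 1) f 0) \<le> fact 1 * B / r ^ 1"
    by (rule Cauchy_inequality[OF h r]) (use B in simp)
  then show ?thesis using DERIV_imp_deriv[OF f[of 0]] by simp
qed

lemma dhpoly_cauchy:
  assumes "0 < r" "\<And>s. norm s = r \<Longrightarrow> norm (hpoly d a (y + s *s t)) \<le> B"
  shows "norm (dhpoly d a y t) \<le> B / r"
  using cauchy_estimate_line[of "\<lambda>s. hpoly d a (y + s *s t)" "\<lambda>s. dhpoly d a (y + s *s t) t", OF hpoly_line assms]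
  by simp

lemma d2hpoly_cauchy:
  assumes "0 < r" "\<And>s. norm s = r \<Longrightarrow> norm (dhpoly d a (y + s *s u) t) \<le> B"
  shows "norm (d2hpoly d a y t u) \<le> B / r"
  using cauchy_estimate_line[of "\<lambda>s. dhpoly d a (y + s *s u) t" "\<lambda>s. d2hpoly d a (y + s *s u) t u", OF dhpoly_line assms]
  by simp

lemma norm_add_orthogonal:
  assumes "herm w x = 0"
  shows "(norm (x + w))\<^sup>2 = (norm x)\<^sup>2 + (norm w)\<^sup>2"
proof -
  have "herm x w = 0" using assms herm_commute by (metis complex_cnj_zero)
  then have "complex_of_real ((norm (x + w))\<^sup>2) = of_real ((norm x)\<^sup>2 + (norm w)\<^sup>2)"
    using assms by (simp only: herm_self[symmetric] herm_linear of_real_add) simp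
  then show ?thesis by (simp only: of_real_eq_iff)
qed

text \<open>(1 + 9/d)^d is at most e^9: this close to the unit sphere, homogeneity of degree d costs
  only a constant.\<close>

lemma norm_power_bound:
  assumes d: "0 < d" and y: "(norm (y::complex^3))\<^sup>2 \<le> 1 + 9 / real d" and n: "n \<le> d"
  shows "norm y ^ n \<le> exp (9 / 2)"
proof -
  have "(norm y ^ n)\<^sup>2 = ((norm y)\<^sup>2) ^ n" by (simp add: power_mult[symmetric] mult.commute)
  also have "\<dots> \<le> (1 + 9 / real d) ^ n" using y by (intro power_mono) auto
  also have "\<dots> \<le> (1 + 9 / real d) ^ d" using n by (intro power_increasing) auto
  also have "\<dots> \<le> exp (9 / real d) ^ d" by (intro power_mono exp_ge_add_one_self_aux) auto
  also have "\<dots> = exp 9" using d by (simp add: exp_of_nat_mult[symmetric])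
  also have "\<dots> = (exp (9 / 2))\<^sup>2" by (simp add: power2_eq_square exp_add[symmetric])
  finally show ?thesis by (rule power2_le_imp_le) simp
qed

lemma norm_ccross_square: "(norm (ccross v w))\<^sup>2 = (norm v * norm w)\<^sup>2 - (norm (herm v w))\<^sup>2"
proof -
  have "complex_of_real ((norm (ccross v w))\<^sup>2) = of_real ((norm v)\<^sup>2 * (norm w)\<^sup>2 - (norm (herm v w))\<^sup>2)"
    using lagrange_identity[of v w] unfolding herm_self of_real_diff of_real_mult complex_norm_square[of "herm v w"]
    by (simp add: herm_commute mult.commute)
  then show ?thesis by (simp only: of_real_eq_iff power_mult_distrib)
qed

lemma herm_cauchy_schwarz: "norm (herm v w) \<le> norm v * norm w"
proof (rule power2_le_imp_le)
  show "(norm (herm v w))\<^sup>2 \<le> (norm v * norm w)\<^sup>2"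
    using norm_ccross_square[of v w] zero_le_power2[of "norm (ccross v w)"] by linarith
qed simp

lemma norm_ccross_le: "norm (ccross v w) \<le> norm v * norm w"
proof (rule power2_le_imp_le)
  show "(norm (ccross v w))\<^sup>2 \<le> (norm v * norm w)\<^sup>2"
    using norm_ccross_square[of v w] zero_le_power2[of "norm (herm v w)"] by linarith
qed simp

lemma norm_vcnj: "norm (vcnj v) = norm v"
  by (simp add: vcnj_def norm_vec_def)

lemma norm_bil_le: "norm (bil v w) \<le> norm v * norm w"
proof -
  have "bil v w = herm w (vcnj v)" by (simp add: bil_def herm_def vcnj_def mult.commute)
  then show ?thesis using herm_cauchy_schwarz[of w "vcnj v"] by (simp add: norm_vcnj mult.commute)
qed

section \<open>Estimates from a bound on the unit sphere\<close>

locale bounded_hpoly =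
  fixes d :: nat and a :: "nat \<times> nat \<times> nat \<Rightarrow> complex" and M :: real
  assumes d: "2 \<le> d" and M: "\<And>v. norm v = 1 \<Longrightarrow> norm (hpoly d a v) \<le> M"
begin

lemma M_nonneg: "0 \<le> M"
proof -
  have "norm (axis 1 1 :: complex^3) = 1" by simp
  then show ?thesis using M norm_ge_zero order_trans by blast
qed

lemma hpoly_le: "norm (hpoly d a v) \<le> M * norm v ^ d"
proof (cases "v = 0")
  case True
  then have "hpoly d a v = hpoly d a (0 *s v)" by simp
  also have "\<dots> = 0" using d by (simp only: hpoly_scale) simp
  finally show ?thesis using M_nonneg by simp
next
  case False
  have "norm (of_real (inverse (norm v)) *s v) = 1" using False by (simp add: norm_scale_vec norm_inverse)
  from M[OF this] show ?thesis
    using False by (simp add: hpoly_scale norm_mult norm_power norm_divide norm_inverse power_inverse field_simps)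
qed

lemma hpoly_le_near:
  assumes "(norm v)\<^sup>2 \<le> 1 + 9 / real d"
  shows "norm (hpoly d a v) \<le> M * exp (9 / 2)"
  using order_trans[OF hpoly_le mult_left_mono[OF norm_power_bound[OF _ assms order_refl] M_nonneg]] d by simp

text \<open>By Pythagoras an orthogonal displacement of length 3 / sqrt d raises the squared norm by
  only 9/d. Hence the natural scale of tangential displacements is 1 / sqrt d, while in radial
  directions it would be 1/d.\<close>

lemma near_orthogonal:
  assumes x: "norm x = 1" and w: "herm w x = 0" "norm w \<le> 3 / sqrt (real d)"
  shows "(norm (x + w))\<^sup>2 \<le> 1 + 9 / real d"
proof -
  have "(norm w)\<^sup>2 \<le> (3 / sqrt (real d))\<^sup>2" using w(2) by (intro power_mono) auto
  then show ?thesis using x by (simp add: norm_add_orthogonal[OF w(1)] power_divide)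
qed

text \<open>Cauchy's estimate on a disc that moves the point by 1 / sqrt d in a tangential
  direction. The radii 1, 2, 3 over sqrt d in \<open>d2hpoly_le\<close>, here and in
  \<open>near_orthogonal\<close> leave room for one such disc per derivative.\<close>

lemma dhpoly_le:
  assumes x: "norm x = 1" and w: "herm w x = 0" "norm w \<le> 2 / sqrt (real d)"
    and t: "herm t x = 0"
  shows "norm (dhpoly d a (x + w) t) \<le> norm t * (M * exp (9 / 2) * sqrt (real d))"
proof (cases "t = 0")
  case True
  then show ?thesis by (simp add: dhpoly_zero_arg)
next
  case False
  have "norm (dhpoly d a (x + w) t) \<le> M * exp (9 / 2) / (1 / (norm t * sqrt (real d)))"
  proof (rule dhpoly_cauchy)
    show "0 < 1 / (norm t * sqrt (real d))" using False d by simp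
    fix s :: complex assume s: "norm s = 1 / (norm t * sqrt (real d))"
    have "herm (w + s *s t) x = 0" by (simp add: herm_linear w t)
    moreover have "norm (w + s *s t) \<le> 3 / sqrt (real d)"
      using norm_triangle_ineq[of w "s *s t"] w(2) s False by (simp add: norm_scale_vec field_simps)
    ultimately show "norm (hpoly d a (x + w + s *s t)) \<le> M * exp (9 / 2)"
      using hpoly_le_near[OF near_orthogonal[OF x]] by (simp add: add.assoc)
  qed
  then show ?thesis by (simp add: mult_ac)
qed

lemma d2hpoly_le:
  assumes x: "norm x = 1" and w: "herm w x = 0" "norm w \<le> 1 / sqrt (real d)"
    and t: "herm t x = 0" and u: "herm u x = 0"
  shows "norm (d2hpoly d a (x + w) t u) \<le> norm t * norm u * (M * exp (9 / 2) * real d)"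
proof (cases "u = 0")
  case True
  then have "d2hpoly d a (x + w) t u = 0"
    using d2hpoly_linear(4)[of d a "x + w" t 0 0] by simp
  then show ?thesis using True by simp
next
  case False
  have "norm (d2hpoly d a (x + w) t u) \<le> norm t * (M * exp (9 / 2) * sqrt (real d)) / (1 / (norm u * sqrt (real d)))"
  proof (rule d2hpoly_cauchy)
    show "0 < 1 / (norm u * sqrt (real d))" using False d by simp
    fix s :: complex assume s: "norm s = 1 / (norm u * sqrt (real d))"
    have "herm (w + s *s u) x = 0" by (simp add: herm_linear w u)
    moreover have "norm (w + s *s u) \<le> 2 / sqrt (real d)"
      using norm_triangle_ineq[of w "s *s u"] w(2) s False by (simp add: norm_scale_vec field_simps)
    ultimately show "norm (dhpoly d a (x + w + s *s u) t) \<le> norm t * (M * exp (9 / 2) * sqrt (real d))"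
      using dhpoly_le[OF x _ _ t] by (simp add: add.assoc)
  qed
  also have "\<dots> = norm t * norm u * (M * exp (9 / 2) * (sqrt (real d) * sqrt (real d)))"
    by (simp only: divide_divide_eq_right div_by_1 mult_ac)
  also have "sqrt (real d) * sqrt (real d) = real d" by simp
  finally show ?thesis .
qed

text \<open>The tangent vector in \<open>curv_term\<close> is no longer than the gradient, so the
  squared term is at most |grad|^4 times the squared Hessian bound. Against \<open>C\<close>
  |grad|^6 this cancels the fourth power and bounds |grad|^2.\<close>

lemma grad_small:
  assumes v: "norm v = 1" and C: "0 < C"
    and bad: "grad d a v = 0 \<or> C * norm (grad d a v) ^ 6 < (norm (curv_term d a v))\<^sup>2"
  shows "(norm (grad d a v))\<^sup>2 \<le> (M * exp (9 / 2) * real d)\<^sup>2 / C"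
proof (cases "grad d a v = 0")
  case True
  then show ?thesis using C by simp
next
  case False
  define W where "W = ccross (vcnj v) (grad d a v)"
  define g where "g = norm (grad d a v)"
  define H where "H = M * exp (9 / 2) * real d"
  have g: "0 < g" using False by (simp add: g_def)
  have H: "0 \<le> H" using M_nonneg by (simp add: H_def)
  have W: "herm W v = 0"
    by (simp add: W_def herm_def ccross_def vcnj_def sum_3 vector_3 algebra_simps)
  have nW: "norm W \<le> g"
    using norm_ccross_le[of "vcnj v" "grad d a v"] v by (simp add: W_def g_def norm_vcnj)
  have "norm (curv_term d a v) \<le> norm W * norm W * H"
    using d2hpoly_le[OF v _ _ W W, of 0] by (simp add: curv_term_def W_def[symmetric] H_def herm_def)
  also have "\<dots> \<le> g * g * H" using nW H by (intro mult_right_mono mult_mono) (auto simp: g_def)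
  finally have "(norm (curv_term d a v))\<^sup>2 \<le> (g * g * H)\<^sup>2" by (intro power_mono) auto
  with bad False have "C * g ^ 6 < (g * g * H)\<^sup>2" by (auto simp: g_def)
  also have "\<dots> = g ^ 4 * H\<^sup>2" by (simp add: power_mult_distrib numeral_eq_Suc)
  finally have "g ^ 4 * (C * g\<^sup>2) < g ^ 4 * H\<^sup>2" by (simp add: numeral_eq_Suc mult_ac)
  then have "C * g\<^sup>2 < H\<^sup>2" using g by simp
  then show ?thesis using C by (simp add: g_def H_def field_simps)
qed

text \<open>At \<open>x + w\<close>, a multiple of the zero \<open>v\<close>, the polynomial
  vanishes and the gradient is small by homogeneity. Along the segment from there to
  \<open>x\<close> the tangential second derivatives are controlled, so the derivatives at
  \<open>x\<close> stay small and the value gains one more factor \<open>\<rho>\<close>.\<close>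

lemma small_at_net_point:
  assumes v: "hpoly d a v = 0" and c: "x + w = c *s v" "norm v = 1"
    and x: "norm x = 1" and w: "herm w x = 0" "norm w \<le> \<rho>" and \<rho>: "\<rho> \<le> 1 / sqrt (real d)"
    and g: "norm (grad d a v) \<le> \<epsilon>" and t: "herm t x = 0" "norm t = 1"
  shows "norm (dhpoly d a x t) \<le> exp (9 / 2) * \<epsilon> + \<rho> * (M * exp (9 / 2) * real d)"
    and "norm (hpoly d a x) \<le> \<rho> * (exp (9 / 2) * \<epsilon> + \<rho> * (M * exp (9 / 2) * real d))"
proof -
  define H where "H = M * exp (9 / 2) * real d"
  have H: "0 \<le> H" using M_nonneg by (simp add: H_def)
  have \<rho>0: "0 \<le> \<rho>" using w(2) norm_ge_zero order_trans by blast
  have \<epsilon>0: "0 \<le> \<epsilon>" using g norm_ge_zero order_trans by blast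
  have nc: "norm c = norm (x + w)" using c by (simp add: norm_scale_vec)
  have "norm (x + w) ^ (d - 1) \<le> exp (9 / 2)"
    by (rule norm_power_bound[OF _ near_orthogonal[OF x w(1)]])
      (use d w(2) \<rho> in \<open>auto intro: order_trans simp: divide_right_mono\<close>)
  then have "norm c ^ (d - 1) \<le> exp (9 / 2)" by (simp add: nc)
  then have gy: "norm (grad d a (x + w)) \<le> exp (9 / 2) * \<epsilon>"
    unfolding c(1) grad_scale norm_scale_vec norm_power
    using g by (intro mult_mono) auto
  have Py: "hpoly d a (x + w) = 0" by (simp add: c(1) hpoly_scale v)
  have D1: "norm (dhpoly d a (x + w) u) \<le> exp (9 / 2) * \<epsilon> * norm u" for u
    using order_trans[OF norm_bil_le mult_right_mono[OF gy norm_ge_zero]] by (simp add: dhpoly_bil)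
  have seg: "norm (s *s w) \<le> 1 / sqrt (real d)" "herm (s *s w) x = 0" if "s \<in> closed_segment 0 1" for s
  proof -
    have "norm s \<le> 1" using that by (auto simp: closed_segment_def norm_mult)
    then have "norm s * norm w \<le> 1 * norm w" by (intro mult_right_mono) auto
    then show "norm (s *s w) \<le> 1 / sqrt (real d)" using w(2) \<rho> by (simp add: norm_scale_vec)
    show "herm (s *s w) x = 0" by (simp add: herm_linear w)
  qed
  have D2: "norm (d2hpoly d a (x + s *s w) u w) \<le> norm u * \<rho> * H" if "s \<in> closed_segment 0 1" "herm u x = 0" for s u
  proof -
    have "norm (d2hpoly d a (x + s *s w) u w) \<le> norm u * norm w * H"
      unfolding H_def by (rule d2hpoly_le[OF x seg(2)[OF that(1)] seg(1)[OF that(1)] that(2) w(1)])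
    also have "\<dots> \<le> norm u * \<rho> * H" using w(2) H by (intro mult_right_mono mult_left_mono) auto
    finally show ?thesis .
  qed
  have "norm (dhpoly d a (x + 0 *s w) t - dhpoly d a (x + 1 *s w) t) \<le> (\<rho> * H) * norm (0 - 1 :: complex)"
  proof (rule field_differentiable_bound[OF convex_closed_segment[of 0 1]])
    show "((\<lambda>s. dhpoly d a (x + s *s w) t) has_field_derivative d2hpoly d a (x + s *s w) t w) (at s within closed_segment 0 1)" for s
      by (rule has_field_derivative_at_within[OF dhpoly_line])
    show "norm (d2hpoly d a (x + s *s w) t w) \<le> \<rho> * H" if "s \<in> closed_segment 0 1" for s
      using D2[OF that t(1)] t(2) by simp
  qed auto
  then have "norm (dhpoly d a x t - dhpoly d a (x + w) t) \<le> \<rho> * H" by simp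
  then show "norm (dhpoly d a x t) \<le> exp (9 / 2) * \<epsilon> + \<rho> * (M * exp (9 / 2) * real d)"
    using D1[of t] t(2) norm_triangle_sub[of "dhpoly d a x t" "dhpoly d a (x + w) t"] by (simp add: H_def)
  \<comment> \<open>The Taylor expansion is centred at the end \<open>s = 1\<close> of the segment,
    where the value is 0 and the derivative small, and evaluated at \<open>s = 0\<close>.\<close>
  define F where "F = (\<lambda>i s. case i of 0 \<Rightarrow> hpoly d a (x + s *s w) | Suc 0 \<Rightarrow> dhpoly d a (x + s *s w) w
     | _ \<Rightarrow> d2hpoly d a (x + s *s w) w w)"
  have "norm (F 0 0 - (\<Sum>i\<le>1. F i 1 * (0 - 1) ^ i / fact i)) \<le> (\<rho> * \<rho> * H) * norm (0 - 1 :: complex) ^ Suc 1 / fact 1"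
  proof (rule complex_Taylor[where S = "closed_segment 0 1"])
    show "(F i has_field_derivative F (Suc i) s) (at s within closed_segment 0 1)" if "i \<le> 1" for i s
    proof -
      have "i = 0 \<or> i = 1" using that by auto
      then show ?thesis
        unfolding F_def
        by (auto intro: has_field_derivative_at_within[OF hpoly_line] has_field_derivative_at_within[OF dhpoly_line])
    qed
    show "norm (F (Suc 1) s) \<le> \<rho> * \<rho> * H" if "s \<in> closed_segment 0 1" for s
    proof -
      have "norm w * \<rho> * H \<le> \<rho> * \<rho> * H" using w(2) H \<rho>0 by (intro mult_right_mono) auto
      then show ?thesis using D2[OF that w(1)] by (simp add: F_def)
    qed
  qed auto
  then have "norm (hpoly d a x + dhpoly d a (x + w) w) \<le> \<rho> * \<rho> * H"
    by (simp add: F_def Py)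
  moreover have "norm (dhpoly d a (x + w) w) \<le> \<rho> * (exp (9 / 2) * \<epsilon>)"
  proof -
    have "exp (9 / 2) * \<epsilon> * norm w \<le> exp (9 / 2) * \<epsilon> * \<rho>" using w(2) \<epsilon>0 by (intro mult_left_mono) auto
    then show ?thesis using D1[of w] by (simp add: mult_ac)
  qed
  moreover have "norm (hpoly d a x) \<le> norm (hpoly d a x + dhpoly d a (x + w) w) + norm (dhpoly d a (x + w) w)"
    using norm_triangle_ineq4[of "hpoly d a x + dhpoly d a (x + w) w" "dhpoly d a (x + w) w"] by simp
  ultimately show "norm (hpoly d a x) \<le> \<rho> * (exp (9 / 2) * \<epsilon> + \<rho> * (M * exp (9 / 2) * real d))"
    by (simp add: H_def algebra_simps)
qed

end

text \<open>By a Bernstein inequality the derivative of \<open>P\<close> is at most of the order of \<open>d\<close> times the maximum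
  of \<open>|P|\<close> on the sphere.\<close>

lemma hpoly_half_max_near:
  assumes d: "2 \<le> d"
  shows "\<exists>v. norm v = 1 \<and> bounded_hpoly d a (norm (hpoly d a v)) \<and>
    (\<forall>n. norm (n - v) \<le> 1 / (18 * real d) \<longrightarrow> norm (hpoly d a v) / 2 \<le> norm (hpoly d a n))"
proof -
  have "axis 1 1 \<in> sphere (0::complex^3) 1" by simp
  then have "sphere (0::complex^3) 1 \<noteq> {}" by blast
  then obtain v where v: "v \<in> sphere (0::complex^3) 1" "\<And>u. u \<in> sphere 0 1 \<Longrightarrow> norm (hpoly d a u) \<le> norm (hpoly d a v)"
    using continuous_attains_sup[OF compact_sphere, of 0 1 "\<lambda>v. norm (hpoly d a v)"]
      continuous_on_norm[OF continuous_on_hpoly[of "sphere 0 1" d a]] by blast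
  define M where "M = norm (hpoly d a v)"
  interpret bounded_hpoly d a M
    by unfold_locales (use v d in \<open>auto simp: M_def\<close>)
  have "M / 2 \<le> norm (hpoly d a n)" if n: "norm (n - v) \<le> 1 / (18 * real d)" for n
  proof -
    have D: "norm (dhpoly d a (v + s *s (n - v)) (n - v)) \<le> M / 2" if s: "s \<in> closed_segment 0 1" for s
    proof (cases "n = v")
      case True
      then show ?thesis using M_nonneg by (simp add: dhpoly_zero_arg)
    next
      case False
      \<comment> \<open>In the parameter of the complex line, this radius displaces the point by
        1/d. The disc lies in the ball of radius 1 + 2/d, where |P| is at most e^2 M and so at most
        9 M; hence a step of length 1/(18 d) changes P by at most M/2.\<close>
      define r where "r = 1 / (real d * norm (n - v))"
      have r: "0 < r" using False d by (simp add: r_def)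
      have "norm (dhpoly d a (v + s *s (n - v)) (n - v)) \<le> M * 9 / r"
      proof (rule dhpoly_cauchy[OF r])
        fix s' :: complex assume s': "norm s' = r"
        have "norm s \<le> 1" using s by (auto simp: closed_segment_def norm_mult)
        then have "norm s * norm (n - v) \<le> 1 * (1 / (18 * real d))" using n by (intro mult_mono) auto
        also have "1 * (1 / (18 * real d)) \<le> 1 / real d" using d by (simp add: field_simps)
        finally have 1: "norm (s *s (n - v)) \<le> 1 / real d" by (simp only: norm_scale_vec)
        have 2: "norm (s' *s (n - v)) = 1 / real d" unfolding norm_scale_vec s' r_def using False by simp
        have "norm (v + s *s (n - v) + s' *s (n - v)) \<le> norm v + norm (s *s (n - v)) + norm (s' *s (n - v))"
          by (intro order_trans[OF norm_triangle_ineq] add_mono norm_triangle_ineq order_refl)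
        also have "\<dots> \<le> 1 + 2 / real d" using 1 2 v(1) by simp
        also have "\<dots> \<le> exp (2 / real d)" by (rule exp_ge_add_one_self_aux) simp
        finally have "norm (v + s *s (n - v) + s' *s (n - v)) ^ d \<le> exp (2 / real d) ^ d"
          by (intro power_mono) auto
        also have "\<dots> = exp 1 * exp 1" using d by (simp add: exp_of_nat_mult[symmetric] exp_add[symmetric])
        also have "\<dots> \<le> 3 * 3" using exp_le by (intro mult_mono) auto
        finally show "norm (hpoly d a (v + s *s (n - v) + s' *s (n - v))) \<le> M * 9"
          using order_trans[OF hpoly_le mult_left_mono[OF _ M_nonneg]] by simp
      qed
      also have "\<dots> = M * (9 * real d * norm (n - v))" by (simp add: r_def)
      also have "\<dots> \<le> M * (1 / 2)" using n d M_nonneg by (intro mult_left_mono) (auto simp: field_simps)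
      finally show ?thesis by simp
    qed
    have "norm (hpoly d a (v + 1 *s (n - v)) - hpoly d a (v + 0 *s (n - v))) \<le> M / 2 * norm (1 - 0 :: complex)"
    proof (rule field_differentiable_bound[OF convex_closed_segment[of 0 1]])
      show "((\<lambda>s. hpoly d a (v + s *s (n - v))) has_field_derivative dhpoly d a (v + s *s (n - v)) (n - v))
          (at s within closed_segment 0 1)" for s
        by (rule has_field_derivative_at_within[OF hpoly_line])
    qed (rule D, assumption, rule ends_in_segment, rule ends_in_segment)
    then have "norm (hpoly d a n - hpoly d a v) \<le> M / 2" by simp
    then show ?thesis using norm_triangle_ineq2[of "hpoly d a v" "hpoly d a n"]
      by (simp add: M_def norm_minus_commute)
  qed
  then show ?thesis using v(1) bounded_hpoly_axioms by (intro exI[of _ v]) (auto simp: M_def)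
qed

section \<open>Nets\<close>

definition grid :: "real \<Rightarrow> nat \<Rightarrow> (complex^3) set" where
  "grid h L = (let T = {- int L..int L} in
     (\<lambda>(p1, q1, p2, q2, p3, q3). vector [Complex (h * of_int p1) (h * of_int q1),
        Complex (h * of_int p2) (h * of_int q2), Complex (h * of_int p3) (h * of_int q3)])
      ` (T \<times> T \<times> T \<times> T \<times> T \<times> T))"

lemma finite_grid: "finite (grid h L)"
  unfolding grid_def Let_def by (intro finite_imageI finite_cartesian_product) auto

lemma card_grid: "card (grid h L) \<le> (2 * L + 1) ^ 6"
proof -
  let ?T = "{- int L..int L}"
  have "card (grid h L) \<le> card (?T \<times> ?T \<times> ?T \<times> ?T \<times> ?T \<times> ?T)"
    unfolding grid_def Let_def by (rule card_image_le) (intro finite_cartesian_product; simp)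
  also have "\<dots> = (2 * L + 1) ^ 6"
  proof -
    have "card ?T = 2 * L + 1" by simp
    then show ?thesis by (simp only: card_cartesian_product) (simp add: numeral_eq_Suc)
  qed
  finally show ?thesis .
qed

lemma grid_approx:
  assumes v: "norm (v::complex^3) = 1" and h: "0 < h" "1 / h \<le> real L"
  shows "\<exists>n\<in>grid h L. norm (n - v) \<le> 6 * h"
proof -
  define fl where "fl x = \<lfloor>x / h\<rfloor>" for x
  have fl: "fl x \<in> {- int L..int L}" "\<bar>h * of_int (fl x) - x\<bar> \<le> h" if "\<bar>x\<bar> \<le> 1" for x
  proof -
    have "\<bar>x / h\<bar> \<le> 1 / h" using that h by (simp add: divide_right_mono)
    then have "\<bar>x / h\<bar> \<le> real L" using h by simp
    then have "- real L \<le> x / h" "x / h \<le> real L" by (simp_all only: abs_le_iff) linarith+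
    then show "fl x \<in> {- int L..int L}"
      unfolding fl_def by (auto simp: le_floor_iff floor_le_iff)
    have "h * of_int (fl x) \<le> h * (x / h)" "h * (x / h) \<le> h * (of_int (fl x) + 1)"
      using h unfolding fl_def by (intro mult_left_mono; linarith)+
    then show "\<bar>h * of_int (fl x) - x\<bar> \<le> h" using h by (simp add: distrib_left abs_le_iff)
  qed
  have comp: "\<bar>Re (v $ i)\<bar> \<le> 1" "\<bar>Im (v $ i)\<bar> \<le> 1" for i
    using abs_Re_le_cmod[of "v $ i"] abs_Im_le_cmod[of "v $ i"] Finite_Cartesian_Product.norm_nth_le[of v i] v by linarith+
  define n :: "complex^3" where "n = (\<chi> i. Complex (h * of_int (fl (Re (v $ i)))) (h * of_int (fl (Im (v $ i)))))"
  have "n = vector [n $ 1, n $ 2, n $ 3]" by (simp add: vec_eq_iff forall_3 vector_3)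
  also have "\<dots> \<in> grid h L"
    unfolding grid_def Let_def n_def vec_lambda_beta
    by (rule image_eqI[where x = "(fl (Re (v $ 1)), fl (Im (v $ 1)), fl (Re (v $ 2)), fl (Im (v $ 2)), fl (Re (v $ 3)), fl (Im (v $ 3)))"])
      (use fl(1)[OF comp(1)] fl(1)[OF comp(2)] in \<open>simp_all only: prod.case mem_Times_iff fst_conv snd_conv simp_thms\<close>)
  finally have "n \<in> grid h L" .
  moreover have "norm (n - v) \<le> 6 * h"
  proof -
    have c: "norm ((n - v) $ i) \<le> 2 * h" for i
    proof -
      have "norm ((n - v) $ i) \<le> \<bar>Re ((n - v) $ i)\<bar> + \<bar>Im ((n - v) $ i)\<bar>" by (rule cmod_le)
      also have "\<dots> \<le> h + h"
        unfolding n_def using fl(2)[OF comp(1)[of i]] fl(2)[OF comp(2)[of i]] by (intro add_mono) simp_all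
      finally show ?thesis by simp
    qed
    have "norm (n - v) \<le> (\<Sum>i\<in>UNIV. norm ((n - v) $ i))"
      unfolding norm_vec_def by (rule L2_set_le_sum) simp
    also have "\<dots> \<le> 6 * h" using c[of 1] c[of 2] c[of 3] by (simp only: sum_3)
    finally show ?thesis .
  qed
  ultimately show ?thesis by blast
qed

text \<open>A zero matters only up to scaling, so \<open>v\<close> may be divided by its Hermitian
  product with \<open>x\<close>; the displacement from \<open>x\<close> is then exactly orthogonal
  to \<open>x\<close>. The factor 8 arises from |v - x| at most 2 \<open>\<eta>\<close>, an equal
  bound for the deviation of the product from 1, and the modulus of the product being at least
  1/2.\<close>

lemma normalize_net_point:
  assumes v: "norm v = 1" and n: "norm (n - v) \<le> \<eta>" and \<eta>: "\<eta> \<le> 1 / 4"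
  defines "x \<equiv> of_real (inverse (norm n)) *s n"
  shows "n \<noteq> 0 \<and> norm x = 1 \<and> (\<exists>c w. x + w = c *s v \<and> herm w x = 0 \<and> norm w \<le> 8 * \<eta>)"
proof -
  have \<eta>0: "0 \<le> \<eta>" using n norm_ge_zero order_trans by blast
  have nn: "\<bar>norm n - 1\<bar> \<le> \<eta>" using norm_triangle_ineq3[of n v] n v by simp
  then have n0: "norm n > 0" using \<eta> by linarith
  then have x1: "norm x = 1" by (simp add: x_def norm_scale_vec norm_inverse)
  have "n = of_real (norm n) *s x" using n0 by (simp add: x_def vec_eq_iff)
  then have "n - x = of_real (norm n - 1) *s x"
    by (metis (no_types, lifting) of_real_1 of_real_diff vector_smult_lid vector_sub_rdistrib)
  then have "norm (n - x) = \<bar>norm n - 1\<bar>" by (simp only: norm_scale_vec x1 norm_of_real) simp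
  then have "norm (n - x) \<le> \<eta>" using nn by simp
  then have vx: "norm (v - x) \<le> 2 * \<eta>"
    using norm_triangle_ineq[of "v - n" "n - x"] n by (simp add: norm_minus_commute)
  define \<beta> where "\<beta> = herm v x"
  have hxx: "herm x x = 1" by (simp add: herm_self x1)
  have "\<beta> - 1 = herm (v - x) x"
    unfolding \<beta>_def hxx[symmetric] by (simp add: herm_def left_diff_distrib sum_subtractf)
  then have b1: "norm (\<beta> - 1) \<le> 2 * \<eta>"
    using herm_cauchy_schwarz[of "v - x" x] vx x1 by simp
  then have b2: "1 / 2 \<le> norm \<beta>"
    using norm_triangle_ineq2[of 1 "1 - \<beta>"] \<eta> by (simp add: norm_minus_commute)
  then have b0: "\<beta> \<noteq> 0" by auto
  define w where "w = inverse \<beta> *s v - x"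
  have "herm w x = 0"
    using b0 hxx by (simp add: w_def herm_def left_diff_distrib sum_subtractf \<beta>_def sum_distrib_left[symmetric] mult.assoc)
  moreover have "norm w \<le> 8 * \<eta>"
  proof -
    have "\<beta> *s w = (v - x) - (\<beta> - 1) *s x"
      using b0 by (simp add: w_def vec_eq_iff algebra_simps)
    then have "norm \<beta> * norm w \<le> norm (v - x) + norm (\<beta> - 1) * norm x"
      by (metis norm_scale_vec norm_triangle_ineq4)
    also have "\<dots> \<le> 4 * \<eta>" using vx b1 x1 by simp
    finally have "norm \<beta> * norm w \<le> 4 * \<eta>" .
    moreover have "1 / 2 * norm w \<le> norm \<beta> * norm w" using b2 by (intro mult_right_mono) auto
    ultimately show ?thesis by simp
  qed
  moreover have "x + w = inverse \<beta> *s v" by (simp add: w_def)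
  ultimately show ?thesis using n0 x1 by auto
qed

section \<open>Orthonormal frames and the probability of a small jet\<close>

lemma norm_ccross_orthogonal:
  assumes "herm v w = 0"
  shows "norm (ccross v w) = norm v * norm w"
  by (rule power2_eq_imp_eq) (simp_all add: norm_ccross_square assms)

lemma herm_vcnj_ccross: "herm (vcnj (ccross x u)) x = 0" "herm (vcnj (ccross x u)) u = 0"
  by (simp_all add: herm_def vcnj_def ccross_def sum_3 vector_3 algebra_simps)

lemma orthonormal_frame:
  assumes x: "norm x = 1"
  shows "\<exists>t1 t2. herm t1 x = 0 \<and> herm t2 x = 0 \<and> herm t2 t1 = 0 \<and> norm t1 = 1 \<and> norm t2 = 1"
proof -
  have "\<exists>u. ccross x u \<noteq> 0"
  proof (rule ccontr)
    assume "\<not> ?thesis"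
    then have z: "ccross x u = 0" for u by blast
    from z[of "axis 1 1"] z[of "axis 2 1"] have "x = 0"
      by (auto simp: ccross_def vec_eq_iff forall_3 vector_3 axis_def)
    then show False using x by simp
  qed
  then obtain u where u: "ccross x u \<noteq> 0" by blast
  define t1 where "t1 = of_real (inverse (norm (ccross x u))) *s vcnj (ccross x u)"
  define t2 where "t2 = vcnj (ccross x t1)"
  have 1: "herm t1 x = 0" "norm t1 = 1"
    using u by (simp_all add: t1_def herm_linear herm_vcnj_ccross norm_scale_vec norm_vcnj norm_inverse)
  have "herm x t1 = 0" using 1(1) herm_commute by (metis complex_cnj_zero)
  then have "norm t2 = 1" unfolding t2_def norm_vcnj by (simp add: norm_ccross_orthogonal x 1)
  then show ?thesis using 1 herm_vcnj_ccross[of x t1] unfolding t2_def by blast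
qed

text \<open>By the kernel identities the three linear forms are orthogonal, of squared lengths N, N
  d and N d. The radial derivative would add nothing: by Euler's identity it is d times the
  value.\<close>

lemma jet_small_ball:
  assumes d: "0 < d" and x: "norm x = 1" and t: "herm t1 x = 0" "herm t2 x = 0" "herm t2 t1 = 0" "norm t1 = 1" "norm t2 = 1"
    and r: "0 < r0" "0 < r1"
  shows "measure (gmeas (exponents d)) {a \<in> space (gmeas (exponents d)).
      norm (hpoly d a x) \<le> r0 \<and> norm (dhpoly d a x t1) \<le> r1 \<and> norm (dhpoly d a x t2) \<le> r1}
    \<le> exp 3 * (r0\<^sup>2 / Ndim d * (r1\<^sup>2 / (Ndim d * real d))\<^sup>2)"
proof -
  define u where "u j \<alpha> = of_real (weight d \<alpha>) * (if j = (0::nat) then mon \<alpha> x else if j = 1 then dmon \<alpha> x t1 else dmon \<alpha> x t2)" for j \<alpha>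
  define U where "U j = (if j = (0::nat) then Ndim d else Ndim d * real d)" for j
  define r where "r j = (if j = (0::nat) then r0 else r1)" for j
  have N: "0 < Ndim d" by (simp add: Ndim_def)
  have hxx: "herm x x = 1" "herm t1 t1 = 1" "herm t2 t2 = 1" by (simp_all add: herm_self x t)
  have t': "herm x t1 = 0" "herm x t2 = 0" "herm t1 t2 = 0" using t herm_commute by (metis complex_cnj_zero)+
  have sq: "of_real (weight d \<alpha>) * p * cnj (of_real (weight d \<alpha>) * q) = of_real ((weight d \<alpha>)\<^sup>2) * p * cnj q" for \<alpha> p q
    by (simp add: power2_eq_square)
  have cnjk: "(\<Sum>\<alpha>\<in>exponents d. of_real ((weight d \<alpha>)\<^sup>2) * mon \<alpha> x * cnj (dmon \<alpha> x t)) = 0" if "herm t x = 0" for t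
    using arg_cong[OF kernel_1[of d x t x], of cnj] that by (simp add: mult_ac)
  have orth: "(\<Sum>\<alpha>\<in>exponents d. u j \<alpha> * cnj (u k \<alpha>)) = 0" if "j \<in> {0, 1, 2}" "k \<in> {0, 1, 2}" "j \<noteq> k" for j k
    using that unfolding u_def sq by (auto simp only: insert_iff empty_iff) (simp_all add: cnjk[unfolded of_real_power] kernel_1[unfolded of_real_power] kernel_2[unfolded of_real_power] t t')
  have nrm: "(\<Sum>\<alpha>\<in>exponents d. (norm (u j \<alpha>))\<^sup>2) = U j" if "j \<in> {0, 1, 2}" for j
  proof -
    have "complex_of_real (\<Sum>\<alpha>\<in>exponents d. (norm (u j \<alpha>))\<^sup>2) = (\<Sum>\<alpha>\<in>exponents d. u j \<alpha> * cnj (u j \<alpha>))"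
      unfolding of_real_sum complex_norm_square ..
    also have "\<dots> = of_real (U j)"
      using that unfolding u_def sq U_def by (auto simp only: insert_iff empty_iff) (simp_all add: kernel_0[unfolded of_real_power] kernel_2[unfolded of_real_power] t t' hxx)
    finally show ?thesis by (simp only: of_real_eq_iff)
  qed
  have forms: "(\<Sum>\<alpha>\<in>exponents d. a \<alpha> * u 0 \<alpha>) = hpoly d a x" "(\<Sum>\<alpha>\<in>exponents d. a \<alpha> * u (Suc 0) \<alpha>) = dhpoly d a x t1"
    "(\<Sum>\<alpha>\<in>exponents d. a \<alpha> * u 2 \<alpha>) = dhpoly d a x t2" for a
    by (simp_all add: u_def hpoly_eq dhpoly_def mult.assoc)
  have "measure (gmeas (exponents d)) {a \<in> space (gmeas (exponents d)). \<forall>j\<in>{0, 1, 2}. norm (\<Sum>\<alpha>\<in>exponents d. a \<alpha> * u j \<alpha>) \<le> r j}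
    \<le> exp (card {0, 1, 2::nat}) * (\<Prod>j\<in>{0, 1, 2}. (r j)\<^sup>2 / U j)"
    by (rule gaussian_small_ball[OF finite_exponents _ orth nrm]) (use N d r in \<open>auto simp: U_def r_def\<close>)
  then show ?thesis by (simp add: forms r_def U_def power2_eq_square)
qed


lemma measurable_hpoly_gmeas: "(\<lambda>a. hpoly d a v) \<in> borel_measurable (gmeas (exponents d))"
  using measurable_hpoly[of d v] by (simp add: measurable_def sets_gmeas space_gmeas space_PiM PiE_def)

lemma measurable_dhpoly_gmeas: "(\<lambda>a. dhpoly d a v t) \<in> borel_measurable (gmeas (exponents d))"
proof -
  have "(\<lambda>a. dhpoly d a v t) \<in> borel_measurable (\<Pi>\<^sub>M i\<in>exponents d. borel)"
    unfolding dhpoly_def by measurable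
  then show ?thesis by (simp add: measurable_def sets_gmeas space_gmeas space_PiM PiE_def)
qed

text \<open>The variance of the value is N |v|^(2 d), at most N e^9. The points of the net for the
  maximum are not normalized, hence the allowance beyond norm 1.\<close>

lemma hpoly_tail:
  assumes d: "0 < d" and v: "(norm v)\<^sup>2 \<le> 1 + 9 / real d" and s: "0 \<le> s"
  shows "measure (gmeas (exponents d)) {a \<in> space (gmeas (exponents d)). s \<le> norm (hpoly d a v)}
    \<le> 4 * exp (- s\<^sup>2 / (2 * (Ndim d * exp 9)))"
proof -
  define u where "u \<alpha> = of_real (weight d \<alpha>) * mon \<alpha> v" for \<alpha>
  have "complex_of_real (\<Sum>\<alpha>\<in>exponents d. (norm (u \<alpha>))\<^sup>2) = (\<Sum>\<alpha>\<in>exponents d. of_real ((weight d \<alpha>)\<^sup>2) * mon \<alpha> v * cnj (mon \<alpha> v))"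
    unfolding of_real_sum complex_norm_square u_def by (simp add: power2_eq_square mult_ac)
  also have "\<dots> = of_real (Ndim d * (norm v ^ d)\<^sup>2)"
    unfolding kernel_0 herm_self by (simp add: power_mult[symmetric] mult.commute)
  finally have "(\<Sum>\<alpha>\<in>exponents d. (norm (u \<alpha>))\<^sup>2) = Ndim d * (norm v ^ d)\<^sup>2" by (simp only: of_real_eq_iff)
  also have "\<dots> \<le> Ndim d * (exp (9 / 2))\<^sup>2"
    using norm_power_bound[OF d v order_refl] by (intro mult_left_mono power_mono) (auto simp: Ndim_def)
  also have "(exp (9 / 2 :: real))\<^sup>2 = exp 9" by (simp add: power2_eq_square exp_add[symmetric])
  finally have "(\<Sum>\<alpha>\<in>exponents d. (norm (u \<alpha>))\<^sup>2) \<le> Ndim d * exp 9" .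
  moreover have "0 < Ndim d * exp 9" by (simp add: Ndim_def)
  ultimately have "measure (gmeas (exponents d)) {a \<in> space (gmeas (exponents d)). s \<le> norm (\<Sum>\<alpha>\<in>exponents d. a \<alpha> * u \<alpha>)}
    \<le> 4 * exp (- s\<^sup>2 / (2 * (Ndim d * exp 9)))"
    by (rule gaussian_tail[OF finite_exponents _ _ s])
  then show ?thesis by (simp add: u_def hpoly_eq mult.assoc)
qed

section \<open>The union bound\<close>

text \<open>Curvature above \<open>d ^ 5\<close> forces the gradient of \<open>P\<close> to be of the order of \<open>d powr (-3/2)\<close> times
  the maximum of \<open>|P|\<close>, while the second derivatives are at most of the order of \<open>d\<close> times that
  maximum. With the mesh \<open>d powr (-5/2)\<close> both contribute equally to the jet at a net point.\<close>

definition mesh :: "nat \<Rightarrow> real" where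
  "mesh d = 1 / ((real d)\<^sup>2 * sqrt (real d))"

text \<open>With M = m sqrt N as bound on the sphere, the 4 is 3 + 1: the small gradient contributes
  three units of M e^9 d^(-3/2), the second derivatives over one mesh width at most one.\<close>

definition jet_bound :: "nat \<Rightarrow> real \<Rightarrow> real" where
  "jet_bound d m = 4 * (m * sqrt (Ndim d)) * exp 9 / (real d * sqrt (real d))"

definition normalized :: "complex^3 \<Rightarrow> complex^3" where
  "normalized n = of_real (inverse (norm n)) *s n"

text \<open>108 is 6 times 18: \<open>grid_approx\<close> loses a factor 6, and
  \<open>hpoly_half_max_near\<close> asks for distance 1/(18 d).\<close>

definition sup_net :: "nat \<Rightarrow> (complex^3) set" where
  "sup_net d = {n \<in> grid (1 / (108 * real d)) (108 * d). (norm n)\<^sup>2 \<le> 1 + 9 / real d}"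

text \<open>48 is 6 times 8: a factor 6 is lost in approximating by the grid and a factor 8 in
  normalizing, so displacements end up at most \<open>mesh d\<close>.\<close>

definition jet_net :: "nat \<Rightarrow> (complex^3) set" where
  "jet_net d = normalized ` (grid (mesh d / 48) (nat \<lceil>48 / mesh d\<rceil>) - {0})"

text \<open>Either the maximum of |P| exceeds M = m sqrt N, and a net point near it still sees half
  of it, or M bounds P on the sphere and the estimates with this deterministic M apply. Both
  alternatives refer to fixed finite nets, as a union bound requires.\<close>

lemma bad_coeffs_cover:
  assumes d: "2 \<le> d" and m: "0 < m" and a: "a \<in> extensional (exponents d)"
    and bad: "a \<notin> good_coeffs d ((real d ^ 5 + 4 * pi) / (2 * pi))"
  shows "(\<exists>n\<in>sup_net d. m * sqrt (Ndim d) / 2 \<le> norm (hpoly d a n)) \<or>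
    (\<exists>x\<in>jet_net d. norm (hpoly d a x) \<le> mesh d * jet_bound d m \<and>
      (\<forall>t. herm t x = 0 \<and> norm t = 1 \<longrightarrow> norm (dhpoly d a x t) \<le> jet_bound d m))"
proof -
  define M where "M = m * sqrt (Ndim d)"
  define E where "E = exp (9 / 2 :: real)"
  define C where "C = (real d ^ 5 + 4 * pi) / (2 * pi)"
  have E1: "1 \<le> E" and EE: "E * E = exp 9" by (simp_all add: E_def exp_add[symmetric])
  have M0: "0 \<le> M" using m by (simp add: M_def Ndim_def)
  have d0: "0 < real d" "1 \<le> real d" using d by auto
  obtain v where v: "norm v = 1" "bounded_hpoly d a (norm (hpoly d a v))"
    "\<And>n. norm (n - v) \<le> 1 / (18 * real d) \<Longrightarrow> norm (hpoly d a v) / 2 \<le> norm (hpoly d a n)"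
    using hpoly_half_max_near[OF d] by blast
  obtain n where n: "n \<in> grid (1 / (108 * real d)) (108 * d)" "norm (n - v) \<le> 6 * (1 / (108 * real d))"
    using grid_approx[OF v(1), of "1 / (108 * real d)" "108 * d"] d0 by auto
  then have nv: "norm (n - v) \<le> 1 / (18 * real d)" by simp
  have "n \<in> sup_net d"
  proof -
    have "norm n \<le> 1 + 1 / (18 * real d)" using norm_triangle_ineq[of v "n - v"] v(1) nv by simp
    then have "(norm n)\<^sup>2 \<le> (1 + 1 / (18 * real d))\<^sup>2" by (intro power_mono) auto
    also have "\<dots> = 1 + 1 / (9 * real d) + (1 / (18 * real d)) * (1 / (18 * real d))"
      using d0 by (simp add: power2_eq_square field_simps)
    also have "(1 / (18 * real d)) * (1 / (18 * real d)) \<le> 1 / (18 * real d) * 1"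
      using d0 by (intro mult_left_mono) (auto simp: field_simps)
    also have "1 + 1 / (9 * real d) + 1 / (18 * real d) * 1 \<le> 1 + 9 / real d"
      using d0 by (simp add: field_simps)
    finally show ?thesis using n(1) by (simp add: sup_net_def)
  qed
  show ?thesis
  proof (cases "M / 2 \<le> norm (hpoly d a n)")
    case True
    then show ?thesis using \<open>n \<in> sup_net d\<close> by (auto simp: M_def)
  next
    case False
    then have "norm (hpoly d a v) \<le> M" using v(3)[OF nv] by simp
    then interpret bounded_hpoly d a M
      using v(2) unfolding bounded_hpoly_def by (meson order_trans)
    obtain z where z: "norm z = 1" "hpoly d a z = 0"
      "grad d a z = 0 \<or> C * norm (grad d a z) ^ 6 < (norm (curv_term d a z))\<^sup>2"
      using bad a unfolding good_coeffs_def C_def by (auto simp: not_le)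
    \<comment> \<open>9 exceeds 2 pi and is a square; its root is the 3 in
      \<open>\<epsilon>\<close>.\<close>
    have C: "real d ^ 5 / 9 \<le> C"
    proof -
      have "real d ^ 5 / 9 \<le> real d ^ 5 / (2 * pi)" using pi_less_4 by (intro divide_left_mono) auto
      also have "\<dots> \<le> C" unfolding C_def by (intro divide_right_mono) auto
      finally show ?thesis .
    qed
    then have C0: "0 < C" using d0 by (smt (verit) divide_pos_pos zero_less_power)
    define \<epsilon> where "\<epsilon> = 3 * M * E / (real d * sqrt (real d))"
    have sq: "sqrt (real d) * sqrt (real d) = real d" by simp
    have g: "norm (grad d a z) \<le> \<epsilon>"
    proof (rule power2_le_imp_le)
      have "(norm (grad d a z))\<^sup>2 \<le> (M * E * real d)\<^sup>2 / C"
        unfolding E_def by (rule grad_small[OF z(1) C0 z(3)])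
      also have "\<dots> \<le> (M * E * real d)\<^sup>2 / (real d ^ 5 / 9)"
        using C C0 d0 by (intro divide_left_mono) auto
      also have "\<dots> = \<epsilon>\<^sup>2"
        using d0 by (simp add: \<epsilon>_def power_mult_distrib power_divide field_simps numeral_eq_Suc)
      finally show "(norm (grad d a z))\<^sup>2 \<le> \<epsilon>\<^sup>2" .
      show "0 \<le> \<epsilon>" using M0 E1 by (simp add: \<epsilon>_def)
    qed
    have s1: "1 \<le> sqrt (real d)" using d0 by simp
    have mesh0: "0 < mesh d" using d0 by (simp add: mesh_def)
    have mesh1: "mesh d \<le> 1 / sqrt (real d)"
      using d0 s1 unfolding mesh_def by (intro divide_left_mono) (auto simp: field_simps)
    have mesh2: "mesh d \<le> 1" using mesh1 s1 by (smt (verit) divide_le_eq_1)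
    have "1 / (mesh d / 48) \<le> real (nat \<lceil>48 / mesh d\<rceil>)" using mesh0 by simp
    then obtain n' where n': "n' \<in> grid (mesh d / 48) (nat \<lceil>48 / mesh d\<rceil>)" "norm (n' - z) \<le> 6 * (mesh d / 48)"
      using grid_approx[OF z(1), of "mesh d / 48"] mesh0 by fastforce
    then have nz: "norm (n' - z) \<le> mesh d / 8" by simp
    define x where "x = normalized n'"
    obtain c w where x: "n' \<noteq> 0" "norm x = 1" "x + w = c *s z" "herm w x = 0" "norm w \<le> 8 * (mesh d / 8)"
      using normalize_net_point[OF z(1) nz] mesh2 unfolding x_def normalized_def by auto
    have xnet: "x \<in> jet_net d" using n'(1) x(1) by (auto simp: jet_net_def x_def)
    have w: "norm w \<le> mesh d" using x(5) by simp
    have tau: "E * \<epsilon> + mesh d * (M * E * real d) \<le> jet_bound d m"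
    proof -
      have "mesh d * (M * E * real d) = M * E / (real d * sqrt (real d))"
        using d0 by (simp add: mesh_def power2_eq_square)
      also have "\<dots> \<le> M * (E * E) / (real d * sqrt (real d))"
        using M0 E1 by (intro divide_right_mono mult_left_mono) auto
      finally have "E * \<epsilon> + mesh d * (M * E * real d) \<le> E * \<epsilon> + M * (E * E) / (real d * sqrt (real d))" by simp
      also have "\<dots> = 4 * M * (E * E) / (real d * sqrt (real d))"
        unfolding \<epsilon>_def by (simp add: field_simps)
      finally show ?thesis unfolding jet_bound_def M_def[symmetric] EE by simp
    qed
    note small = small_at_net_point[OF z(2) x(3) z(1) x(2) x(4) w mesh1 g, folded E_def]
    have "norm (dhpoly d a x t) \<le> jet_bound d m" if "herm t x = 0 \<and> norm t = 1" for t
      using order_trans[OF small(1) tau] that by blast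
    moreover have "norm (hpoly d a x) \<le> mesh d * jet_bound d m"
    proof -
      obtain t where "herm t x = 0" "norm t = 1" using orthonormal_frame[OF x(2)] by blast
      then show ?thesis using order_trans[OF small(2) mult_left_mono[OF tau]] mesh0 by simp
    qed
    ultimately show ?thesis using xnet by blast
  qed
qed

lemma card_sup_net: "0 < d \<Longrightarrow> finite (sup_net d) \<and> real (card (sup_net d)) \<le> (217 * real d) ^ 6"
proof -
  assume d: "0 < d"
  let ?G = "grid (1 / (108 * real d)) (108 * d)"
  have "card (sup_net d) \<le> card ?G"
    unfolding sup_net_def by (rule card_mono[OF finite_grid]) auto
  also have "\<dots> \<le> (2 * (108 * d) + 1) ^ 6" by (rule card_grid)
  also have "\<dots> \<le> (217 * d) ^ 6" using d by (intro power_mono) auto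
  finally have "real (card (sup_net d)) \<le> real ((217 * d) ^ 6)" by (simp only: of_nat_le_iff)
  then show ?thesis using finite_grid by (simp add: sup_net_def)
qed

lemma card_jet_net:
  assumes d: "0 < d"
  shows "finite (jet_net d)" "real (card (jet_net d)) \<le> 99 ^ 6 * real d ^ 15" "\<And>x. x \<in> jet_net d \<Longrightarrow> norm x = 1"
proof -
  define L where "L = nat \<lceil>48 / mesh d\<rceil>"
  let ?G = "grid (mesh d / 48) L"
  show "finite (jet_net d)" unfolding jet_net_def L_def[symmetric] using finite_grid by auto
  show "norm x = 1" if x: "x \<in> jet_net d" for x
  proof -
    obtain n where "n \<noteq> 0" "x = normalized n" using x by (auto simp: jet_net_def)
    then show ?thesis by (simp add: normalized_def norm_scale_vec norm_inverse)
  qed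
  define q where "q = (real d)\<^sup>2 * sqrt (real d)"
  have q: "1 \<le> q" using d unfolding q_def by (intro mult_ge1_I) auto
  have L: "real L \<le> 48 * q + 1"
  proof -
    have "48 / mesh d = 48 * q" by (simp add: mesh_def q_def)
    moreover have "real L = of_int \<lceil>48 * q\<rceil>" using q by (simp add: L_def \<open>48 / mesh d = 48 * q\<close>)
    ultimately show ?thesis using of_int_ceiling_le_add_one[of "48 * q"] by simp
  qed
  have "card (jet_net d) \<le> card (?G - {0})"
    unfolding jet_net_def L_def[symmetric] using finite_grid by (intro card_image_le) auto
  also have "\<dots> \<le> card ?G" using finite_grid by (intro card_mono) auto
  also have "\<dots> \<le> (2 * L + 1) ^ 6" by (rule card_grid)
  finally have "real (card (jet_net d)) \<le> real ((2 * L + 1) ^ 6)" by (simp only: of_nat_le_iff)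
  \<comment> \<open>2 (48 q + 1) + 1 is at most 99 q because q is at least 1.\<close>
  also have "\<dots> \<le> (99 * q) ^ 6" unfolding of_nat_power using L q by (intro power_mono) auto
  also have "\<dots> = 99 ^ 6 * real d ^ 15"
  proof -
    have "sqrt (real d) ^ 6 = (sqrt (real d) ^ 2) ^ 3" by (simp only: power_mult[symmetric]) simp
    also have "\<dots> = real d ^ 3" by simp
    finally have "q ^ 6 = real d ^ 12 * real d ^ 3" by (simp add: q_def power_mult_distrib power_mult[symmetric])
    then show ?thesis by (simp add: power_mult_distrib power_add[symmetric])
  qed
  finally show "real (card (jet_net d)) \<le> 99 ^ 6 * real d ^ 15" .
qed

text \<open>The parameter \<open>m\<close> trades the two terms: a larger \<open>m\<close> makes a
  large maximum rarer but the jet event wider, by \<open>m\<close>^2 for each of the three linear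
  forms.\<close>

lemma measure_bad_coeffs:
  assumes d: "2 \<le> d" and m: "0 < m"
  shows "1 - measure (gmeas (exponents d)) (good_coeffs d ((real d ^ 5 + 4 * pi) / (2 * pi)))
    \<le> (217 * real d) ^ 6 * (4 * exp (- m\<^sup>2 / (8 * exp 9))) + 99 ^ 6 * exp 3 * (16 * exp 18) ^ 3 * (m ^ 6 / real d)"
proof -
  interpret prob_space "gmeas (exponents d)" by (rule prob_space_gmeas[OF finite_exponents])
  define \<tau> where "\<tau> = jet_bound d m"
  let ?good = "good_coeffs d ((real d ^ 5 + 4 * pi) / (2 * pi))" and ?S = "space (gmeas (exponents d))"
  have N: "0 < Ndim d" by (simp add: Ndim_def)
  have d0: "0 < real d" "0 < d" using d by auto
  note m1[measurable] = measurable_hpoly_gmeas measurable_dhpoly_gmeas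
  have \<tau>: "0 < \<tau>" using m N d0 by (simp add: \<tau>_def jet_bound_def)
  have mesh0: "0 < mesh d" using d0 by (simp add: mesh_def)
  \<comment> \<open>The frame is fixed as a function of the net point alone, so that each event in
    the union is determined by three given linear forms.\<close>
  obtain T1 T2 where T: "\<And>x. norm x = 1 \<Longrightarrow> herm (T1 x) x = 0 \<and> herm (T2 x) x = 0 \<and> herm (T2 x) (T1 x) = 0
      \<and> norm (T1 x) = 1 \<and> norm (T2 x) = 1"
    using orthonormal_frame by metis
  define A where "A n = {a \<in> ?S. m * sqrt (Ndim d) / 2 \<le> norm (hpoly d a n)}" for n
  define B where "B x = {a \<in> ?S. norm (hpoly d a x) \<le> mesh d * \<tau> \<and> norm (dhpoly d a x (T1 x)) \<le> \<tau>
      \<and> norm (dhpoly d a x (T2 x)) \<le> \<tau>}" for x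
  have A: "A n \<in> events" and B: "B n \<in> events" for n unfolding A_def B_def by measurable
  have good: "?good \<in> events" using sets_good_coeffs by (simp add: sets_gmeas)
  have fin: "finite (sup_net d)" "finite (jet_net d)" using card_sup_net card_jet_net d0 by auto
  have "?S - ?good \<subseteq> (\<Union>n\<in>sup_net d. A n) \<union> (\<Union>x\<in>jet_net d. B x)"
  proof
    fix a assume a: "a \<in> ?S - ?good"
    then have "a \<in> extensional (exponents d)" by (simp add: space_gmeas)
    from bad_coeffs_cover[OF d m this] a
    show "a \<in> (\<Union>n\<in>sup_net d. A n) \<union> (\<Union>x\<in>jet_net d. B x)"
      using T card_jet_net(3)[OF d0(2)] unfolding A_def B_def \<tau>_def by blast
  qed
  moreover have "(\<Union>n\<in>sup_net d. A n) \<union> (\<Union>x\<in>jet_net d. B x) \<in> events"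
    using fin A B by (intro sets.Un sets.finite_UN) auto
  ultimately have "prob (?S - ?good) \<le> prob ((\<Union>n\<in>sup_net d. A n) \<union> (\<Union>x\<in>jet_net d. B x))"
    by (rule finite_measure_mono)
  also have "\<dots> \<le> prob (\<Union>n\<in>sup_net d. A n) + prob (\<Union>x\<in>jet_net d. B x)"
    using A B fin by (intro measure_Un_le sets.finite_UN) auto
  also have "\<dots> \<le> (\<Sum>n\<in>sup_net d. prob (A n)) + (\<Sum>x\<in>jet_net d. prob (B x))"
    using A B fin by (intro add_mono finite_measure_subadditive_finite) auto
  also have "\<dots> \<le> (\<Sum>n\<in>sup_net d. 4 * exp (- m\<^sup>2 / (8 * exp 9))) + (\<Sum>x\<in>jet_net d. exp 3 * (16 * exp 18) ^ 3 * (m ^ 6 / real d ^ 16))"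
  proof (intro add_mono sum_mono)
    fix n assume "n \<in> sup_net d"
    then have "prob (A n) \<le> 4 * exp (- (m * sqrt (Ndim d) / 2)\<^sup>2 / (2 * (Ndim d * exp 9)))"
      unfolding A_def using m N by (intro hpoly_tail[OF d0(2)]) (auto simp: sup_net_def)
    also have "- (m * sqrt (Ndim d) / 2)\<^sup>2 / (2 * (Ndim d * exp 9)) = - m\<^sup>2 / (8 * exp 9)"
      using N by (simp add: power_mult_distrib power_divide)
    finally show "prob (A n) \<le> 4 * exp (- m\<^sup>2 / (8 * exp 9))" .
  next
    fix x assume x: "x \<in> jet_net d"
    note x1 = card_jet_net(3)[OF d0(2) x]
    have "prob (B x) \<le> exp 3 * ((mesh d * \<tau>)\<^sup>2 / Ndim d * (\<tau>\<^sup>2 / (Ndim d * real d))\<^sup>2)"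
      unfolding B_def using T[OF x1] mesh0 \<tau> by (intro jet_small_ball[OF d0(2) x1]) auto
    also have "(mesh d * \<tau>)\<^sup>2 / Ndim d * (\<tau>\<^sup>2 / (Ndim d * real d))\<^sup>2 = (mesh d)\<^sup>2 * (\<tau>\<^sup>2 / Ndim d) ^ 3 / (real d)\<^sup>2"
      using N d0 by (simp add: power_mult_distrib power_divide field_simps numeral_eq_Suc)
    also have "\<tau>\<^sup>2 / Ndim d = 16 * exp 18 * m\<^sup>2 / real d ^ 3"
    proof -
      have "(exp 9)\<^sup>2 = exp (18 :: real)" by (simp add: power2_eq_square exp_add[symmetric])
      then show ?thesis
        using N d0 by (simp add: \<tau>_def jet_bound_def power_mult_distrib power_divide field_simps numeral_eq_Suc)
    qed
    also have "(mesh d)\<^sup>2 = 1 / real d ^ 5"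
      using d0 by (simp add: mesh_def power_mult_distrib power_divide field_simps numeral_eq_Suc)
    also have "1 / real d ^ 5 * (16 * exp 18 * m\<^sup>2 / real d ^ 3) ^ 3 / (real d)\<^sup>2 = (16 * exp 18) ^ 3 * (m ^ 6 / real d ^ 16)"
      using d0 by (simp add: power_mult_distrib power_divide power_mult[symmetric] power_add[symmetric])
    finally show "prob (B x) \<le> exp 3 * (16 * exp 18) ^ 3 * (m ^ 6 / real d ^ 16)" by (simp add: mult.assoc)
  qed
  also have "\<dots> = real (card (sup_net d)) * (4 * exp (- m\<^sup>2 / (8 * exp 9)))
      + real (card (jet_net d)) * (exp 3 * (16 * exp 18) ^ 3 * (m ^ 6 / real d ^ 16))"
    by simp
  also have "\<dots> \<le> (217 * real d) ^ 6 * (4 * exp (- m\<^sup>2 / (8 * exp 9)))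
      + 99 ^ 6 * real d ^ 15 * (exp 3 * (16 * exp 18) ^ 3 * (m ^ 6 / real d ^ 16))"
    using card_sup_net[OF d0(2)] card_jet_net(2)[OF d0(2)] m
    by (intro add_mono mult_right_mono) auto
  also have "99 ^ 6 * real d ^ 15 * (exp 3 * (16 * exp 18) ^ 3 * (m ^ 6 / real d ^ 16))
      = 99 ^ 6 * exp 3 * (16 * exp 18) ^ 3 * (m ^ 6 / real d)"
  proof -
    have "x * real d ^ 15 * (y * z * (k / real d ^ 16)) = x * y * z * (k / real d)" for x y z k
      using d0 by (simp add: field_simps numeral_eq_Suc)
    then show ?thesis .
  qed
  finally show ?thesis using prob_compl[OF good] by simp
qed

text \<open>With m = d^(1/12) the exponential in d^(1/6) beats d^6, and m^6 / d is d^(-1/2). Any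
  exponent strictly between 0 and 1/6 would serve.\<close>

lemma bad_bound_tendsto_0:
  "(\<lambda>d. (217 * real d) ^ 6 * (4 * exp (- (real d powr (1 / 12))\<^sup>2 / (8 * exp 9)))
     + 99 ^ 6 * exp 3 * (16 * exp 18) ^ 3 * ((real d powr (1 / 12)) ^ 6 / real d)) \<longlonglongrightarrow> 0"
proof -
  define k where "k = 1 / (8 * exp 9 :: real)"
  have k: "0 < k" by (simp add: k_def)
  have 1: "(\<lambda>d. real d ^ 6 * exp (- (k * real d powr (1 / 6)))) \<longlonglongrightarrow> 0"
    using k by real_asymp
  have 2: "(\<lambda>d. real d powr (- 1 / 2)) \<longlonglongrightarrow> 0"
    by real_asymp
  have "(\<lambda>d. (217 ^ 6 * 4) * (real d ^ 6 * exp (- (k * real d powr (1 / 6))))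
     + 99 ^ 6 * exp 3 * (16 * exp 18) ^ 3 * (real d powr (- 1 / 2))) \<longlonglongrightarrow> 0"
    using tendsto_add[OF tendsto_mult_left[OF 1, of "217 ^ 6 * 4"] tendsto_mult_left[OF 2, of "99 ^ 6 * exp 3 * (16 * exp 18) ^ 3"]]
    by simp
  moreover have "eventually (\<lambda>d. (217 ^ 6 * 4) * (real d ^ 6 * exp (- (k * real d powr (1 / 6))))
     + 99 ^ 6 * exp 3 * (16 * exp 18) ^ 3 * (real d powr (- 1 / 2))
    = (217 * real d) ^ 6 * (4 * exp (- (real d powr (1 / 12))\<^sup>2 / (8 * exp 9)))
     + 99 ^ 6 * exp 3 * (16 * exp 18) ^ 3 * ((real d powr (1 / 12)) ^ 6 / real d)) sequentially"
    using eventually_gt_at_top[of 0]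
  proof eventually_elim
    case (elim d)
    have "(real d powr (1 / 12))\<^sup>2 = real d powr (1 / 6)"
      using elim by (simp add: powr_power)
    moreover have "(real d powr (1 / 12)) ^ 6 / real d = real d powr (- 1 / 2)"
    proof -
      have "(real d powr (1 / 12)) ^ 6 = real d powr (1 / 2)" using elim by (simp add: powr_power)
      moreover have "real d powr (- 1 / 2) = real d powr (1 / 2) / real d powr 1"
        unfolding powr_diff[symmetric] by simp
      ultimately show ?thesis using elim by simp
    qed
    ultimately show ?case by (simp add: k_def power_mult_distrib)
  qed
  ultimately show ?thesis by (rule Lim_transform_eventually)
qed

theorem theorem1p2:
  shows "(\<lambda>d. measure (mu d) {a \<in> space (mu d).
            smooth_curve (hpoly d a) \<and>
            (SUP x\<in>zero_locus (hpoly d a).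
               ereal \<bar>gauss_curvature (zero_locus (hpoly d a)) x\<bar>) \<le> ereal (real d ^ 5)})
         \<longlonglongrightarrow> 1"
proof (rule tendsto_sandwich)
  let ?f = "\<lambda>d. (217 * real d) ^ 6 * (4 * exp (- (real d powr (1 / 12))\<^sup>2 / (8 * exp 9)))
     + 99 ^ 6 * exp 3 * (16 * exp 18) ^ 3 * ((real d powr (1 / 12)) ^ 6 / real d)"
  let ?p = "\<lambda>d. measure (mu d) {a \<in> space (mu d). smooth_curve (hpoly d a) \<and>
            (SUP x\<in>zero_locus (hpoly d a).
               ereal \<bar>gauss_curvature (zero_locus (hpoly d a)) x\<bar>) \<le> ereal (real d ^ 5)}"
  show "(\<lambda>d. 1 - ?f d) \<longlonglongrightarrow> 1"
    using tendsto_diff[OF tendsto_const[of 1] bad_bound_tendsto_0] by simp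
  show "(\<lambda>_. 1) \<longlonglongrightarrow> (1 :: real)" by simp
  show "eventually (\<lambda>d. 1 - ?f d \<le> ?p d) sequentially"
    using eventually_ge_at_top[of 2]
  proof eventually_elim
    case (elim d)
    then have "0 < real d powr (1 / 12)" by simp
    from measure_bad_coeffs[OF elim this] show ?case
      unfolding measure_curvature_event[OF elim] by linarith
  qed
  show "eventually (\<lambda>d. ?p d \<le> 1) sequentially"
    using eventually_ge_at_top[of 2]
  proof eventually_elim
    case (elim d)
    show ?case unfolding measure_curvature_event[OF elim]
      by (rule prob_space.prob_le_1[OF prob_space_gmeas[OF finite_exponents]])
  qed
qed

end
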